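(* For every $\varepsilon\ge 0$, the stopping time $U_\varepsilon=\inf\{t\ge 0: V(\widetilde{\Phi}_t)\ge-\varepsilon\}$ is $\varepsilon$-optimal for the optimal stopping problem defining $V$, that is, $$\mathbb E_0^{\phi_0,\phi_1}\Big[\int_0^{U_\varepsilon}e^{-\lambda s}g(\widetilde\Phi_s)\,ds\Big]\le V(\phi_0,\phi_1)+\varepsilon\qquad\text{for every }(\phi_0,\phi_1)\in\mathbb R_+^2.$$
   Context: Fix constants $\lambda>0$, $\mu>1$, $c>0$, $m\in(-1,1)$; $\mathbb R_+=[0,\infty)$. On a probability space $(\Omega,\mathcal H,\mathbb P_0)$ let $N$ be a homogeneous Poisson process with rate $\mu$ and jump times $0=\sigma_0<\sigma_1<\sigma_2<\cdots$; $\mathbb F$ is the right-continuous enlargement with $\mathbb P_0$-null sets of its natural filtration, and $\mathcal S$ is the collection of all $\mathbb F$-stopping times. For $\phi_0,\phi_1\in\mathbb R$ let $x(t,\phi_0)$, $y(t,\phi_1)$, $t\in\mathbb R$, be the solutions of $$\frac{d}{dt}x(t,\phi_0)=(\lambda+1)x(t,\phi_0)+\frac{\lambda(1-m)}{\sqrt2},\ x(0,\phi_0)=\phi_0;\qquad \frac{d}{dt}y(t,\phi_1)=(\lambda-1)y(t,\phi_1)+\frac{\lambda(1+m)}{\sqrt2},\ y(0,\phi_1)=\phi_1,$$ and let $S(\phi_0,\phi_1)=\big((1-\frac1\mu)\phi_0,(1+\frac1\mu)\phi_1\big)$. The process $\widetilde\Phi=(\widetilde\Phi^{(0)},\widetilde\Phi^{(1)})$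 in $\mathbb R_+^2$ started at $(\phi_0,\phi_1)$ satisfies $\widetilde\Phi_0=(\phi_0,\phi_1)$, $\widetilde\Phi_t=\big(x(t-\sigma_n,\widetilde\Phi^{(0)}_{\sigma_n}),y(t-\sigma_n,\widetilde\Phi^{(1)}_{\sigma_n})\big)$ for $\sigma_n\le t<\sigma_{n+1}$, $n\ge0$, and $\widetilde\Phi_{\sigma_n}=S(\widetilde\Phi_{\sigma_n-})$ for $n\ge1$. $\mathbb E_0^{\phi_0,\phi_1}$ is the $\mathbb P_0$-expectation when $\widetilde\Phi_0=(\phi_0,\phi_1)$. With $g(\phi_0,\phi_1)=\phi_0+\phi_1-\frac{\lambda}{c}\sqrt2$, the value function is $$V(\phi_0,\phi_1)=\inf_{\tau\in\mathcal S}\mathbb E_0^{\phi_0,\phi_1}\Big[\int_0^\tau e^{-\lambda t}g(\widetilde\Phi_t)\,dt\Big],\qquad(\phi_0,\phi_1)\in\mathbb R_+^2.$$ *)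

theory Defs
  imports "HOL-Probability.Probability"
begin

text \<open>Every path is a counting path: on \<open>t \<ge> 0\<close> the event \<open>N\<^sub>t = n\<close> is exactly
  \<open>\<sigma>\<^sub>n \<le> t < \<sigma>\<^sub>n\<^sub>+\<^sub>1\<close>, which determines \<open>\<sigma>\<close> from \<open>N\<close> and forces \<open>\<sigma>\<^sub>n\<close> to tend to infinity.
  Paths are nondecreasing, so the natural-number subtractions below never truncate.\<close>

definition homogeneous_poisson_process ::
    "'a measure \<Rightarrow> real \<Rightarrow> (real \<Rightarrow> 'a \<Rightarrow> nat) \<Rightarrow> (nat \<Rightarrow> 'a \<Rightarrow> real) \<Rightarrow> bool" where
  "homogeneous_poisson_process M \<mu> N \<sigma> \<longleftrightarrow>
     (\<forall>t\<ge>0. N t \<in> measurable M (count_space UNIV)) \<and>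
     (\<forall>\<omega>\<in>space M. \<sigma> 0 \<omega> = 0 \<and> strict_mono (\<lambda>n. \<sigma> n \<omega>) \<and>
        (\<forall>t\<ge>0. \<forall>n. N t \<omega> = n \<longleftrightarrow> \<sigma> n \<omega> \<le> t \<and> t < \<sigma> (Suc n) \<omega>)) \<and>
     (\<forall>s t. 0 \<le> s \<longrightarrow> s < t \<longrightarrow>
        distr M (count_space UNIV) (\<lambda>\<omega>. N t \<omega> - N s \<omega>) = measure_pmf (poisson_pmf (\<mu> * (t - s)))) \<and>
     (\<forall>(r :: nat \<Rightarrow> real) k. 0 \<le> r 0 \<longrightarrow> strict_mono r \<longrightarrow>
        prob_space.indep_vars M (\<lambda>_. count_space UNIV)
          (\<lambda>i \<omega>. N (r (Suc i)) \<omega> - N (r i) \<omega>) {..<k})"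

definition natural_events :: "'a measure \<Rightarrow> (real \<Rightarrow> 'a \<Rightarrow> nat) \<Rightarrow> real \<Rightarrow> 'a set set" where
  "natural_events M N s = sigma_sets (space M) {N u -` A \<inter> space M | u A. 0 \<le> u \<and> u \<le> s}"

text \<open>Right-continuous enlargement, with null sets, of the natural filtration. Time is
  \<open>[0, \<infinity>]\<close>, so that stopping times may be infinite. For finite \<open>t\<close> the conjunct \<open>A \<in> sets M\<close> is
  redundant; at \<open>t = \<infinity>\<close>, where the intersection is over no \<open>s\<close>, it gives the full sigma-algebra,
  which does not affect the notion of stopping time.\<close>

definition augmented_filtration :: "'a measure \<Rightarrow> (real \<Rightarrow> 'a \<Rightarrow> nat) \<Rightarrow> ennreal \<Rightarrow> 'a measure" where
  "augmented_filtration M N t =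
     sigma (space M) {A \<in> sets M. \<forall>s\<ge>0. t < ennreal s \<longrightarrow>
                        A \<in> sigma_sets (space M) (natural_events M N s \<union> null_sets M)}"

text \<open>Integral with values in the extended reals, as the difference of the integrals of the positive
  and negative parts. It is needed because costs over an unbounded time horizon may be \<open>+\<infinity>\<close>;
  below, the integral of the negative part is always finite.\<close>

definition ext_integral :: "'a measure \<Rightarrow> ('a \<Rightarrow> ereal) \<Rightarrow> ereal" where
  "ext_integral M f = enn2ereal (\<integral>\<^sup>+ x. e2ennreal (f x) \<partial>M) - enn2ereal (\<integral>\<^sup>+ x. e2ennreal (- f x) \<partial>M)"

definition running_cost :: "real \<Rightarrow> real \<Rightarrow> real \<times> real \<Rightarrow> real" where
  "running_cost lam c p = fst p + snd p - lam / c * sqrt 2"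

definition jump_map :: "real \<Rightarrow> real \<times> real \<Rightarrow> real \<times> real" where
  "jump_map \<mu> p = ((1 - 1 / \<mu>) * fst p, (1 + 1 / \<mu>) * snd p)"

text \<open>In the following, \<open>\<Phi> p t \<omega>\<close> is the state at time \<open>t\<close> of the process started at \<open>p\<close>.\<close>

definition expected_cost ::
    "'a measure \<Rightarrow> real \<Rightarrow> real \<Rightarrow> (real \<times> real \<Rightarrow> real \<Rightarrow> 'a \<Rightarrow> real \<times> real)
      \<Rightarrow> real \<times> real \<Rightarrow> ('a \<Rightarrow> ennreal) \<Rightarrow> ereal" where
  "expected_cost M lam c \<Phi> p \<tau> =
     ext_integral M (\<lambda>\<omega>. ext_integral lborel (\<lambda>t.
       ereal (indicator {t. 0 \<le> t \<and> ennreal t \<le> \<tau> \<omega>} t *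
              (exp (- lam * t) * running_cost lam c (\<Phi> p t \<omega>)))))"

definition value_function ::
    "'a measure \<Rightarrow> (real \<Rightarrow> 'a \<Rightarrow> nat) \<Rightarrow> real \<Rightarrow> real
      \<Rightarrow> (real \<times> real \<Rightarrow> real \<Rightarrow> 'a \<Rightarrow> real \<times> real) \<Rightarrow> real \<times> real \<Rightarrow> ereal" where
  "value_function M N lam c \<Phi> p =
     (INF \<tau>\<in>{\<tau>. stopping_time (augmented_filtration M N) \<tau>}. expected_cost M lam c \<Phi> p \<tau>)"

definition hitting_time ::
    "'a measure \<Rightarrow> (real \<Rightarrow> 'a \<Rightarrow> nat) \<Rightarrow> real \<Rightarrow> real
      \<Rightarrow> (real \<times> real \<Rightarrow> real \<Rightarrow> 'a \<Rightarrow> real \<times> real) \<Rightarrow> real \<Rightarrow> real \<times> real \<Rightarrow> 'a \<Rightarrow> ennreal" where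
  "hitting_time M N lam c \<Phi> \<epsilon> p \<omega> =
     Inf (ennreal ` {t. 0 \<le> t \<and> value_function M N lam c \<Phi> (\<Phi> p t \<omega>) \<ge> ereal (- \<epsilon>)})"

end

theory Submission
  imports Defs
begin

text \<open>
  Put \<open>K = sqrt 2 / c\<close>. Since \<open>g(\<phi>) = \<phi>\<^sub>0 + \<phi>\<^sub>1 - lam K\<close>, adding \<open>K\<close> to the cost of \<open>\<tau>\<close> gives
  the expectation of the nonnegative quantity
  \<open>\<integral>\<^sub>0\<^sup>\<tau> exp(-lam t) (\<Phi>\<^sup>0 + \<Phi>\<^sup>1) dt + K exp(-lam \<tau>)\<close>. For stopping on the grid of mesh \<open>h = 1 / 2^k\<close>,
  backward induction yields a value \<open>r\<^sub>k = min K (Q\<^sub>h r\<^sub>k)\<close>; only the Markov property at deterministic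
  times is needed, and it follows from the independent stationary increments because the state is an
  explicit affine function of its starting point along each counting path. The \<open>r\<^sub>k\<close> decrease to a limit
  \<open>r\<close> and share a modulus of continuity. Rounding an arbitrary stopping time up to the grid shows that
  \<open>r\<close> is a lower bound for all costs. For \<open>\<epsilon> > 0\<close> the set where \<open>r + \<epsilon> \<le> K\<close> is closed, so on its
  bounded part compactness gives \<open>r\<^sub>k < K\<close> for large \<open>k\<close>, hence \<open>r\<^sub>k = Q\<^sub>h r\<^sub>k\<close>; therefore optional
  stopping up to \<open>U\<^sub>\<epsilon>\<close> loses nothing, and Fatou's lemma makes \<open>U\<^sub>\<epsilon>\<close> \<open>\<epsilon>\<close>-optimal. For \<open>\<epsilon> = 0\<close> let
  \<open>\<epsilon>\<close> decrease to 0: the times \<open>U\<^sub>\<epsilon>\<close> increase to \<open>U\<^sub>0\<close> almost surely, because a jump of \<open>N\<close> cannot be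
  announced by a sequence of stopping times.
\<close>

section \<open>Counting paths and the flow along a path\<close>

text \<open>K is the total discounted mass of the rate lam K, so what this rate collects before
  \<tau> plus K exp(-lam \<tau>) is always K. The shift removes questions of sign and integrability,
  and V \<ge> -\<epsilon> becomes K \<le> r + \<epsilon>. The common modulus rests on a
  cancellation. Two states driven by the same path differ in their coordinates by multiples of
  exp((lam + 1) t) (1 - 1/\<mu>)^N and exp((lam - 1) t) (1 + 1/\<mu>)^N, and a Poisson process of
  rate \<mu> averages the powers to exp(-t) and exp(t). The expected discounted distance is
  therefore constant in time, so the value with horizon T is T-Lipschitz, while forcing a stop at T
  costs at most K exp(-lam T). Neither bound involves the mesh. Two obstacles shape the rest. States
  are unbounded, so compactness is used only for paths with at most B jumps up to T; then B and T
  tend to infinity. The state is only right continuous, so limits of times from the right are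
  harmless, but limits from the left, as for \<epsilon> decreasing to 0, are not.\<close>

definition counting_path :: "(real \<Rightarrow> nat) \<Rightarrow> bool" where
  "counting_path w \<longleftrightarrow> mono w \<and> (\<forall>t. \<exists>d>0. \<forall>s. t \<le> s \<longrightarrow> s < t + d \<longrightarrow> w s = w t)"

text \<open>Clamping negative arguments to 0 keeps the increments after \<open>t\<close> a counting
  path on the whole real line.\<close>

definition shift_path :: "real \<Rightarrow> (real \<Rightarrow> nat) \<Rightarrow> real \<Rightarrow> nat" where
  "shift_path t w u = w (t + max 0 u) - w t"

abbreviation path_space :: "(real \<Rightarrow> nat) measure" where
  "path_space \<equiv> PiM UNIV (\<lambda>_. count_space UNIV)"

text \<open>Evaluation \<open>w s\<close> is not jointly measurable on the uncountable product \<open>path_space\<close>. This right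
  limit along dyadic times is, and it agrees with \<open>w s\<close> on counting paths.\<close>

definition regularize :: "(real \<Rightarrow> nat) \<Rightarrow> real \<Rightarrow> nat" where
  "regularize w s = nat \<lfloor>lim (\<lambda>j. real (w (real_of_int (\<lfloor>2 ^ j * s\<rfloor> + 1) / 2 ^ j)))\<rfloor>"

lemma dyadic_above:
  "s < real_of_int (\<lfloor>2 ^ j * s\<rfloor> + 1) / 2 ^ j" "real_of_int (\<lfloor>2 ^ j * s\<rfloor> + 1) / 2 ^ j \<le> s + 1 / 2 ^ j"
proof -
  have "2 ^ j * s < real_of_int (\<lfloor>2 ^ j * s\<rfloor> + 1)" by linarith
  then show "s < real_of_int (\<lfloor>2 ^ j * s\<rfloor> + 1) / 2 ^ j" by (simp add: field_simps)
  have "real_of_int (\<lfloor>2 ^ j * s\<rfloor> + 1) \<le> 2 ^ j * s + 1" by linarith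
  then show "real_of_int (\<lfloor>2 ^ j * s\<rfloor> + 1) / 2 ^ j \<le> s + 1 / 2 ^ j" by (simp add: field_simps)
qed

lemma counting_pathD:
  assumes "counting_path w"
  shows "mono w" "\<exists>d>0. \<forall>s. t \<le> s \<longrightarrow> s < t + d \<longrightarrow> w s = w t"
  using assms by (auto simp: counting_path_def)

text \<open>The dyadic points lie strictly to the right of \<open>s\<close> and within 2^-j of it,
  so they eventually enter the interval on which \<open>w\<close> still equals
  \<open>w s\<close>.\<close>

lemma regularize_eq:
  assumes "counting_path w"
  shows "regularize w s = w s"
proof -
  obtain d where d: "d > 0" "\<And>u. s \<le> u \<Longrightarrow> u < s + d \<Longrightarrow> w u = w s"
    using counting_pathD(2)[OF assms, of s] by blast
  have "eventually (\<lambda>j. 1 / 2 ^ j < d) sequentially"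
    using order_tendstoD(2)[OF LIMSEQ_divide_realpow_zero[of 2 1]] d(1) by simp
  then have "eventually (\<lambda>j. real (w (real_of_int (\<lfloor>2 ^ j * s\<rfloor> + 1) / 2 ^ j)) = real (w s)) sequentially"
  proof eventually_elim
    case (elim j)
    show ?case using d(2)[of "real_of_int (\<lfloor>2 ^ j * s\<rfloor> + 1) / 2 ^ j"] dyadic_above[where s=s and j=j] elim by simp
  qed
  then have "(\<lambda>j. real (w (real_of_int (\<lfloor>2 ^ j * s\<rfloor> + 1) / 2 ^ j))) \<longlonglongrightarrow> real (w s)"
    by (rule tendsto_eventually)
  then show ?thesis by (simp add: regularize_def limI)
qed

lemma regularize_eq_fun: "counting_path w \<Longrightarrow> regularize w = w"
  by (rule ext) (rule regularize_eq)

text \<open>For fixed j the index \<open>\<lfloor>2 ^ j * f x\<rfloor>\<close> takes countably many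
  values, and for each of them the expression is a coordinate of the product. Joint measurability in
  time and path is what Fubini and the Markov property require later.\<close>

lemma measurable_regularize [measurable (raw)]:
  assumes [measurable]: "f \<in> borel_measurable Q" "g \<in> measurable Q path_space"
  shows "(\<lambda>x. regularize (g x) (f x)) \<in> measurable Q (count_space UNIV)"
proof -
  have 1: "(\<lambda>x. real (g x (real_of_int (\<lfloor>2 ^ j * f x\<rfloor> + 1) / 2 ^ j))) \<in> borel_measurable Q" for j :: nat
  proof (rule measurable_compose_countable[where g="\<lambda>x. \<lfloor>2 ^ j * f x\<rfloor>" and f="\<lambda>i x. real (g x (real_of_int (i + 1) / 2 ^ j))"])
    fix i :: int
    have "(\<lambda>x. g x (real_of_int (i + 1) / 2 ^ j)) \<in> measurable Q (count_space UNIV)"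
      by (rule measurable_compose[OF assms(2) measurable_component_singleton]) simp
    then show "(\<lambda>x. real (g x (real_of_int (i + 1) / 2 ^ j))) \<in> borel_measurable Q" by measurable
  qed measurable
  show ?thesis unfolding regularize_def using 1 by measurable
qed

lemma counting_path_measurable:
  assumes "counting_path w"
  shows "w \<in> measurable borel (count_space UNIV)"
proof -
  have "(\<lambda>s. regularize w s) \<in> measurable borel (count_space UNIV)"
    by (rule measurable_regularize) (auto simp: space_PiM)
  then show ?thesis by (simp add: regularize_eq_fun[OF assms])
qed

lemma shift_path_simps:
  "shift_path t w 0 = 0" "u \<ge> 0 \<Longrightarrow> shift_path t w u = w (t + u) - w t"
  by (auto simp: shift_path_def)

lemma counting_path_shift:
  assumes "counting_path w"
  shows "counting_path (shift_path t w)"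
proof -
  have m: "mono w" using assms by (simp add: counting_path_def)
  have "mono (shift_path t w)"
    unfolding shift_path_def by (intro monoI diff_le_mono monoD[OF m]) auto
  moreover have "\<exists>d>0. \<forall>s. u \<le> s \<longrightarrow> s < u + d \<longrightarrow> shift_path t w s = shift_path t w u" for u
  proof -
    obtain d where d: "d > 0" "\<And>s. t + max 0 u \<le> s \<Longrightarrow> s < t + max 0 u + d \<Longrightarrow> w s = w (t + max 0 u)"
      using counting_pathD(2)[OF assms, of "t + max 0 u"] by blast
    show ?thesis
    proof (intro exI conjI allI impI)
      show "d > 0" by fact
      fix s assume "u \<le> s" "s < u + d"
      then have "w (t + max 0 s) = w (t + max 0 u)"
        using d(1) by (intro d(2)) auto
      then show "shift_path t w s = shift_path t w u"
        unfolding shift_path_def by simp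
    qed
  qed
  ultimately show ?thesis by (simp add: counting_path_def)
qed

text \<open>The stopped path depends only on values up to \<open>t\<close>; substituting it for the
  path turns adaptedness into measurability with respect to the past.\<close>

lemma counting_path_stop:
  assumes "counting_path w"
  shows "counting_path (\<lambda>u. w (min t u))"
proof -
  have m: "mono w" using assms by (simp add: counting_path_def)
  have "mono (\<lambda>u. w (min t u))" by (intro monoI monoD[OF m]) auto
  moreover have "\<exists>d>0. \<forall>s. u \<le> s \<longrightarrow> s < u + d \<longrightarrow> w (min t s) = w (min t u)" for u
  proof -
    obtain d where d: "d > 0" "\<And>s. min t u \<le> s \<Longrightarrow> s < min t u + d \<Longrightarrow> w s = w (min t u)"
      using counting_pathD(2)[OF assms, of "min t u"] by blast
    have "w (min t s) = w (min t u)" if "u \<le> s" "s < u + d" for s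
      by (rule d(2)) (use d(1) that in \<open>auto simp: min_def\<close>)
    then show ?thesis using d(1) by blast
  qed
  ultimately show ?thesis by (simp add: counting_path_def)
qed

text \<open>Variation of constants for v' = \<rho> v + a with v multiplied by z at each unit jump of
  w: exp(\<rho> t) z^(w t) solves the homogeneous equation, and the integrand is a divided by it.
  Both coordinates of the state have this form.\<close>

definition flow :: "real \<Rightarrow> real \<Rightarrow> real \<Rightarrow> (real \<Rightarrow> nat) \<Rightarrow> real \<Rightarrow> real \<Rightarrow> real" where
  "flow \<rho> z a w v t = exp (\<rho> * t) * z ^ w t *
     (v + (\<integral>s. indicator {0..t} s * (a * exp (- \<rho> * s) / z ^ w s) \<partial>lborel))"

lemma flow_density_bound:
  assumes "counting_path w" "z > 0" "0 \<le> s" "s \<le> T"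
  shows "\<bar>a * exp (- \<rho> * s) / z ^ w s\<bar> \<le> \<bar>a\<bar> * exp (\<bar>\<rho>\<bar> * T) * max 1 (1/z) ^ w T"
proof -
  have "w s \<le> w T" using assms by (auto simp: counting_path_def mono_def)
  have 1: "exp (- \<rho> * s) \<le> exp (\<bar>\<rho>\<bar> * T)"
  proof -
    have "- \<rho> * s \<le> \<bar>\<rho>\<bar> * s" using assms by (intro mult_right_mono) auto
    also have "\<dots> \<le> \<bar>\<rho>\<bar> * T" using assms by (intro mult_left_mono) auto
    finally show ?thesis by simp
  qed
  have "(1/z) ^ w s \<le> max 1 (1/z) ^ w s" using assms by (intro power_mono) auto
  also have "\<dots> \<le> max 1 (1/z) ^ w T" using \<open>w s \<le> w T\<close> by (intro power_increasing) auto
  finally have 2: "1 / z ^ w s \<le> max 1 (1/z) ^ w T" by (simp add: power_one_over)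
  have "\<bar>a * exp (- \<rho> * s) / z ^ w s\<bar> = \<bar>a\<bar> * exp (- \<rho> * s) * (1 / z ^ w s)"
    using assms by (simp add: abs_mult)
  also have "\<dots> \<le> \<bar>a\<bar> * exp (\<bar>\<rho>\<bar> * T) * max 1 (1/z) ^ w T"
    using 1 2 assms by (intro mult_mono) auto
  finally show ?thesis .
qed

lemma flow_density_integrable:
  assumes "counting_path w" "z > 0" and that: "0 \<le> t"
  shows "set_integrable lborel {t..T} (\<lambda>s. a * exp (- \<rho> * s) / z ^ w s)"
proof -
  have [measurable]: "w \<in> measurable borel (count_space UNIV)"
    by (rule counting_path_measurable) fact
  show ?thesis unfolding set_integrable_def
    by (rule integrableI_bounded_set_indicator[where B="\<bar>a\<bar> * exp (\<bar>\<rho>\<bar> * T) * max 1 (1/z) ^ w T"])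
       (use flow_density_bound[OF assms(1,2), of _ T a \<rho>] that in \<open>auto simp: emeasure_lborel_Icc_eq simp del: emeasure_lborel_Icc\<close>)
qed

text \<open>The Lebesgue form suits measurability in the path; the gauge integral offers splitting
  of intervals and continuity in the upper limit.\<close>

lemma flow_eq_HK:
  assumes "counting_path w" "z > 0"
  shows "flow \<rho> z a w v t = exp (\<rho> * t) * z ^ w t * (v + integral {0..t} (\<lambda>s. a * exp (- \<rho> * s) / z ^ w s))"
    and "(\<lambda>s. a * exp (- \<rho> * s) / z ^ w s) integrable_on {0..t}"
  using set_borel_integral_eq_integral[OF flow_density_integrable[OF assms, of 0 t a \<rho>]]
  by (simp_all add: flow_def set_lebesgue_integral_def)

lemma flow_0: "w 0 = 0 \<Longrightarrow> counting_path w \<Longrightarrow> z > 0 \<Longrightarrow> flow \<rho> z a w v 0 = v"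
  by (simp add: flow_eq_HK)

lemma flow_nonneg: "z > 0 \<Longrightarrow> a \<ge> 0 \<Longrightarrow> v \<ge> 0 \<Longrightarrow> flow \<rho> z a w v t \<ge> 0"
  unfolding flow_def by (intro mult_nonneg_nonneg add_nonneg_nonneg integral_nonneg_AE) auto

text \<open>The inhomogeneous term does not see the starting value and cancels, so the distance of
  two states depends on the path only through the number of jumps.\<close>

lemma flow_diff: "flow \<rho> z a w v t - flow \<rho> z a w v' t = exp (\<rho> * t) * z ^ w t * (v - v')"
  by (simp add: flow_def algebra_simps)

text \<open>Splitting the integral at \<open>t\<close> and translating its second part brings out
  the homogeneous factor at \<open>t\<close>. This restart property lets independence of increments
  act as a Markov property of the state.\<close>

lemma flow_add:
  assumes w: "counting_path w" "z > 0" and t: "0 \<le> t" "0 \<le> s"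
  shows "flow \<rho> z a w v (t + s) = flow \<rho> z a (shift_path t w) (flow \<rho> z a w v t) s"
proof -
  let ?f = "\<lambda>s. a * exp (- \<rho> * s) / z ^ w s"
  let ?g = "\<lambda>u. a * exp (- \<rho> * u) / z ^ shift_path t w u"
  have m: "w t \<le> w (t + u)" if "u \<ge> 0" for u using w that by (auto simp: counting_path_def mono_def)
  have "integral {0..t+s} ?f = integral {0..t} ?f + integral {t..t+s} ?f"
    using t by (intro Henstock_Kurzweil_Integration.integral_combine[symmetric] flow_eq_HK(2) w) auto
  also have "integral {t..t+s} ?f = integral {0..s} (\<lambda>u. ?f (u + t))"
  proof -
    have "(?f has_integral integral {t..t+s} ?f) {t..t+s}"
      using flow_density_integrable[OF w t(1), THEN set_borel_integral_eq_integral(1)]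
      by (rule integrable_integral)
    then have "((?f \<circ> (+) t) has_integral integral {t..t+s} ?f) {0..s}"
      using has_integral_shift_cbox_iff[of ?f t _ 0 s] by (simp add: add.commute)
    then show ?thesis by (simp add: integral_unique comp_def add.commute)
  qed
  also have "\<dots> = integral {0..s} (\<lambda>u. (exp (- \<rho> * t) / z ^ w t) * ?g u)"
    using m w by (intro Henstock_Kurzweil_Integration.integral_cong)
      (auto simp: shift_path_simps power_diff exp_add[symmetric] algebra_simps field_simps)
  also have "\<dots> = (exp (- \<rho> * t) / z ^ w t) * integral {0..s} ?g"
    by (rule Henstock_Kurzweil_Integration.integral_mult_right)
  finally have I: "integral {0..t+s} ?f = integral {0..t} ?f + (exp (- \<rho> * t) / z ^ w t) * integral {0..s} ?g" .
  have e: "exp (- \<rho> * t) = 1 / exp (\<rho> * t)" by (simp add: exp_minus field_simps)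
  have zz: "z ^ w (t + s) = z ^ w t * z ^ shift_path t w s"
    using m[OF t(2)] t by (simp add: shift_path_simps power_add[symmetric])
  show ?thesis
    unfolding flow_eq_HK(1)[OF w] flow_eq_HK(1)[OF counting_path_shift[OF w(1)] w(2)] I zz e
    using w(2) by (simp add: field_simps exp_add)
qed

text \<open>The factor \<open>max 1 z * max 1 (1/z)\<close> covers both the power of z in front and
  its reciprocal in the integral, whether z is below or above 1. The path enters only through a
  count, so Poisson moments and bounds on the count apply directly.\<close>

definition flow_bound :: "real \<Rightarrow> real \<Rightarrow> real \<Rightarrow> real \<Rightarrow> real \<Rightarrow> nat \<Rightarrow> real" where
  "flow_bound \<rho> z a v T n = exp (\<bar>\<rho>\<bar> * T) * (\<bar>v\<bar> + T * (\<bar>a\<bar> * exp (\<bar>\<rho>\<bar> * T))) * (max 1 z * max 1 (1/z)) ^ n"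

lemma flow_bound:
  assumes w: "counting_path w" "z > 0" and t: "0 \<le> t" "t \<le> T"
  shows "\<bar>flow \<rho> z a w v t\<bar> \<le> flow_bound \<rho> z a v T (w T)"
proof -
  let ?f = "\<lambda>s. a * exp (- \<rho> * s) / z ^ w s"
  let ?Z = "max 1 (1/z) ^ w T"
  have "w t \<le> w T" using w t by (auto simp: counting_path_def mono_def)
  have Z: "?Z \<ge> 1" by (intro one_le_power) auto
  have "norm (integral {0..t} ?f) \<le> (\<bar>a\<bar> * exp (\<bar>\<rho>\<bar> * T) * ?Z) * Henstock_Kurzweil_Integration.content {0..t}"
    using t flow_density_bound[OF w, of _ T a \<rho>]
    by (intro has_integral_bound_real[OF _ _ integrable_integral[OF flow_eq_HK(2)[OF w]], of _ "{}"]) auto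
  also have "\<dots> = (\<bar>a\<bar> * exp (\<bar>\<rho>\<bar> * T) * ?Z) * t" using t by simp
  also have "\<dots> \<le> (\<bar>a\<bar> * exp (\<bar>\<rho>\<bar> * T) * ?Z) * T" using t by (intro mult_left_mono) auto
  finally have 1: "\<bar>integral {0..t} ?f\<bar> \<le> \<bar>a\<bar> * exp (\<bar>\<rho>\<bar> * T) * ?Z * T" by simp
  have "\<bar>v + integral {0..t} ?f\<bar> \<le> \<bar>v\<bar> * ?Z + \<bar>a\<bar> * exp (\<bar>\<rho>\<bar> * T) * ?Z * T"
    using 1 mult_left_mono[OF Z, of "\<bar>v\<bar>"] abs_triangle_ineq[of v "integral {0..t} ?f"] by linarith
  also have "\<dots> = (\<bar>v\<bar> + T * (\<bar>a\<bar> * exp (\<bar>\<rho>\<bar> * T))) * ?Z" by (simp add: algebra_simps)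
  finally have 2: "\<bar>v + integral {0..t} ?f\<bar> \<le> (\<bar>v\<bar> + T * (\<bar>a\<bar> * exp (\<bar>\<rho>\<bar> * T))) * ?Z" .
  have "\<rho> * t \<le> \<bar>\<rho>\<bar> * t" using t by (intro mult_right_mono) auto
  also have "\<dots> \<le> \<bar>\<rho>\<bar> * T" using t by (intro mult_left_mono) auto
  finally have 3: "exp (\<rho> * t) \<le> exp (\<bar>\<rho>\<bar> * T)" by simp
  have "z ^ w t \<le> max 1 z ^ w t" using w by (intro power_mono) auto
  also have "\<dots> \<le> max 1 z ^ w T" using \<open>w t \<le> w T\<close> by (intro power_increasing) auto
  finally have 4: "z ^ w t \<le> max 1 z ^ w T" .
  have "\<bar>flow \<rho> z a w v t\<bar> = exp (\<rho> * t) * z ^ w t * \<bar>v + integral {0..t} ?f\<bar>"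
    using w by (simp add: flow_eq_HK abs_mult)
  also have "\<dots> \<le> exp (\<bar>\<rho>\<bar> * T) * max 1 z ^ w T * ((\<bar>v\<bar> + T * (\<bar>a\<bar> * exp (\<bar>\<rho>\<bar> * T))) * ?Z)"
    using 2 3 4 w t by (intro mult_mono) auto
  also have "\<dots> = flow_bound \<rho> z a v T (w T)"
    by (simp add: flow_bound_def power_mult_distrib)
  finally show ?thesis .
qed

lemma flow_bound_mono:
  assumes "n \<le> k" "0 \<le> T"
  shows "flow_bound \<rho> z a v T n \<le> flow_bound \<rho> z a v T k"
proof -
  have "1 \<le> max 1 z * max 1 (1/z)" using mult_mono[of 1 "max 1 z" 1 "max 1 (1/z)"] by simp
  then show ?thesis unfolding flow_bound_def using assms by (intro mult_left_mono power_increasing) auto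
qed

lemma continuous_flow_integral:
  assumes w: "counting_path w" "z > 0"
  shows "continuous_on {0..T} (\<lambda>t. integral {0..t} (\<lambda>s. a * exp (- \<rho> * s) / z ^ w s))"
  by (rule indefinite_integral_continuous_1) (rule flow_eq_HK(2)[OF w])

lemma continuous_on_flow:
  assumes w: "counting_path w" "z > 0" and S: "S \<subseteq> {0..T}" and c: "\<And>s. s \<in> S \<Longrightarrow> w s = n"
  shows "continuous_on S (flow \<rho> z a w v)"
proof -
  have "continuous_on S (\<lambda>t. exp (\<rho> * t) * z ^ n * (v + integral {0..t} (\<lambda>s. a * exp (- \<rho> * s) / z ^ w s)))"
    by (intro continuous_intros continuous_on_subset[OF continuous_flow_integral[OF w] S])
  then show ?thesis
    by (rule continuous_on_eq) (simp add: flow_eq_HK(1)[OF w] c)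
qed

lemma flow_zero_path:
  assumes "z > 0" "0 \<le> t" "\<And>s. 0 \<le> s \<Longrightarrow> s \<le> t \<Longrightarrow> w s = 0" "counting_path w"
  shows "flow \<rho> z a w v t = exp (\<rho> * t) * (v + integral {0..t} (\<lambda>s. a * exp (- \<rho> * s)))"
proof -
  have "integral {0..t} (\<lambda>s. a * exp (- \<rho> * s) / z ^ w s) = integral {0..t} (\<lambda>s. a * exp (- \<rho> * s))"
    using assms by (intro Henstock_Kurzweil_Integration.integral_cong) auto
  then show ?thesis using assms by (simp add: flow_eq_HK)
qed

text \<open>With the integrating factor exp(-\<rho> s) the derivative becomes a exp(-\<rho> s). The
  integral stays unevaluated, so \<rho> = 0, which occurs for lam = 1, is no special case.\<close>

lemma linear_ode_unique:
  fixes f :: "real \<Rightarrow> real"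
  assumes "\<And>t. (f has_real_derivative \<rho> * f t + a) (at t)" "0 \<le> t"
  shows "f t = exp (\<rho> * t) * (f 0 + integral {0..t} (\<lambda>s. a * exp (- \<rho> * s)))"
proof -
  have "((\<lambda>s. a * exp (- \<rho> * s)) has_integral (exp (- \<rho> * t) * f t - exp (- \<rho> * 0) * f 0)) {0..t}"
  proof (rule fundamental_theorem_of_calculus)
    fix s assume "s \<in> {0..t}"
    have "((\<lambda>s. exp (- \<rho> * s) * f s) has_real_derivative (a * exp (- \<rho> * s))) (at s)"
      by (auto intro!: derivative_eq_intros assms(1) simp: algebra_simps)
    then show "((\<lambda>s. exp (- \<rho> * s) * f s) has_vector_derivative a * exp (- \<rho> * s)) (at s within {0..t})"
      using has_field_derivative_at_within has_real_derivative_iff_has_vector_derivative by blast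
  qed fact
  then have "integral {0..t} (\<lambda>s. a * exp (- \<rho> * s)) = exp (- \<rho> * t) * f t - f 0"
    by (auto dest: integral_unique)
  then show ?thesis by (simp add: exp_minus field_simps)
qed

lemma measurable_flow [measurable (raw)]:
  assumes [measurable]: "f \<in> borel_measurable Q" "h \<in> borel_measurable Q" "g \<in> measurable Q path_space"
  shows "(\<lambda>x. flow \<rho> z a (regularize (g x)) (f x) (h x)) \<in> borel_measurable Q"
proof -
  have "(\<lambda>x. \<integral>s. indicator {0..h x} s * (a * exp (- \<rho> * s) / z ^ regularize (g x) s) \<partial>lborel) \<in> borel_measurable Q"
    unfolding indicator_def by (rule lborel.borel_measurable_lebesgue_integral) (simp, measurable)
  then show ?thesis unfolding flow_def by measurable
qed

section \<open>The Markov property of the Poisson process\<close>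

text \<open>Independence of increments is given along infinite strictly increasing sequences. The
  finitely many times of a cylinder are therefore sorted and continued beyond their maximum, and
  \<open>idx\<close> locates each of them in the sequence.\<close>

lemma finite_set_grid:
  fixes S :: "real set"
  assumes "finite S" "0 \<in> S" "S \<subseteq> {0..}"
  shows "\<exists>r k idx. strict_mono (r :: nat \<Rightarrow> real) \<and> r 0 = 0 \<and> (\<forall>u\<in>S. idx u < k \<and> r (idx u) = u)"
proof -
  define xs where "xs = sorted_list_of_set S"
  have xs: "set xs = S" "sorted xs" "distinct xs" using assms by (auto simp: xs_def)
  then have ne: "xs \<noteq> []" using assms by auto
  define r where "r i = (if i < length xs then xs ! i else Max S + 1 + real i)" for i
  have "strict_mono r"
  proof (rule strict_monoI)
    fix i j :: nat assume ij: "i < j"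
    show "r i < r j"
    proof (cases "j < length xs")
      case True
      then have "xs ! i \<le> xs ! j" using ij xs by (intro sorted_nth_mono) auto
      moreover have "xs ! i \<noteq> xs ! j" using ij True xs by (auto simp: nth_eq_iff_index_eq)
      ultimately show ?thesis using True ij by (auto simp: r_def)
    next
      case False
      show ?thesis
      proof (cases "i < length xs")
        case True
        then have "xs ! i \<le> Max S" using xs assms by (intro Max_ge) auto
        then show ?thesis using True False by (simp add: r_def)
      qed (use ij False in \<open>auto simp: r_def\<close>)
    qed
  qed
  moreover have "r 0 = 0"
  proof -
    obtain i where i: "i < length xs" "xs ! i = 0" using xs assms by (metis in_set_conv_nth)
    have "xs ! 0 \<le> xs ! i" using i xs by (intro sorted_nth_mono) auto
    moreover have "xs ! 0 \<in> S" using ne xs by (metis length_greater_0_conv nth_mem)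
    ultimately show ?thesis using i assms ne by (auto simp: r_def)
  qed
  moreover have "\<exists>i. i < length xs \<and> r i = u" if "u \<in> S" for u
    using that xs by (metis in_set_conv_nth r_def)
  then obtain idx where "\<And>u. u \<in> S \<Longrightarrow> idx u < length xs \<and> r (idx u) = u" by metis
  ultimately show ?thesis by blast
qed

locale poisson_observation = prob_space M for M :: "'a measure" +
  fixes N :: "real \<Rightarrow> 'a \<Rightarrow> nat" and \<sigma> :: "nat \<Rightarrow> 'a \<Rightarrow> real" and \<mu> :: real
  assumes hpp: "homogeneous_poisson_process M \<mu> N \<sigma>" and mu_pos: "\<mu> > 0"
begin

lemma measurable_N: "0 \<le> t \<Longrightarrow> N t \<in> measurable M (count_space UNIV)"
  using hpp by (auto simp: homogeneous_poisson_process_def)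

lemma N_eq_iff: "\<omega> \<in> space M \<Longrightarrow> 0 \<le> t \<Longrightarrow> N t \<omega> = n \<longleftrightarrow> \<sigma> n \<omega> \<le> t \<and> t < \<sigma> (Suc n) \<omega>"
  using hpp by (auto simp: homogeneous_poisson_process_def)

lemma sigma_0: "\<omega> \<in> space M \<Longrightarrow> \<sigma> 0 \<omega> = 0"
  and sigma_strict_mono: "\<omega> \<in> space M \<Longrightarrow> strict_mono (\<lambda>n. \<sigma> n \<omega>)"
  using hpp by (auto simp: homogeneous_poisson_process_def)

lemma sigma_less_iff: "\<omega> \<in> space M \<Longrightarrow> \<sigma> n \<omega> < \<sigma> k \<omega> \<longleftrightarrow> n < k"
  using strict_mono_less[OF sigma_strict_mono] .

lemma sigma_nonneg: "\<omega> \<in> space M \<Longrightarrow> 0 \<le> \<sigma> n \<omega>"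
  using sigma_0 sigma_less_iff[of \<omega> 0 n] by (cases n) auto

lemma N_0: "\<omega> \<in> space M \<Longrightarrow> N 0 \<omega> = 0"
  using N_eq_iff[of \<omega> 0 0] sigma_0 sigma_less_iff[of \<omega> 0 1] by simp

lemma N_mono: "\<omega> \<in> space M \<Longrightarrow> 0 \<le> s \<Longrightarrow> s \<le> t \<Longrightarrow> N s \<omega> \<le> N t \<omega>"
proof (rule ccontr)
  assume *: "\<omega> \<in> space M" "0 \<le> s" "s \<le> t" "\<not> N s \<omega> \<le> N t \<omega>"
  have "t < \<sigma> (Suc (N t \<omega>)) \<omega>" using N_eq_iff[of \<omega> t "N t \<omega>"] * by auto
  also have "\<dots> \<le> \<sigma> (N s \<omega>) \<omega>" using sigma_less_iff[OF *(1), of "N s \<omega>" "Suc (N t \<omega>)"] * by force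
  also have "\<dots> \<le> s" using N_eq_iff[of \<omega> s "N s \<omega>"] * by auto
  finally show False using * by simp
qed

lemma N_increment_law:
  "0 \<le> s \<Longrightarrow> s < t \<Longrightarrow> distr M (count_space UNIV) (\<lambda>\<omega>. N t \<omega> - N s \<omega>) = measure_pmf (poisson_pmf (\<mu> * (t - s)))"
  using hpp unfolding homogeneous_poisson_process_def by blast

lemma N_increments_indep:
  "0 \<le> r 0 \<Longrightarrow> strict_mono r \<Longrightarrow>
   indep_vars (\<lambda>_. count_space UNIV) (\<lambda>i \<omega>. N (r (Suc i)) \<omega> - N (r i) \<omega>) {..<k}"
  using hpp unfolding homogeneous_poisson_process_def by blast

text \<open>\<open>N\<close> is specified for nonnegative times only; clamping makes every path a
  counting path on the whole line.\<close>

definition path :: "'a \<Rightarrow> real \<Rightarrow> nat" where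
  "path \<omega> u = N (max 0 u) \<omega>"

abbreviation incr :: "real \<Rightarrow> 'a \<Rightarrow> real \<Rightarrow> nat" where
  "incr t \<omega> \<equiv> shift_path t (path \<omega>)"

lemma counting_path_path: "\<omega> \<in> space M \<Longrightarrow> counting_path (path \<omega>)"
  unfolding counting_path_def
proof (intro conjI allI)
  assume \<omega>: "\<omega> \<in> space M"
  show "mono (path \<omega>)" unfolding path_def by (intro monoI N_mono \<omega>) auto
  fix t :: real
  define n where "n = N (max 0 t) \<omega>"
  have n: "\<sigma> n \<omega> \<le> max 0 t" "max 0 t < \<sigma> (Suc n) \<omega>"
    using N_eq_iff[OF \<omega>, of "max 0 t" n] by (auto simp: n_def)
  show "\<exists>d>0. \<forall>s\<ge>t. s < t + d \<longrightarrow> path \<omega> s = path \<omega> t"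
  proof (intro exI[of _ "\<sigma> (Suc n) \<omega> - max 0 t"] conjI allI impI)
    fix s assume s: "t \<le> s" "s < t + (\<sigma> (Suc n) \<omega> - max 0 t)"
    have "N (max 0 s) \<omega> = n" using s n by (subst N_eq_iff[OF \<omega>]) auto
    then show "path \<omega> s = path \<omega> t" by (simp add: path_def n_def)
  qed (use n in auto)
qed

lemma path_simps: "0 \<le> u \<Longrightarrow> path \<omega> u = N u \<omega>"
  by (simp add: path_def)

lemma incr_0: "\<omega> \<in> space M \<Longrightarrow> incr 0 \<omega> = path \<omega>"
  using N_0[of \<omega>] by (auto simp: shift_path_def path_def fun_eq_iff)

lemma incr_eq: "0 \<le> t \<Longrightarrow> incr t \<omega> u = N (t + max 0 u) \<omega> - N t \<omega>"
  by (simp add: shift_path_def path_def)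

lemma measurable_into_path_space:
  assumes "\<And>u. (\<lambda>x. f x u) \<in> measurable Q (count_space UNIV)"
  shows "f \<in> measurable Q path_space"
proof -
  have "(\<lambda>x u. f x u) \<in> measurable Q path_space"
    by (rule measurable_PiM_single') (simp_all add: assms space_PiM)
  then show ?thesis by simp
qed

lemma measurable_incr [measurable]: "0 \<le> t \<Longrightarrow> incr t \<in> measurable M path_space"
proof (rule measurable_into_path_space)
  fix u assume t: "0 \<le> t"
  have [measurable]: "N (t + max 0 u) \<in> measurable M (count_space UNIV)" "N t \<in> measurable M (count_space UNIV)"
    using t by (auto intro!: measurable_N)
  show "(\<lambda>\<omega>. incr t \<omega> u) \<in> measurable M (count_space UNIV)"
    unfolding incr_eq[OF t] by measurable
qed

text \<open>Independence makes the joint law a product, and each factor is determined by the width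
  of its interval. That \<open>t\<close> is absent on the right is the stationarity used
  below.\<close>

lemma increments_distr:
  assumes r: "strict_mono r" "r 0 = 0" and t: "0 \<le> t" and k: "k > 0"
  shows "distr M (PiM {..<k} (\<lambda>_. count_space UNIV)) (\<lambda>\<omega>. \<lambda>i\<in>{..<k}. N (t + r (Suc i)) \<omega> - N (t + r i) \<omega>)
       = PiM {..<k} (\<lambda>i. measure_pmf (poisson_pmf (\<mu> * (r (Suc i) - r i))))"
proof -
  have r0: "0 \<le> r i" for i using strict_mono_less_eq[OF r(1), of 0 i] r(2) by simp
  have rS: "r i < r (Suc i)" for i using strict_mono_less[OF r(1), of i "Suc i"] by simp
  have "indep_vars (\<lambda>_. count_space UNIV) (\<lambda>i \<omega>. N (t + r (Suc i)) \<omega> - N (t + r i) \<omega>) {..<k}"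
    using N_increments_indep[of "\<lambda>i. t + r i" k] r t by (auto simp: strict_mono_def)
  moreover have "(\<lambda>\<omega>. N (t + r (Suc i)) \<omega> - N (t + r i) \<omega>) \<in> measurable M (count_space UNIV)" for i
  proof -
    have [measurable]: "N (t + r (Suc i)) \<in> measurable M (count_space UNIV)" "N (t + r i) \<in> measurable M (count_space UNIV)"
      using t r0 by (auto intro!: measurable_N)
    show ?thesis by measurable
  qed
  ultimately have "distr M (PiM {..<k} (\<lambda>_. count_space UNIV)) (\<lambda>\<omega>. \<lambda>i\<in>{..<k}. N (t + r (Suc i)) \<omega> - N (t + r i) \<omega>)
    = PiM {..<k} (\<lambda>i. distr M (count_space UNIV) (\<lambda>\<omega>. N (t + r (Suc i)) \<omega> - N (t + r i) \<omega>))"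
    using k by (subst (asm) indep_vars_iff_distr_eq_PiM) auto
  also have "\<dots> = PiM {..<k} (\<lambda>i. measure_pmf (poisson_pmf (\<mu> * (r (Suc i) - r i))))"
    using N_increment_law[of "t + r i" "t + r (Suc i)" for i] t r0 rS by (intro PiM_cong) auto
  finally show ?thesis .
qed

text \<open>Truncated subtraction telescopes because the values of \<open>N\<close> along increasing
  times are ordered.\<close>

lemma sum_increments:
  assumes "\<omega> \<in> space M" "strict_mono r" "0 \<le> t + r 0" "i \<le> n"
  shows "(\<Sum>i\<in>{i..<n}. N (t + r (Suc i)) \<omega> - N (t + r i) \<omega>) = N (t + r n) \<omega> - N (t + r i) \<omega>"
  using \<open>i \<le> n\<close>
proof (induction n rule: dec_induct)
  case (step n)
  have 1: "r 0 \<le> r i" using assms(2) by (simp add: strict_mono_less_eq)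
  have "r i \<le> r n" "r n \<le> r (Suc n)"
    using assms(2) step by (auto simp: strict_mono_less_eq)
  then have "N (t + r i) \<omega> \<le> N (t + r n) \<omega>" "N (t + r n) \<omega> \<le> N (t + r (Suc n)) \<omega>"
    using assms 1 by (auto intro!: N_mono)
  with step show ?case by simp
qed simp

text \<open>A finite product of countable discrete spaces is discrete, so every condition on
  finitely many increments is measurable.\<close>

lemma sets_PiM_count_space_finite:
  fixes A :: "(nat \<Rightarrow> nat) set"
  assumes "finite I" "A \<subseteq> extensional I"
  shows "A \<in> sets (PiM I (\<lambda>_. count_space UNIV))"
  using assms by (simp add: count_space_PiM_finite PiE_def)

text \<open>Finite cylinders determine a finite measure on the product. On a common grid a cylinder
  is a condition on grid increments, and these have the same law from time \<open>t\<close> as from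
  time 0.\<close>

lemma incr_law:
  assumes t: "0 \<le> t"
  shows "distr M path_space (incr t) = distr M path_space (incr 0)"
proof (rule measure_eqI_PiM_infinite)
  show "finite_measure (distr M path_space (incr t))"
    using t by (intro prob_space.finite_measure prob_space_distr) measurable
  fix A :: "real \<Rightarrow> nat set" and J :: "real set"
  assume J: "finite J" "J \<subseteq> UNIV"
  have "finite (insert 0 (max 0 ` J))" "0 \<in> insert 0 (max 0 ` J)" "insert 0 (max 0 ` J) \<subseteq> {0..}"
    using J by auto
  from finite_set_grid[OF this] obtain r :: "nat \<Rightarrow> real" and k idx where r: "strict_mono r" "r 0 = 0"
    and idx': "\<forall>u\<in>insert 0 (max 0 ` J). idx u < k \<and> r (idx u) = u"
    by blast
  have idx: "idx u < k \<and> r (idx u) = u" if "u \<in> insert 0 (max 0 ` J)" for u using idx' that by blast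
  have k: "k > 0" using idx[of 0] by simp
  let ?X = "prod_emb UNIV (\<lambda>_. count_space UNIV) J (Pi\<^sub>E J A)"
  let ?D = "\<lambda>t \<omega>. \<lambda>i\<in>{..<k}. N (t + r (Suc i)) \<omega> - N (t + r i) \<omega>"
  \<comment> \<open>The cylinder in terms of increments: the value at u is the sum of the grid
    increments before \<open>max 0 u\<close>.\<close>
  let ?B = "{d \<in> extensional {..<k}. \<forall>u\<in>J. (\<Sum>i\<in>{0..<idx (max 0 u)}. d i) \<in> A u}"
  have r0: "0 \<le> r i" for i using strict_mono_less_eq[OF r(1), of 0 i] r(2) by simp
  have X: "?X \<in> sets path_space" using J by (intro sets_PiM_I) auto
  have main: "emeasure (distr M path_space (incr t)) ?X
    = emeasure (PiM {..<k} (\<lambda>i. measure_pmf (poisson_pmf (\<mu> * (r (Suc i) - r i))))) ?B" if t: "0 \<le> t" for t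
  proof -
    have s: "(\<Sum>i\<in>{0..<idx (max 0 u)}. ?D t \<omega> i) = incr t \<omega> u" if u: "u \<in> J" and \<omega>: "\<omega> \<in> space M" for u \<omega>
    proof -
      have "(\<Sum>i\<in>{0..<idx (max 0 u)}. ?D t \<omega> i) = (\<Sum>i\<in>{0..<idx (max 0 u)}. N (t + r (Suc i)) \<omega> - N (t + r i) \<omega>)"
        using idx[of "max 0 u"] u by (intro sum.cong) auto
      also have "\<dots> = N (t + r (idx (max 0 u))) \<omega> - N (t + r 0) \<omega>"
        using \<omega> r t by (intro sum_increments) auto
      also have "\<dots> = incr t \<omega> u"
        using idx[of "max 0 u"] u r t by (simp add: incr_eq)
      finally show ?thesis .
    qed
    have D: "?D t \<in> measurable M (PiM {..<k} (\<lambda>_. count_space UNIV))"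
    proof (rule measurable_restrict)
      fix i
      have [measurable]: "N (t + r (Suc i)) \<in> measurable M (count_space UNIV)" "N (t + r i) \<in> measurable M (count_space UNIV)"
        using t r0 by (auto intro!: measurable_N)
      show "(\<lambda>\<omega>. N (t + r (Suc i)) \<omega> - N (t + r i) \<omega>) \<in> measurable M (count_space UNIV)" by measurable
    qed
    have B: "?B \<in> sets (PiM {..<k} (\<lambda>_. count_space UNIV))"
      by (rule sets_PiM_count_space_finite) auto
    have "emeasure (distr M path_space (incr t)) ?X = emeasure M (incr t -` ?X \<inter> space M)"
      using t X by (simp add: emeasure_distr measurable_incr)
    also have "incr t -` ?X \<inter> space M = ?D t -` ?B \<inter> space M"
      using s by (auto simp: prod_emb_def PiE_iff extensional_def)
    also have "emeasure M \<dots> = emeasure (distr M (PiM {..<k} (\<lambda>_. count_space UNIV)) (?D t)) ?B"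
      by (rule emeasure_distr[OF D B, symmetric])
    finally show ?thesis by (simp only: increments_distr[OF r t k])
  qed
  show "emeasure (distr M path_space (incr t)) ?X = emeasure (distr M path_space (incr 0)) ?X"
    using main[OF t] main[of 0] by simp
qed simp_all

section \<open>The past up to a time and its independence of later increments\<close>

definition past :: "real \<Rightarrow> 'a measure" where
  "past t = sigma (space M) (natural_events M N t \<union> null_sets M)"

lemma natural_events_subset: "natural_events M N t \<subseteq> sets M"
  unfolding natural_events_def
  by (rule sets.sigma_sets_subset) (auto intro!: measurable_sets[OF measurable_N])

lemma space_past [simp]: "space (past t) = space M"
  unfolding past_def using natural_events_subset sets.sets_into_space null_setsD2
  by (intro space_measure_of) blast

lemma sets_past: "sets (past t) = sigma_sets (space M) (natural_events M N t \<union> null_sets M)"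
  unfolding past_def using natural_events_subset sets.sets_into_space null_setsD2
  by (intro sets_measure_of) blast

lemma sets_past_subset: "sets (past t) \<subseteq> sets M"
  unfolding sets_past using natural_events_subset by (intro sets.sigma_sets_subset) auto

lemma past_mono: "s \<le> t \<Longrightarrow> sets (past s) \<subseteq> sets (past t)"
  unfolding sets_past natural_events_def
  by (intro sigma_sets_mono' Un_mono order_refl) (auto intro: order_trans)

lemma measurable_from_past: "f \<in> measurable (past t) Q \<Longrightarrow> f \<in> measurable M Q"
  using sets_past_subset by (auto simp: measurable_def)

lemma measurable_past_mono: "s \<le> t \<Longrightarrow> f \<in> measurable (past s) Q \<Longrightarrow> f \<in> measurable (past t) Q"
  using past_mono[of s t] by (auto simp: measurable_def)

lemma measurable_N_past: "0 \<le> u \<Longrightarrow> u \<le> t \<Longrightarrow> N u \<in> measurable (past t) (count_space UNIV)"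
  unfolding measurable_def sets_past natural_events_def by auto

definition cylinders :: "(real \<Rightarrow> 'a \<Rightarrow> nat) \<Rightarrow> real set \<Rightarrow> 'a set set" where
  "cylinders X I = {{\<omega> \<in> space M. \<forall>u\<in>J. X u \<omega> \<in> A u} | J A. finite J \<and> J \<subseteq> I}"

abbreviation past_cylinders :: "real \<Rightarrow> 'a set set" where
  "past_cylinders t \<equiv> cylinders N {0..t}"

abbreviation future_cylinders :: "real \<Rightarrow> 'a set set" where
  "future_cylinders t \<equiv> cylinders (\<lambda>u \<omega>. incr t \<omega> u) UNIV"

lemma cylinders_subset:
  assumes X: "\<And>u. u \<in> I \<Longrightarrow> X u \<in> measurable M (count_space UNIV)"
  shows "cylinders X I \<subseteq> events"
proof
  fix a assume "a \<in> cylinders X I"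
  then obtain J A where a: "a = {\<omega> \<in> space M. \<forall>u\<in>J. X u \<omega> \<in> A u}" "finite J" "J \<subseteq> I"
    unfolding cylinders_def by blast
  have "{\<omega> \<in> space M. X u \<omega> \<in> A u} \<in> events" if "u \<in> J" for u
    using measurable_sets[OF X, of u "A u"] that a by (auto simp: vimage_def Int_def conj_commute)
  then show "a \<in> events" unfolding a(1) using a(2) by (intro sets.sets_Collect_finite_All) auto
qed

lemma Int_stable_cylinders: "Int_stable (cylinders X I)"
proof (rule Int_stableI)
  fix a b assume "a \<in> cylinders X I" "b \<in> cylinders X I"
  then obtain J1 A1 J2 A2 where a: "a = {\<omega> \<in> space M. \<forall>u\<in>J1. X u \<omega> \<in> A1 u}" "finite J1" "J1 \<subseteq> I"
    and b: "b = {\<omega> \<in> space M. \<forall>u\<in>J2. X u \<omega> \<in> A2 u}" "finite J2" "J2 \<subseteq> I"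
    unfolding cylinders_def by blast
  show "a \<inter> b \<in> cylinders X I"
    unfolding cylinders_def mem_Collect_eq a(1) b(1)
    by (rule exI[of _ "J1 \<union> J2"], rule exI[of _ "\<lambda>u. (if u \<in> J1 then A1 u else UNIV) \<inter> (if u \<in> J2 then A2 u else UNIV)"])
      (use a b in auto)
qed

text \<open>All times involved, together with 0 and \<open>t\<close>, are placed on one grid. The
  past cylinder then depends on increments with index below \<open>idx t\<close>, the future one on
  increments from \<open>idx t\<close> on, and disjoint blocks of independent increments are
  independent.\<close>

lemma indep_cylinders:
  assumes t: "0 \<le> t"
  shows "indep_set (past_cylinders t) (future_cylinders t)"
  unfolding indep_sets2_eq
proof (intro conjI ballI)
  show "past_cylinders t \<subseteq> events" by (rule cylinders_subset) (simp add: measurable_N)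
  show "future_cylinders t \<subseteq> events"
    by (rule cylinders_subset)
      (rule measurable_compose[OF measurable_incr[OF t] measurable_component_singleton], simp)
  fix a b assume "a \<in> past_cylinders t" "b \<in> future_cylinders t"
  then obtain J1 A1 J2 A2 where a: "a = {\<omega> \<in> space M. \<forall>u\<in>J1. N u \<omega> \<in> A1 u}" and J1: "finite J1" "J1 \<subseteq> {0..t}"
    and b: "b = {\<omega> \<in> space M. \<forall>u\<in>J2. incr t \<omega> u \<in> A2 u}" and J2: "finite J2"
    unfolding cylinders_def by blast
  define S where "S = insert 0 (insert t (J1 \<union> (\<lambda>u. t + max 0 u) ` J2))"
  have "finite S" "0 \<in> S" "S \<subseteq> {0..}" using J1 J2 t by (auto simp: S_def)
  from finite_set_grid[OF this] obtain r :: "nat \<Rightarrow> real" and k idx where r: "strict_mono r" "r 0 = 0"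
    and idx': "\<forall>u\<in>S. idx u < k \<and> r (idx u) = u"
    by blast
  have idx: "idx u < k \<and> r (idx u) = u" if "u \<in> S" for u using idx' that by blast
  let ?D = "\<lambda>i \<omega>. N (r (Suc i)) \<omega> - N (r i) \<omega>"
  let ?l = "idx t"
  let ?C = "\<lambda>_. count_space UNIV"
  have l: "?l < k" "r ?l = t" using idx[of t] by (auto simp: S_def)
  have J1_le: "idx u \<le> ?l" "r (idx u) = u" if "u \<in> J1" for u
    using idx[of u] that J1 l strict_mono_less_eq[OF r(1), of "idx u" ?l] by (auto simp: S_def)
  have J2_ge: "?l \<le> idx (t + max 0 u)" "r (idx (t + max 0 u)) = t + max 0 u" "idx (t + max 0 u) < k" if "u \<in> J2" for u
    using idx[of "t + max 0 u"] that J1 l strict_mono_less_eq[OF r(1), of ?l "idx (t + max 0 u)"] by (auto simp: S_def)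
  let ?B1 = "{d \<in> extensional {..<?l}. \<forall>u\<in>J1. (\<Sum>i\<in>{0..<idx u}. d i) \<in> A1 u}"
  let ?B2 = "{d \<in> extensional {?l..<k}. \<forall>u\<in>J2. (\<Sum>i\<in>{?l..<idx (t + max 0 u)}. d i) \<in> A2 u}"
  have ind: "indep_vars ?C ?D {..<k}"
    using r by (intro N_increments_indep) auto
  have iv: "indep_var (PiM {..<?l} ?C) (\<lambda>\<omega>. restrict (\<lambda>i. ?D i \<omega>) {..<?l})
     (PiM {?l..<k} ?C) (\<lambda>\<omega>. restrict (\<lambda>i. ?D i \<omega>) {?l..<k})"
    using l by (intro indep_var_restrict[OF ind]) auto
  have B: "?B1 \<in> sets (PiM {..<?l} ?C)" "?B2 \<in> sets (PiM {?l..<k} ?C)"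
    by (rule sets_PiM_count_space_finite; auto)+
  have S1: "(\<Sum>i\<in>{0..<idx u}. restrict (\<lambda>i. ?D i \<omega>) {..<?l} i) = N u \<omega>" if "u \<in> J1" "\<omega> \<in> space M" for u \<omega>
  proof -
    have "(\<Sum>i\<in>{0..<idx u}. restrict (\<lambda>i. ?D i \<omega>) {..<?l} i) = (\<Sum>i\<in>{0..<idx u}. ?D i \<omega>)"
      using J1_le[OF that(1)] by (intro sum.cong) auto
    also have "\<dots> = N (r (idx u)) \<omega> - N (r 0) \<omega>"
      using sum_increments[of \<omega> r 0 0 "idx u"] that r by auto
    finally show ?thesis using J1_le[OF that(1)] r N_0[OF that(2)] by simp
  qed
  have S2: "(\<Sum>i\<in>{?l..<idx (t + max 0 u)}. restrict (\<lambda>i. ?D i \<omega>) {?l..<k} i) = incr t \<omega> u" if "u \<in> J2" "\<omega> \<in> space M" for u \<omega>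
  proof -
    have "(\<Sum>i\<in>{?l..<idx (t + max 0 u)}. restrict (\<lambda>i. ?D i \<omega>) {?l..<k} i) = (\<Sum>i\<in>{?l..<idx (t + max 0 u)}. ?D i \<omega>)"
      using J2_ge[OF that(1)] by (intro sum.cong) auto
    also have "\<dots> = N (r (idx (t + max 0 u))) \<omega> - N (r ?l) \<omega>"
      using sum_increments[of \<omega> r 0 ?l "idx (t + max 0 u)"] that r J2_ge[OF that(1)] by auto
    finally show ?thesis using J2_ge[OF that(1)] r l t by (simp add: incr_eq)
  qed
  have a': "a = (\<lambda>\<omega>. restrict (\<lambda>i. ?D i \<omega>) {..<?l}) -` ?B1 \<inter> space M"
    unfolding a using S1 by auto
  have b': "b = (\<lambda>\<omega>. restrict (\<lambda>i. ?D i \<omega>) {?l..<k}) -` ?B2 \<inter> space M"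
    unfolding b using S2 by auto
  have "indep_set {(\<lambda>\<omega>. restrict (\<lambda>i. ?D i \<omega>) {..<?l}) -` X \<inter> space M |X. X \<in> sets (PiM {..<?l} ?C)}
       {(\<lambda>\<omega>. restrict (\<lambda>i. ?D i \<omega>) {?l..<k}) -` X \<inter> space M |X. X \<in> sets (PiM {?l..<k} ?C)}"
    using iv unfolding indep_var_eq indep_sets2_eq by blast
  then show "prob (a \<inter> b) = prob a * prob b"
    unfolding indep_sets2_eq a' b' using B by blast
qed

text \<open>Cylinders are stable under intersection, so their independence extends to the generated
  sigma-algebras. The null sets contained in \<open>past t\<close> are absorbed by replacing each of
  its events by an almost surely equal event generated by past cylinders.\<close>

lemma indep_past_future:
  assumes t: "0 \<le> t"
    and ab: "a \<in> sets (past t)" "b \<in> sets path_space"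
  shows "prob (a \<inter> (incr t -` b \<inter> space M)) = prob a * prob (incr t -` b \<inter> space M)"
proof -
  let ?F = "sigma_sets (space M) (future_cylinders t)"
  have ind: "indep_set (sigma_sets (space M) (past_cylinders t)) ?F"
    by (intro indep_set_sigma_sets indep_cylinders t Int_stable_cylinders)
  have ne: "natural_events M N t \<subseteq> sigma_sets (space M) (past_cylinders t)"
    unfolding natural_events_def
  proof (rule sigma_sets_mono, rule subsetI, rule sigma_sets.Basic)
    fix a assume "a \<in> {N u -` A \<inter> space M |u A. 0 \<le> u \<and> u \<le> t}"
    then obtain u A where "a = N u -` A \<inter> space M" "0 \<le> u" "u \<le> t" by auto
    then show "a \<in> past_cylinders t" unfolding cylinders_def
      by (auto intro!: exI[of _ "{u}"] exI[of _ "\<lambda>_. A"])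
  qed
  \<comment> \<open>Sets with null symmetric difference to a generated event are closed under
    complements and countable unions, so induction over \<open>sigma_sets\<close> applies.\<close>
  have approx: "\<exists>a'\<in>sigma_sets (space M) (past_cylinders t). a' \<in> events \<and> (a - a') \<union> (a' - a) \<in> null_sets M"
    if "a \<in> sets (past t)" for a
    using that unfolding sets_past
  proof (induction rule: sigma_sets.induct)
    case (Basic a)
    then show ?case
    proof
      assume "a \<in> natural_events M N t"
      then show ?thesis using ne natural_events_subset by (intro bexI[of _ a]) auto
    next
      assume "a \<in> null_sets M"
      then show ?thesis by (intro bexI[of _ "{}"]) (auto intro: sigma_sets.Empty)
    qed
  next
    case Empty
    then show ?case by (intro bexI[of _ "{}"]) (auto intro: sigma_sets.Empty)
  next
    case (Compl a)
    then obtain a' where a': "a' \<in> sigma_sets (space M) (past_cylinders t)" "a' \<in> events" "(a - a') \<union> (a' - a) \<in> null_sets M" by auto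
    have asp: "a \<subseteq> space M" using Compl(1) sets_past sets_past_subset sets.sets_into_space by blast
    have "(space M - a - (space M - a')) \<union> (space M - a' - (space M - a)) = (a - a') \<union> (a' - a)"
      using asp sets.sets_into_space[OF a'(2)] by auto
    then show ?case using a' by (intro bexI[of _ "space M - a'"]) (auto intro: sigma_sets.Compl)
  next
    case (Union a)
    then obtain a' where a': "\<And>i. a' i \<in> sigma_sets (space M) (past_cylinders t)" "\<And>i. a' i \<in> events"
        "\<And>i. (a i - a' i) \<union> (a' i - a i) \<in> null_sets M" by metis
    have ai: "a i \<in> events" for i using Union(1)[of i] sets_past sets_past_subset by blast
    have "(\<Union>i. (a i - a' i) \<union> (a' i - a i)) \<in> null_sets M" using a'(3) by (intro null_sets_UN)
    then have "((\<Union>i. a i) - (\<Union>i. a' i)) \<union> ((\<Union>i. a' i) - (\<Union>i. a i)) \<in> null_sets M"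
      by (rule null_sets_subset) (use ai a'(2) in auto)
    then show ?case using a' by (intro bexI[of _ "\<Union>i. a' i"]) (auto intro: sigma_sets.Union)
  qed
  have "indep_set (sets (past t)) ?F"
    unfolding indep_sets2_eq
  proof (intro conjI ballI)
    show "sets (past t) \<subseteq> events" by (rule sets_past_subset)
    show F: "?F \<subseteq> events" using ind unfolding indep_sets2_eq by blast
    fix a b assume ab: "a \<in> sets (past t)" "b \<in> ?F"
    obtain a' where a': "a' \<in> sigma_sets (space M) (past_cylinders t)" "a' \<in> events" "(a - a') \<union> (a' - a) \<in> null_sets M"
      using approx[OF ab(1)] by auto
    have ev: "a \<in> events" "b \<in> events" using ab F sets_past_subset by auto
    have ae: "AE x in M. x \<notin> (a - a') \<union> (a' - a)" by (rule AE_not_in) fact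
    have "prob (a \<inter> b) = prob (a' \<inter> b)" "prob a = prob a'"
      using ae ev a' by (auto intro!: measure_eq_AE)
    moreover have "prob (a' \<inter> b) = prob a' * prob b"
      using ind a' ab unfolding indep_sets2_eq by blast
    ultimately show "prob (a \<inter> b) = prob a * prob b" by simp
  qed
  moreover have "incr t -` b \<inter> space M \<in> ?F"
  proof -
    have "incr t \<in> measurable (sigma (space M) (future_cylinders t)) path_space"
    proof (rule measurable_into_path_space)
      fix u
      have sub: "future_cylinders t \<subseteq> Pow (space M)" by (auto simp: cylinders_def)
      show "(\<lambda>\<omega>. incr t \<omega> u) \<in> measurable (sigma (space M) (future_cylinders t)) (count_space UNIV)"
      proof (rule measurableI)
        fix A :: "nat set"
        have "(\<lambda>\<omega>. incr t \<omega> u) -` A \<inter> space M \<in> future_cylinders t"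
          unfolding cylinders_def by (auto intro!: exI[of _ "{u}"] exI[of _ "\<lambda>_. A"])
        then show "(\<lambda>\<omega>. incr t \<omega> u) -` A \<inter> space (sigma (space M) (future_cylinders t)) \<in> sets (sigma (space M) (future_cylinders t))"
          using sub by auto
      qed simp
    qed
    from measurable_sets[OF this ab(2)] show ?thesis
      by (auto simp: cylinders_def space_measure_of_conv sets_measure_of_conv split: if_splits)
  qed
  ultimately show ?thesis using ab unfolding indep_sets2_eq by blast
qed

text \<open>By independence the joint law of \<omega>, seen through \<open>past t\<close>, and of
  the later increments is a product measure. Fubini separates the two, and stationarity replaces the
  increments by a fresh copy of the whole path. Keeping \<omega> itself as first argument lets
  \<open>f\<close> depend on any past-measurable quantity.\<close>

theorem simple_Markov:
  assumes t: "0 \<le> t" and f: "f \<in> borel_measurable (past t \<Otimes>\<^sub>M path_space)"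
  shows "(\<integral>\<^sup>+\<omega>. f (\<omega>, incr t \<omega>) \<partial>M) = (\<integral>\<^sup>+\<omega>. (\<integral>\<^sup>+\<omega>'. f (\<omega>, path \<omega>') \<partial>M) \<partial>M)"
proof -
  have id: "(\<lambda>\<omega>. \<omega>) \<in> measurable M (past t)" by (rule measurable_from_past[of _ t]) simp
  interpret L: prob_space "distr M path_space (incr t)"
    using t by (intro prob_space_distr) measurable
  interpret I: prob_space "distr M (past t) (\<lambda>\<omega>. \<omega>)"
    by (intro prob_space_distr id)
  have pr: "(\<lambda>\<omega>. (\<omega>, incr t \<omega>)) \<in> measurable M (past t \<Otimes>\<^sub>M path_space)"
    using id measurable_incr[OF t] by (rule measurable_Pair)
  have eq: "distr M (past t) (\<lambda>\<omega>. \<omega>) \<Otimes>\<^sub>M distr M path_space (incr t)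
      = distr M (past t \<Otimes>\<^sub>M path_space) (\<lambda>\<omega>. (\<omega>, incr t \<omega>))"
  proof (rule pair_measure_eqI)
    fix A B assume AB: "A \<in> sets (distr M (past t) (\<lambda>\<omega>. \<omega>))" "B \<in> sets (distr M path_space (incr t))"
    have A: "A \<subseteq> space M" using AB sets.sets_into_space[of A "past t"] by simp
    have "A \<in> events" "incr t -` B \<inter> space M \<in> events"
      using AB sets_past_subset[of t] measurable_sets[OF measurable_incr[OF t]] by auto
    then have "emeasure M A * emeasure M (incr t -` B \<inter> space M) = emeasure M (A \<inter> (incr t -` B \<inter> space M))"
      using indep_past_future[OF t, of A B] AB by (simp add: emeasure_eq_measure ennreal_mult)
    moreover have "(\<lambda>\<omega>. \<omega>) -` A \<inter> space M = A" "(\<lambda>\<omega>. (\<omega>, incr t \<omega>)) -` (A \<times> B) \<inter> space M = A \<inter> (incr t -` B \<inter> space M)"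
      using A by auto
    ultimately show "emeasure (distr M (past t) (\<lambda>\<omega>. \<omega>)) A * emeasure (distr M path_space (incr t)) B =
       emeasure (distr M (past t \<Otimes>\<^sub>M path_space) (\<lambda>\<omega>. (\<omega>, incr t \<omega>))) (A \<times> B)"
      using AB t by (simp add: emeasure_distr id measurable_incr pr)
  qed (simp_all add: L.sigma_finite_measure_axioms I.sigma_finite_measure_axioms cong: sets_pair_measure_cong)
  have [measurable]: "f \<in> borel_measurable (past t \<Otimes>\<^sub>M path_space)" by fact
  have "(\<integral>\<^sup>+\<omega>. f (\<omega>, incr t \<omega>) \<partial>M) = (\<integral>\<^sup>+z. f z \<partial>distr M (past t \<Otimes>\<^sub>M path_space) (\<lambda>\<omega>. (\<omega>, incr t \<omega>)))"
    by (subst nn_integral_distr[OF pr]) auto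
  also have "\<dots> = (\<integral>\<^sup>+\<omega>. (\<integral>\<^sup>+w. f (\<omega>, w) \<partial>distr M path_space (incr t)) \<partial>distr M (past t) (\<lambda>\<omega>. \<omega>))"
    unfolding eq[symmetric] by (subst L.nn_integral_fst[symmetric]) (auto cong: measurable_cong_sets)
  also have "\<dots> = (\<integral>\<^sup>+\<omega>. (\<integral>\<^sup>+w. f (\<omega>, w) \<partial>distr M path_space (incr 0)) \<partial>distr M (past t) (\<lambda>\<omega>. \<omega>))"
    by (simp only: incr_law[OF t])
  also have "\<dots> = (\<integral>\<^sup>+\<omega>. (\<integral>\<^sup>+w. f (\<omega>, w) \<partial>distr M path_space (incr 0)) \<partial>M)"
  proof (rule nn_integral_distr[OF id])
    interpret L0: prob_space "distr M path_space (incr 0)"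
      by (intro prob_space_distr) measurable
    show "(\<lambda>\<omega>. \<integral>\<^sup>+w. f (\<omega>, w) \<partial>distr M path_space (incr 0)) \<in> borel_measurable (distr M (past t) (\<lambda>\<omega>. \<omega>))"
      by (rule L0.borel_measurable_nn_integral) (auto cong: measurable_cong_sets)
  qed
  also have "\<dots> = (\<integral>\<^sup>+\<omega>. (\<integral>\<^sup>+\<omega>'. f (\<omega>, path \<omega>') \<partial>M) \<partial>M)"
  proof (rule nn_integral_cong)
    fix \<omega> assume "\<omega> \<in> space M"
    then have "(\<lambda>w. f (\<omega>, w)) \<in> borel_measurable path_space"
      using measurable_Pair2[OF f] by simp
    then have "(\<integral>\<^sup>+w. f (\<omega>, w) \<partial>distr M path_space (incr 0)) = (\<integral>\<^sup>+\<omega>'. f (\<omega>, incr 0 \<omega>') \<partial>M)"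
      by (intro nn_integral_distr) auto
    also have "\<dots> = (\<integral>\<^sup>+\<omega>'. f (\<omega>, path \<omega>') \<partial>M)"
      by (intro nn_integral_cong) (simp add: incr_0)
    finally show "(\<integral>\<^sup>+w. f (\<omega>, w) \<partial>distr M path_space (incr 0)) = (\<integral>\<^sup>+\<omega>'. f (\<omega>, path \<omega>') \<partial>M)" .
  qed
  finally show ?thesis .
qed

end

section \<open>The state process and the one-step operator\<close>

lemma flow_cong:
  assumes "\<And>s. 0 \<le> s \<Longrightarrow> s \<le> t \<Longrightarrow> w s = w' s" "0 \<le> t"
  shows "flow \<rho> z a w v t = flow \<rho> z a w' v t"
proof -
  have "(\<integral>s. indicator {0..t} s * (a * exp (- \<rho> * s) / z ^ w s) \<partial>lborel) =
        (\<integral>s. indicator {0..t} s * (a * exp (- \<rho> * s) / z ^ w' s) \<partial>lborel)"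
    by (intro Bochner_Integration.integral_cong) (auto simp: indicator_def assms)
  then show ?thesis using assms by (simp add: flow_def)
qed

context poisson_observation
begin

section \<open>Law, one-jump bound and generating function of the counts\<close>

lemma N_law: "0 < t \<Longrightarrow> distr M (count_space UNIV) (N t) = measure_pmf (poisson_pmf (\<mu> * t))"
proof -
  assume t: "0 < t"
  have "distr M (count_space UNIV) (N t) = distr M (count_space UNIV) (\<lambda>\<omega>. N t \<omega> - N 0 \<omega>)"
    by (intro distr_cong) (auto simp: N_0)
  then show ?thesis using N_increment_law[of 0 t] t by simp
qed

lemma prob_increment_ge_1:
  assumes "0 \<le> s" "0 < h"
  shows "emeasure M {\<omega>\<in>space M. N (s + h) \<omega> - N s \<omega> \<ge> 1} \<le> ennreal (\<mu> * h)"
proof -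
  let ?D = "\<lambda>\<omega>. N (s + h) \<omega> - N s \<omega>"
  have [measurable]: "N (s + h) \<in> measurable M (count_space UNIV)" "N s \<in> measurable M (count_space UNIV)"
    using assms by (auto intro!: measurable_N)
  have "emeasure M {\<omega>\<in>space M. ?D \<omega> \<ge> 1} = emeasure (distr M (count_space UNIV) ?D) {1..}"
    by (subst emeasure_distr) (auto intro!: arg_cong2[where f=emeasure])
  also have "\<dots> = emeasure (measure_pmf (poisson_pmf (\<mu> * h))) (space (measure_pmf (poisson_pmf (\<mu> * h))) - {0})"
    using N_increment_law[of s "s + h"] assms by (auto intro!: arg_cong2[where f=emeasure])
  also have "\<dots> = ennreal (1 - exp (- (\<mu> * h)))"
    using assms mu_pos by (simp add: measure_pmf.emeasure_eq_measure measure_pmf.prob_compl measure_pmf_single del: space_measure_pmf)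
  also have "\<dots> \<le> ennreal (\<mu> * h)"
    using exp_ge_add_one_self[of "- (\<mu> * h)"] by (intro ennreal_leI) simp
  finally show ?thesis .
qed

text \<open>The Poisson generating function. At z = 1 - 1/\<mu> and z = 1 + 1/\<mu> the exponents
  are -t and t, which is played off against the drift; large z yield finite expectations of
  \<open>flow_bound\<close>.\<close>

lemma nn_integral_power_N:
  assumes "0 \<le> t" "0 \<le> z"
  shows "(\<integral>\<^sup>+\<omega>. ennreal (z ^ N t \<omega>) \<partial>M) = ennreal (exp (\<mu> * t * (z - 1)))"
proof (cases "t = 0")
  case True
  have "(\<integral>\<^sup>+\<omega>. ennreal (z ^ N t \<omega>) \<partial>M) = (\<integral>\<^sup>+\<omega>. 1 \<partial>M)"
    by (intro nn_integral_cong) (simp add: True N_0)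
  then show ?thesis using True by (simp add: emeasure_space_1)
next
  case False
  then have t: "t > 0" using assms by simp
  let ?r = "\<mu> * t"
  have r: "?r > 0" using t mu_pos by simp
  have "(\<integral>\<^sup>+\<omega>. ennreal (z ^ N t \<omega>) \<partial>M) = (\<integral>\<^sup>+n. ennreal (z ^ n) \<partial>distr M (count_space UNIV) (N t))"
    using assms by (subst nn_integral_distr) (auto intro: measurable_N)
  also have "\<dots> = (\<integral>\<^sup>+n. ennreal (pmf (poisson_pmf ?r) n) * ennreal (z ^ n) \<partial>count_space UNIV)"
    unfolding N_law[OF t] by (rule nn_integral_measure_pmf)
  also have "\<dots> = (\<Sum>n. ennreal (exp (- ?r) * ((?r * z) ^ n / fact n)))"
    unfolding nn_integral_count_space_nat using r assms mu_pos
    by (intro suminf_cong) (simp add: ennreal_mult[symmetric] power_mult_distrib field_simps)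
  also have "\<dots> = ennreal (exp (- ?r) * exp (?r * z))"
  proof (rule suminf_ennreal_eq)
    show "(\<lambda>n. exp (- ?r) * ((?r * z) ^ n / fact n)) sums (exp (- ?r) * exp (?r * z))"
      using exp_converges[of "?r * z"] by (intro sums_mult) (simp add: field_simps scaleR_conv_of_real)
  qed (use r assms in auto)
  also have "exp (- ?r) * exp (?r * z) = exp (\<mu> * t * (z - 1))"
    by (simp add: exp_add[symmetric] algebra_simps)
  finally show ?thesis .
qed

end

text \<open>The l1 distance fits because \<open>total_mass\<close> is 1-Lipschitz for it and because
  it splits into the coordinates, whose jump factors are averaged separately.\<close>

definition dist1 :: "real \<times> real \<Rightarrow> real \<times> real \<Rightarrow> real" where
  "dist1 p q = \<bar>fst p - fst q\<bar> + \<bar>snd p - snd q\<bar>"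

text \<open>\<open>ennreal\<close> sends negative numbers to 0, so value functions make sense on the
  whole plane. On the quadrant, which the state never leaves, this is the running cost plus lam
  K.\<close>

definition total_mass :: "real \<times> real \<Rightarrow> ennreal" where
  "total_mass p = ennreal (fst p + snd p)"

lemma measurable_total_mass [measurable]: "total_mass \<in> borel_measurable borel"
  unfolding total_mass_def by (intro measurable_compose[OF _ measurable_ennreal] borel_measurable_add)
    (simp_all add: borel_prod[symmetric])

text \<open>\<open>a\<close> and \<open>b\<close> stand for the constant terms of the two
  differential equations and \<open>K\<close> for sqrt 2 / c. Nonnegative \<open>a\<close> and
  \<open>b\<close> keep the state in the quadrant.\<close>

locale stopping_problem = poisson_observation M N \<sigma> \<mu> for M :: "'a measure" and N \<sigma> \<mu> +
  fixes lam a b K :: real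
  assumes lam: "lam > 0" and mu_gt_1: "\<mu> > 1" and a: "a \<ge> 0" and b: "b \<ge> 0" and K: "K \<ge> 0"
begin

definition state :: "real \<times> real \<Rightarrow> (real \<Rightarrow> nat) \<Rightarrow> real \<Rightarrow> real \<times> real" where
  "state p w t = (flow (lam + 1) (1 - 1/\<mu>) a w (fst p) t, flow (lam - 1) (1 + 1/\<mu>) b w (snd p) t)"

definition run :: "real \<times> real \<Rightarrow> (real \<Rightarrow> nat) \<Rightarrow> real \<Rightarrow> ennreal" where
  "run p w t = (\<integral>\<^sup>+s. indicator {0..t} s * (ennreal (exp (- lam * s)) * total_mass (state p w s)) \<partial>lborel)"

text \<open>With \<open>f\<close> constantly \<open>K\<close> this is the shifted cost of stopping
  at \<open>t\<close>; with a value function as \<open>f\<close> it is the process whose sub- and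
  supermartingale properties are exploited.\<close>

definition gain :: "(real \<times> real \<Rightarrow> ennreal) \<Rightarrow> real \<times> real \<Rightarrow> (real \<Rightarrow> nat) \<Rightarrow> real \<Rightarrow> ennreal" where
  "gain f p w t = run p w t + ennreal (exp (- lam * t)) * f (state p w t)"

definition Q :: "real \<Rightarrow> (real \<times> real \<Rightarrow> ennreal) \<Rightarrow> real \<times> real \<Rightarrow> ennreal" where
  "Q h f p = (\<integral>\<^sup>+\<omega>. gain f p (path \<omega>) h \<partial>M)"

lemma z_pos: "0 < 1 - 1/\<mu>" "0 < 1 + 1/\<mu>"
  using mu_gt_1 by (auto simp: field_simps)

lemma state_0: "counting_path w \<Longrightarrow> w 0 = 0 \<Longrightarrow> state p w 0 = p"
  using z_pos by (simp add: state_def flow_0)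

lemma state_add:
  "counting_path w \<Longrightarrow> 0 \<le> t \<Longrightarrow> 0 \<le> s \<Longrightarrow> state p w (t + s) = state (state p w t) (shift_path t w) s"
  using z_pos by (simp add: state_def flow_add)

lemma state_cong:
  "(\<And>s. 0 \<le> s \<Longrightarrow> s \<le> t \<Longrightarrow> w s = w' s) \<Longrightarrow> 0 \<le> t \<Longrightarrow> state p w t = state p w' t"
  unfolding state_def by (intro arg_cong2[where f=Pair] flow_cong) auto

lemma state_nonneg: "p \<in> {0..} \<times> {0..} \<Longrightarrow> state p w t \<in> {0..} \<times> {0..}"
  using z_pos a b by (auto simp: state_def mem_Times_iff intro!: flow_nonneg)

lemma measurable_state [measurable (raw)]:
  assumes [measurable]: "f \<in> borel_measurable R" "g \<in> measurable R path_space" "h \<in> borel_measurable R"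
  shows "(\<lambda>x. state (f x) (regularize (g x)) (h x)) \<in> borel_measurable R"
proof -
  have [measurable]: "(\<lambda>x. fst (f x)) \<in> borel_measurable R" "(\<lambda>x. snd (f x)) \<in> borel_measurable R"
    using assms(1) by (simp_all add: borel_prod[symmetric])
  show ?thesis unfolding state_def by (intro borel_measurable_Pair) measurable
qed

lemma measurable_run [measurable (raw)]:
  assumes [measurable]: "f \<in> borel_measurable R" "g \<in> measurable R path_space" "h \<in> borel_measurable R"
  shows "(\<lambda>x. run (f x) (regularize (g x)) (h x)) \<in> borel_measurable R"
  unfolding run_def indicator_def by (rule lborel.borel_measurable_nn_integral) (simp, measurable)

lemma measurable_gain [measurable (raw)]:
  assumes [measurable]: "f \<in> borel_measurable R" "g \<in> measurable R path_space" "h \<in> borel_measurable R"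
    "v \<in> borel_measurable borel"
  shows "(\<lambda>x. gain v (f x) (regularize (g x)) (h x)) \<in> borel_measurable R"
  unfolding gain_def by measurable

lemma regularize_path: "\<omega> \<in> space M \<Longrightarrow> regularize (path \<omega>) = path \<omega>"
  by (intro regularize_eq_fun counting_path_path)

lemma measurable_path: "path \<in> measurable M path_space"
  by (rule measurable_into_path_space) (simp add: path_def measurable_N)

text \<open>On paths of \<open>N\<close> regularization changes nothing, so joint measurability
  proved for regularized paths carries over.\<close>

lemma measurable_along_path:
  assumes "(\<lambda>x. F x (regularize (path (g x)))) \<in> measurable R S"
    and "g \<in> measurable R M"
  shows "(\<lambda>x. F x (path (g x))) \<in> measurable R S"
  using assms(1) by (rule measurable_cong[THEN iffD1, rotated])
    (simp add: regularize_path measurable_space[OF assms(2)])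

lemma measurable_gain_path [measurable (raw)]:
  assumes [measurable]: "f \<in> borel_measurable R" "g \<in> measurable R M" "h \<in> borel_measurable R"
    "v \<in> borel_measurable borel"
  shows "(\<lambda>x. gain v (f x) (path (g x)) (h x)) \<in> borel_measurable R"
  by (rule measurable_along_path[where F="\<lambda>x w. gain v (f x) w (h x)"])
    (intro measurable_gain measurable_compose[OF _ measurable_path] assms)+

lemma measurable_run_path [measurable (raw)]:
  assumes [measurable]: "f \<in> borel_measurable R" "g \<in> measurable R M" "h \<in> borel_measurable R"
  shows "(\<lambda>x. run (f x) (path (g x)) (h x)) \<in> borel_measurable R"
  by (rule measurable_along_path[where F="\<lambda>x w. run (f x) w (h x)"])
    (intro measurable_run measurable_compose[OF _ measurable_path] assms)+

lemma measurable_state_path [measurable (raw)]: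
  assumes [measurable]: "f \<in> borel_measurable R" "g \<in> measurable R M" "h \<in> borel_measurable R"
  shows "(\<lambda>x. state (f x) (path (g x)) (h x)) \<in> borel_measurable R"
  by (rule measurable_along_path[where F="\<lambda>x w. state (f x) w (h x)"])
    (intro measurable_state measurable_compose[OF _ measurable_path] assms)+

lemma measurable_Q [measurable]:
  assumes [measurable]: "f \<in> borel_measurable borel"
  shows "Q h f \<in> borel_measurable borel"
  unfolding Q_def by (rule borel_measurable_nn_integral) measurable

text \<open>The state at \<open>t\<close> sees the path on [0, t] only, and every coordinate of the
  path stopped at \<open>t\<close> is some \<open>N u\<close> with u \<le> t.\<close>

lemma measurable_state_past:
  assumes t: "0 \<le> t"
  shows "(\<lambda>\<omega>. state p (path \<omega>) t) \<in> borel_measurable (past t)"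
proof -
  have g: "(\<lambda>\<omega> u. path \<omega> (min t u)) \<in> measurable (past t) path_space"
    by (rule measurable_into_path_space) (use t in \<open>auto simp: path_def intro!: measurable_N_past\<close>)
  have "(\<lambda>\<omega>. state p (regularize (\<lambda>u. path \<omega> (min t u))) t) \<in> borel_measurable (past t)"
    by (intro measurable_state g) auto
  then show ?thesis
  proof (rule measurable_cong[THEN iffD1, rotated])
    fix \<omega> assume "\<omega> \<in> space (past t)"
    then have "counting_path (\<lambda>u. path \<omega> (min t u))"
      by (intro counting_path_stop counting_path_path) simp
    then have "state p (regularize (\<lambda>u. path \<omega> (min t u))) t = state p (\<lambda>u. path \<omega> (min t u)) t"
      by (simp add: regularize_eq_fun)
    also have "\<dots> = state p (path \<omega>) t" using t by (intro state_cong) auto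
    finally show "state p (regularize (\<lambda>u. path \<omega> (min t u))) t = state p (path \<omega>) t" .
  qed
qed

lemma run_0: "run p w 0 = 0"
proof -
  have "AE s in lborel. s \<noteq> (0::real)" by (rule AE_lborel_singleton)
  then have "AE s in lborel. indicator {0..0::real} s * (ennreal (exp (- lam * s)) * total_mass (state p w s)) = 0"
    by eventually_elim simp
  then show ?thesis unfolding run_def by (subst nn_integral_cong_AE[where v="\<lambda>_. 0"]) auto
qed

lemma run_mono: "s \<le> t \<Longrightarrow> run p w s \<le> run p w t"
  unfolding run_def by (intro nn_integral_mono mult_right_mono) (auto simp: indicator_def)

lemma run_add:
  assumes w: "counting_path w" and t: "0 \<le> t" "0 \<le> s"
  shows "run p w (t + s) = run p w t + ennreal (exp (- lam * t)) * run (state p w t) (shift_path t w) s"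
proof -
  let ?F = "\<lambda>s. ennreal (exp (- lam * s)) * total_mass (state p w s)"
  let ?G = "\<lambda>s. ennreal (exp (- lam * s)) * total_mass (state (state p w t) (shift_path t w) s)"
  have st [measurable]: "(\<lambda>s. state p w s) \<in> borel_measurable borel" if "counting_path w" for p w
  proof -
    have "(\<lambda>s. state p (regularize w) s) \<in> borel_measurable borel"
      by (intro measurable_state) (auto simp: space_PiM)
    then show ?thesis by (simp add: regularize_eq_fun that)
  qed
  note [measurable] = st[OF w] st[OF counting_path_shift[OF w]]
  have "run p w (t + s) = (\<integral>\<^sup>+u. indicator {0..t} u * ?F u + indicator {t..t+s} u * ?F u \<partial>lborel)"
    unfolding run_def using AE_lborel_singleton[of t]
    by (intro nn_integral_cong_AE) (use t in \<open>auto simp: indicator_def\<close>)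
  also have "\<dots> = run p w t + (\<integral>\<^sup>+u. indicator {t..t+s} u * ?F u \<partial>lborel)"
    unfolding run_def by (rule nn_integral_add) auto
  also have "(\<integral>\<^sup>+u. indicator {t..t+s} u * ?F u \<partial>lborel) = (\<integral>\<^sup>+u. indicator {t..t+s} (t + 1 * u) * ?F (t + 1 * u) \<partial>lborel)"
    by (subst nn_integral_real_affine[where c=1 and t=t]) auto
  also have "\<dots> = (\<integral>\<^sup>+u. ennreal (exp (- lam * t)) * (indicator {0..s} u * ?G u) \<partial>lborel)"
  proof (rule nn_integral_cong)
    fix u :: real
    show "indicator {t..t+s} (t + 1 * u) * ?F (t + 1 * u) = ennreal (exp (- lam * t)) * (indicator {0..s} u * ?G u)"
    proof (cases "0 \<le> u \<and> u \<le> s")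
      case True
      then have "ennreal (exp (- lam * (t + u))) = ennreal (exp (- lam * t)) * ennreal (exp (- lam * u))"
        by (simp add: ennreal_mult[symmetric] exp_add[symmetric] algebra_simps)
      then show ?thesis using True state_add[OF w t(1), of u p] by (simp add: mult.assoc)
    qed (auto simp: indicator_def)
  qed
  also have "\<dots> = ennreal (exp (- lam * t)) * run (state p w t) (shift_path t w) s"
    unfolding run_def by (rule nn_integral_cmult) auto
  finally show ?thesis .
qed

lemma gain_add:
  assumes w: "counting_path w" and t: "0 \<le> t" "0 \<le> s"
  shows "gain f p w (t + s) = run p w t + ennreal (exp (- lam * t)) * gain f (state p w t) (shift_path t w) s"
proof -
  have e: "ennreal (exp (- lam * (t + s))) = ennreal (exp (- lam * t)) * ennreal (exp (- lam * s))"
    by (simp add: ennreal_mult[symmetric] exp_add[symmetric] algebra_simps)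
  show ?thesis
    unfolding gain_def run_add[OF assms] state_add[OF assms] e by (simp add: algebra_simps)
qed

lemma gain_0: "counting_path w \<Longrightarrow> w 0 = 0 \<Longrightarrow> gain f p w 0 = f p"
  by (simp add: gain_def run_0 state_0)

lemma gain_mono: "(\<And>q. f q \<le> g q) \<Longrightarrow> gain f p w t \<le> gain g p w t"
  unfolding gain_def by (intro add_left_mono mult_left_mono) auto

lemma Q_mono: "(\<And>q. f q \<le> g q) \<Longrightarrow> Q h f p \<le> Q h g p"
  unfolding Q_def by (intro nn_integral_mono gain_mono) auto

text \<open>After splitting the gain at \<open>t\<close>, the remaining part is a function of an
  event and a state known at \<open>t\<close> and of the later increments, so
  \<open>simple_Markov\<close> averages it to \<open>Q s f\<close>. The event \<open>A\<close>
  carries the decision not to have stopped yet.\<close>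

lemma Markov_step:
  assumes A: "A \<in> sets (past t)" and t: "0 \<le> t" "0 \<le> s" and [measurable]: "f \<in> borel_measurable borel"
  shows "(\<integral>\<^sup>+\<omega>. indicator A \<omega> * gain f p (path \<omega>) (t + s) \<partial>M) = (\<integral>\<^sup>+\<omega>. indicator A \<omega> * gain (Q s f) p (path \<omega>) t \<partial>M)"
proof -
  have AM [measurable]: "A \<in> sets M" using A sets_past_subset by auto
  let ?e = "ennreal (exp (- lam * t))"
  \<comment> \<open>The second component passes through \<open>regularize\<close> to make this
    measurable on the product; the actual increments are counting paths, which it leaves
    fixed.\<close>
  let ?\<psi> = "\<lambda>z. indicator A (fst z) * (?e * gain f (state p (path (fst z)) t) (regularize (snd z)) s)"
  have \<psi>: "?\<psi> \<in> borel_measurable (past t \<Otimes>\<^sub>M path_space)"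
    by (intro borel_measurable_times_ennreal borel_measurable_const measurable_gain
        measurable_compose[OF measurable_fst measurable_state_past] measurable_snd
        measurable_compose[OF measurable_fst borel_measurable_indicator] A t) measurable
  have "(\<integral>\<^sup>+\<omega>. indicator A \<omega> * gain f p (path \<omega>) (t + s) \<partial>M)
    = (\<integral>\<^sup>+\<omega>. indicator A \<omega> * run p (path \<omega>) t + ?\<psi> (\<omega>, incr t \<omega>) \<partial>M)"
    by (intro nn_integral_cong)
      (simp add: gain_add[OF counting_path_path t] regularize_eq_fun counting_path_shift counting_path_path distrib_left)
  also have "\<dots> = (\<integral>\<^sup>+\<omega>. indicator A \<omega> * run p (path \<omega>) t \<partial>M) + (\<integral>\<^sup>+\<omega>. ?\<psi> (\<omega>, incr t \<omega>) \<partial>M)"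
  proof (rule nn_integral_add)
    have "(\<lambda>\<omega>. (\<omega>, incr t \<omega>)) \<in> measurable M (past t \<Otimes>\<^sub>M path_space)"
      by (intro measurable_Pair measurable_incr t measurable_from_past[of _ t]) simp
    from measurable_compose[OF this \<psi>] show "(\<lambda>\<omega>. ?\<psi> (\<omega>, incr t \<omega>)) \<in> borel_measurable M" .
  qed measurable
  also have "(\<integral>\<^sup>+\<omega>. ?\<psi> (\<omega>, incr t \<omega>) \<partial>M) = (\<integral>\<^sup>+\<omega>. (\<integral>\<^sup>+\<omega>'. ?\<psi> (\<omega>, path \<omega>') \<partial>M) \<partial>M)"
    by (rule simple_Markov[OF t(1) \<psi>])
  also have "\<dots> = (\<integral>\<^sup>+\<omega>. indicator A \<omega> * (?e * Q s f (state p (path \<omega>) t)) \<partial>M)"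
  proof (rule nn_integral_cong)
    fix \<omega> assume "\<omega> \<in> space M"
    have "(\<integral>\<^sup>+\<omega>'. ?\<psi> (\<omega>, path \<omega>') \<partial>M) = (\<integral>\<^sup>+\<omega>'. (indicator A \<omega> * ?e) * gain f (state p (path \<omega>) t) (path \<omega>') s \<partial>M)"
      by (intro nn_integral_cong) (simp add: regularize_path mult.assoc)
    also have "\<dots> = indicator A \<omega> * (?e * Q s f (state p (path \<omega>) t))"
      unfolding Q_def by (subst nn_integral_cmult) (auto simp: mult.assoc)
    finally show "(\<integral>\<^sup>+\<omega>'. ?\<psi> (\<omega>, path \<omega>') \<partial>M) = indicator A \<omega> * (?e * Q s f (state p (path \<omega>) t))" .
  qed
  also have "(\<integral>\<^sup>+\<omega>. indicator A \<omega> * run p (path \<omega>) t \<partial>M) + \<dots> = (\<integral>\<^sup>+\<omega>. indicator A \<omega> * gain (Q s f) p (path \<omega>) t \<partial>M)"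
    by (subst nn_integral_add[symmetric]) (auto simp: gain_def algebra_simps intro!: nn_integral_cong)
  finally show ?thesis .
qed

definition spread :: "real \<times> real \<Rightarrow> real \<times> real \<Rightarrow> (real \<Rightarrow> nat) \<Rightarrow> real \<Rightarrow> real" where
  "spread p q w t = exp ((lam + 1) * t) * (1 - 1/\<mu>) ^ w t * \<bar>fst p - fst q\<bar> + exp ((lam - 1) * t) * (1 + 1/\<mu>) ^ w t * \<bar>snd p - snd q\<bar>"

lemma dist1_state: "dist1 (state p w t) (state q w t) = spread p q w t"
  unfolding dist1_def state_def spread_def using z_pos by (simp add: flow_diff abs_mult)

lemma total_mass_le: "total_mass p \<le> total_mass q + ennreal (dist1 p q)"
proof -
  have "total_mass p \<le> ennreal (max 0 (fst q + snd q) + dist1 p q)"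
    unfolding total_mass_def dist1_def by (intro ennreal_leI) auto
  also have "\<dots> = total_mass q + ennreal (dist1 p q)"
    unfolding total_mass_def by (subst ennreal_plus) (auto simp: dist1_def max_def ennreal_neg)
  finally show ?thesis .
qed

text \<open>The generating function turns the jump factors into exp(-t) and exp(t), which exactly
  cancel the factors exp(t) and exp(-t) that discounting leaves of the rates lam + 1 and lam -
  1.\<close>

lemma expected_spread:
  assumes t: "0 \<le> t"
  shows "(\<integral>\<^sup>+\<omega>. ennreal (exp (- lam * t) * spread p q (path \<omega>) t) \<partial>M) = ennreal (dist1 p q)"
proof -
  have [measurable]: "N t \<in> measurable M (count_space UNIV)" by (rule measurable_N) fact
  have "(\<integral>\<^sup>+\<omega>. ennreal (exp (- lam * t) * spread p q (path \<omega>) t) \<partial>M)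
     = (\<integral>\<^sup>+\<omega>. ennreal (exp t * \<bar>fst p - fst q\<bar>) * ennreal ((1 - 1/\<mu>) ^ N t \<omega>)
          + ennreal (exp (- t) * \<bar>snd p - snd q\<bar>) * ennreal ((1 + 1/\<mu>) ^ N t \<omega>) \<partial>M)"
  proof (rule nn_integral_cong)
    fix \<omega>
    have "exp (- lam * t) * spread p q (path \<omega>) t = exp t * \<bar>fst p - fst q\<bar> * (1 - 1/\<mu>) ^ N t \<omega> + exp (- t) * \<bar>snd p - snd q\<bar> * (1 + 1/\<mu>) ^ N t \<omega>"
    proof -
      have "exp ((lam + 1) * t) = exp (lam * t) * exp t" "exp ((lam - 1) * t) = exp (lam * t) * exp (-t)"
        by (simp_all add: exp_add[symmetric] algebra_simps)
      then show ?thesis using t by (simp add: spread_def path_simps exp_minus field_simps)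
    qed
    then show "ennreal (exp (- lam * t) * spread p q (path \<omega>) t) = ennreal (exp t * \<bar>fst p - fst q\<bar>) * ennreal ((1 - 1/\<mu>) ^ N t \<omega>)
          + ennreal (exp (- t) * \<bar>snd p - snd q\<bar>) * ennreal ((1 + 1/\<mu>) ^ N t \<omega>)"
      using z_pos by (simp add: ennreal_mult[symmetric] ennreal_plus[symmetric] del: ennreal_plus)
  qed
  also have "\<dots> = ennreal (exp t * \<bar>fst p - fst q\<bar>) * ennreal (exp (\<mu> * t * ((1 - 1/\<mu>) - 1)))
       + ennreal (exp (- t) * \<bar>snd p - snd q\<bar>) * ennreal (exp (\<mu> * t * ((1 + 1/\<mu>) - 1)))"
    using z_pos by (simp add: nn_integral_add nn_integral_cmult nn_integral_power_N t)
  also have "\<dots> = ennreal (exp t * \<bar>fst p - fst q\<bar> * exp (- t) + exp (- t) * \<bar>snd p - snd q\<bar> * exp t)"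
    using mu_gt_1 by (simp add: ennreal_mult[symmetric] ennreal_plus[symmetric] del: ennreal_plus)
  also have "\<dots> = ennreal (dist1 p q)"
    by (simp add: dist1_def exp_minus field_simps)
  finally show ?thesis .
qed

end

section \<open>Values of the discretized problems\<close>

lemma dist1_le_dist: "dist1 p q \<le> 2 * dist p q"
proof -
  have "\<bar>fst p - fst q\<bar> \<le> dist p q" using dist_fst_le[of p q] by (simp add: dist_real_def)
  moreover have "\<bar>snd p - snd q\<bar> \<le> dist p q" using dist_snd_le[of p q] by (simp add: dist_real_def)
  ultimately show ?thesis by (simp add: dist1_def)
qed

lemma dist1_commute: "dist1 p q = dist1 q p" and dist1_nonneg: "0 \<le> dist1 p q"
  by (auto simp: dist1_def abs_minus_commute)

lemma measurable_dist1 [measurable (raw)]: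
  assumes "f \<in> borel_measurable R" "g \<in> borel_measurable R"
  shows "(\<lambda>x. dist1 (f x) (g x)) \<in> borel_measurable R"
proof -
  have [measurable]: "(\<lambda>x. fst (f x)) \<in> borel_measurable R" "(\<lambda>x. snd (f x)) \<in> borel_measurable R"
     "(\<lambda>x. fst (g x)) \<in> borel_measurable R" "(\<lambda>x. snd (g x)) \<in> borel_measurable R"
    using assms by (simp_all add: borel_prod[symmetric])
  show ?thesis unfolding dist1_def by measurable
qed

text \<open>Approaching from the right, the points end up in an interval without jumps, on which the
  flow is continuous.\<close>

lemma continuous_flow_right:
  assumes w: "counting_path w" "z > 0" and t: "0 \<le> t" "\<And>k. t \<le> u k" "u \<longlonglongrightarrow> t"
  shows "(\<lambda>k::nat. flow \<rho> z a w v (u k)) \<longlonglongrightarrow> flow \<rho> z a w v t"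
proof -
  obtain d where d: "d > 0" "\<And>s. t \<le> s \<Longrightarrow> s < t + d \<Longrightarrow> w s = w t"
    using counting_pathD(2)[OF w(1), of t] by blast
  have "continuous_on {t..<t+d} (flow \<rho> z a w v)"
  proof (rule continuous_on_flow[OF w, where T="t + d" and n="w t"])
    show "{t..<t+d} \<subseteq> {0..t+d}" using t(1) by auto
    show "w s = w t" if "s \<in> {t..<t+d}" for s by (rule d(2)) (use that in auto)
  qed
  then have "continuous (at t within {t..<t+d}) (flow \<rho> z a w v)"
    using d(1) by (simp add: continuous_on_eq_continuous_within)
  moreover have "eventually (\<lambda>k. u k \<in> {t..<t+d}) sequentially"
    using order_tendstoD(2)[OF t(3), of "t + d"] d(1) t(2) by (auto elim!: eventually_mono)
  ultimately show ?thesis using t(3) by (rule continuous_within_tendsto_compose)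
qed

lemma flow_bound_mono_time:
  assumes "0 \<le> t" "t \<le> T"
  shows "flow_bound \<rho> z a v t n \<le> flow_bound \<rho> z a v T n"
proof -
  have "1 \<le> max 1 z * max 1 (1/z)" using mult_mono[of 1 "max 1 z" 1 "max 1 (1/z)"] by simp
  moreover have "\<bar>\<rho>\<bar> * t \<le> \<bar>\<rho>\<bar> * T" using assms by (intro mult_left_mono) auto
  ultimately show ?thesis unfolding flow_bound_def using assms
    by (intro mult_mono add_mono mult_nonneg_nonneg add_nonneg_nonneg order_refl) auto
qed

text \<open>Fatou's lemma with convergent upper bounds, the common form of the passages to the limit
  in the mesh, the jump bound, the horizon and the tolerance.\<close>

lemma nn_integral_le_Fatou:
  fixes f :: "nat \<Rightarrow> 'a \<Rightarrow> ennreal"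
  assumes "\<And>n. f n \<in> borel_measurable M" "\<And>n. (\<integral>\<^sup>+x. f n x \<partial>M) \<le> c n" "c \<longlonglongrightarrow> c0"
    "\<And>x. x \<in> space M \<Longrightarrow> H x \<le> liminf (\<lambda>n. f n x)"
  shows "(\<integral>\<^sup>+x. H x \<partial>M) \<le> c0"
proof -
  have "(\<integral>\<^sup>+x. H x \<partial>M) \<le> (\<integral>\<^sup>+x. liminf (\<lambda>n. f n x) \<partial>M)"
    using assms(4) by (rule nn_integral_mono)
  also have "\<dots> \<le> liminf (\<lambda>n. \<integral>\<^sup>+x. f n x \<partial>M)" by (rule nn_integral_liminf) fact
  also have "\<dots> \<le> liminf c" by (rule Liminf_mono) (simp add: assms(2))
  also have "\<dots> = c0" using assms(3) by (intro lim_imp_Liminf) auto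
  finally show ?thesis .
qed

context stopping_problem
begin

lemma run_bound:
  assumes w: "counting_path w" and T: "0 \<le> T"
  shows "run p w T \<le> ennreal (flow_bound (lam + 1) (1 - 1/\<mu>) a (fst p) T (w T) + flow_bound (lam - 1) (1 + 1/\<mu>) b (snd p) T (w T)) * ennreal T"
    (is "_ \<le> ?B * _")
proof -
  have "run p w T \<le> (\<integral>\<^sup>+s. ?B * indicator {0..T} s \<partial>lborel)"
    unfolding run_def
  proof (rule nn_integral_mono)
    fix s :: real
    show "indicator {0..T} s * (ennreal (exp (- lam * s)) * total_mass (state p w s)) \<le> ?B * indicator {0..T} s"
    proof (cases "s \<in> {0..T}")
      case True
      then have s: "0 \<le> s" "s \<le> T" by auto
      have "total_mass (state p w s) \<le> ?B"
        unfolding total_mass_def state_def fst_conv snd_conv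
        by (rule ennreal_leI[OF add_mono[OF order_trans[OF abs_ge_self flow_bound[OF w z_pos(1) s]]
              order_trans[OF abs_ge_self flow_bound[OF w z_pos(2) s]]]])
      moreover have "ennreal (exp (- lam * s)) \<le> 1" using lam True by simp
      ultimately have "ennreal (exp (- lam * s)) * total_mass (state p w s) \<le> 1 * ?B"
        by (intro mult_mono) auto
      then show ?thesis using True by simp
    qed simp
  qed
  also have "\<dots> = ?B * ennreal T" using T by (subst nn_integral_cmult_indicator) auto
  finally show ?thesis .
qed

lemma run_finite: "counting_path w \<Longrightarrow> 0 \<le> T \<Longrightarrow> run p w T < \<infinity>"
  by (rule le_less_trans[OF run_bound]) (simp_all add: ennreal_mult_less_top)

text \<open>The bound is geometric in the count, so its expectation is a multiple of a value of the
  Poisson generating function.\<close>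

lemma expected_flow_bound_finite:
  assumes "0 \<le> T" "0 < z"
  shows "(\<integral>\<^sup>+\<omega>. ennreal (flow_bound \<rho> z v x T (N T \<omega>)) \<partial>M) < \<infinity>"
proof -
  define C where "C = exp (\<bar>\<rho>\<bar> * T) * (\<bar>x\<bar> + T * (\<bar>v\<bar> * exp (\<bar>\<rho>\<bar> * T)))"
  define Y where "Y = max 1 z * max 1 (1/z)"
  have C: "0 \<le> C" "0 \<le> Y" using assms by (auto simp: C_def Y_def)
  have [measurable]: "N T \<in> measurable M (count_space UNIV)" by (rule measurable_N) fact
  have "(\<integral>\<^sup>+\<omega>. ennreal (flow_bound \<rho> z v x T (N T \<omega>)) \<partial>M) = (\<integral>\<^sup>+\<omega>. ennreal C * ennreal (Y ^ N T \<omega>) \<partial>M)"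
    using C by (intro nn_integral_cong) (simp add: flow_bound_def ennreal_mult[symmetric] flip: C_def Y_def)
  also have "\<dots> = ennreal C * ennreal (exp (\<mu> * T * (Y - 1)))"
    using assms C by (simp add: nn_integral_cmult nn_integral_power_N)
  also have "\<dots> < \<infinity>" by (simp add: ennreal_mult_less_top)
  finally show ?thesis .
qed

lemma expected_run_finite:
  assumes T: "0 \<le> T"
  shows "(\<integral>\<^sup>+\<omega>. run p (path \<omega>) T \<partial>M) < \<infinity>"
proof -
  let ?b0 = "\<lambda>\<omega>. flow_bound (lam + 1) (1 - 1/\<mu>) a (fst p) T (N T \<omega>)"
  let ?b1 = "\<lambda>\<omega>. flow_bound (lam - 1) (1 + 1/\<mu>) b (snd p) T (N T \<omega>)"
  have [measurable]: "N T \<in> measurable M (count_space UNIV)" by (rule measurable_N) fact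
  have "(\<integral>\<^sup>+\<omega>. run p (path \<omega>) T \<partial>M) \<le> (\<integral>\<^sup>+\<omega>. (ennreal (?b0 \<omega>) + ennreal (?b1 \<omega>)) * ennreal T \<partial>M)"
  proof (rule nn_integral_mono)
    fix \<omega> assume "\<omega> \<in> space M"
    then have "run p (path \<omega>) T \<le> ennreal (?b0 \<omega> + ?b1 \<omega>) * ennreal T"
      using run_bound[OF counting_path_path T, of \<omega> p] T by (simp add: path_simps)
    also have "ennreal (?b0 \<omega> + ?b1 \<omega>) = ennreal (?b0 \<omega>) + ennreal (?b1 \<omega>)"
      using T by (intro ennreal_plus) (auto simp: flow_bound_def)
    finally show "run p (path \<omega>) T \<le> (ennreal (?b0 \<omega>) + ennreal (?b1 \<omega>)) * ennreal T" .
  qed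
  also have "\<dots> = ((\<integral>\<^sup>+\<omega>. ennreal (?b0 \<omega>) \<partial>M) + (\<integral>\<^sup>+\<omega>. ennreal (?b1 \<omega>) \<partial>M)) * ennreal T"
    by (simp add: nn_integral_multc nn_integral_add)
  also have "\<dots> < \<infinity>"
    using expected_flow_bound_finite[OF T z_pos(1)] expected_flow_bound_finite[OF T z_pos(2)]
    by (simp add: ennreal_mult_less_top)
  finally show ?thesis .
qed

definition lipschitz :: "real \<Rightarrow> (real \<times> real \<Rightarrow> ennreal) \<Rightarrow> bool" where
  "lipschitz L f \<longleftrightarrow> (\<forall>p q. f p \<le> f q + ennreal (L * dist1 p q))"

text \<open>Along a common path the terminal term contributes L and the running term h times the
  initial distance, because the expected discounted distance is constant in time; Fubini exchanges
  the time integral with the expectation.\<close>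

lemma lipschitz_Q:
  assumes f: "lipschitz L f" "f \<in> borel_measurable borel" and L: "0 \<le> L" and h: "0 \<le> h"
  shows "lipschitz (L + h) (Q h f)"
  unfolding lipschitz_def
proof (intro allI)
  fix p q
  note [measurable] = f(2)
  let ?d = "\<lambda>s \<omega>. ennreal (exp (- lam * s) * dist1 (state p (path \<omega>) s) (state q (path \<omega>) s))"
  have d: "(\<integral>\<^sup>+\<omega>. ?d s \<omega> \<partial>M) = ennreal (dist1 p q)" if "0 \<le> s" for s
    unfolding dist1_state by (rule expected_spread[OF that])
  have meas: "(\<lambda>(s, \<omega>). indicator {0..h} s * ?d s \<omega>) \<in> borel_measurable (lborel \<Otimes>\<^sub>M M)"
    by measurable
  have meas': "(\<lambda>(\<omega>, s). indicator {0..h} s * ?d s \<omega>) \<in> borel_measurable (M \<Otimes>\<^sub>M lborel)"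
    by measurable
  have "Q h f p \<le> (\<integral>\<^sup>+\<omega>. gain f q (path \<omega>) h + ((\<integral>\<^sup>+s. indicator {0..h} s * ?d s \<omega> \<partial>lborel) + ennreal L * ?d h \<omega>) \<partial>M)"
    unfolding Q_def
  proof (rule nn_integral_mono)
    fix \<omega> assume \<omega>: "\<omega> \<in> space M"
    let ?w = "path \<omega>"
    have st [measurable]: "(\<lambda>s. state p ?w s) \<in> borel_measurable borel" for p
      by (rule measurable_state_path) (use \<omega> in auto)
    have "run p ?w h \<le> (\<integral>\<^sup>+s. indicator {0..h} s * (ennreal (exp (- lam * s)) * total_mass (state q ?w s)) + indicator {0..h} s * ?d s \<omega> \<partial>lborel)"
      unfolding run_def
    proof (rule nn_integral_mono)
      fix s :: real
      have "ennreal (exp (- lam * s)) * total_mass (state p ?w s) \<le> ennreal (exp (- lam * s)) * (total_mass (state q ?w s) + ennreal (dist1 (state p ?w s) (state q ?w s)))"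
        by (intro mult_left_mono total_mass_le) auto
      also have "\<dots> = ennreal (exp (- lam * s)) * total_mass (state q ?w s) + ?d s \<omega>"
        by (simp add: distrib_left ennreal_mult dist1_nonneg)
      finally show "indicator {0..h} s * (ennreal (exp (- lam * s)) * total_mass (state p ?w s)) \<le>
          indicator {0..h} s * (ennreal (exp (- lam * s)) * total_mass (state q ?w s)) + indicator {0..h} s * ?d s \<omega>"
        unfolding distrib_left[symmetric] by (intro mult_left_mono) auto
    qed
    also have "\<dots> = run q ?w h + (\<integral>\<^sup>+s. indicator {0..h} s * ?d s \<omega> \<partial>lborel)"
      unfolding run_def by (rule nn_integral_add) measurable
    finally have 1: "run p ?w h \<le> run q ?w h + (\<integral>\<^sup>+s. indicator {0..h} s * ?d s \<omega> \<partial>lborel)" .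
    have "ennreal (exp (- lam * h)) * f (state p ?w h) \<le> ennreal (exp (- lam * h)) * (f (state q ?w h) + ennreal (L * dist1 (state p ?w h) (state q ?w h)))"
      using f(1)[unfolded lipschitz_def, rule_format, of "state p ?w h" "state q ?w h"]
      by (intro mult_left_mono) auto
    also have "\<dots> = ennreal (exp (- lam * h)) * f (state q ?w h) + ennreal L * ?d h \<omega>"
      using L dist1_nonneg by (simp add: distrib_left ennreal_mult[symmetric] mult_ac)
    finally have 2: "ennreal (exp (- lam * h)) * f (state p ?w h) \<le> ennreal (exp (- lam * h)) * f (state q ?w h) + ennreal L * ?d h \<omega>" .
    show "gain f p ?w h \<le> gain f q ?w h + ((\<integral>\<^sup>+s. indicator {0..h} s * ?d s \<omega> \<partial>lborel) + ennreal L * ?d h \<omega>)"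
      unfolding gain_def using add_mono[OF 1 2] by (simp only: ac_simps)
  qed
  also have "\<dots> = Q h f q + ((\<integral>\<^sup>+\<omega>. (\<integral>\<^sup>+s. indicator {0..h} s * ?d s \<omega> \<partial>lborel) \<partial>M) + (\<integral>\<^sup>+\<omega>. ennreal L * ?d h \<omega> \<partial>M))"
  proof -
    have [measurable]: "(\<lambda>\<omega>. \<integral>\<^sup>+s. indicator {0..h} s * ?d s \<omega> \<partial>lborel) \<in> borel_measurable M"
      using meas' by (rule lborel.borel_measurable_nn_integral)
    show ?thesis unfolding Q_def by (subst nn_integral_add; measurable) (subst nn_integral_add; measurable)
  qed
  also have "(\<integral>\<^sup>+\<omega>. ennreal L * ?d h \<omega> \<partial>M) = ennreal L * ennreal (dist1 p q)"
    unfolding d[OF h, symmetric] by (rule nn_integral_cmult) measurable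
  also have "(\<integral>\<^sup>+\<omega>. (\<integral>\<^sup>+s. indicator {0..h} s * ?d s \<omega> \<partial>lborel) \<partial>M) = (\<integral>\<^sup>+s. (\<integral>\<^sup>+\<omega>. indicator {0..h} s * ?d s \<omega> \<partial>M) \<partial>lborel)"
  proof -
    interpret P: pair_sigma_finite lborel M by standard
    show ?thesis using P.Fubini'[OF meas] .
  qed
  also have "\<dots> = (\<integral>\<^sup>+s. ennreal (dist1 p q) * indicator {0..h} s \<partial>lborel)"
  proof (rule nn_integral_cong)
    fix s
    show "(\<integral>\<^sup>+\<omega>. indicator {0..h} s * ?d s \<omega> \<partial>M) = ennreal (dist1 p q) * indicator {0..h} s"
      using d[of s] by (cases "s \<in> {0..h}") simp_all
  qed
  also have "\<dots> = ennreal (dist1 p q) * ennreal h"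
    using h by (subst nn_integral_cmult_indicator) auto
  also have "ennreal (dist1 p q) * ennreal h + ennreal L * ennreal (dist1 p q) = ennreal ((L + h) * dist1 p q)"
    using h L dist1_nonneg by (simp add: ennreal_mult[symmetric] ennreal_plus[symmetric] algebra_simps del: ennreal_plus)
  finally show "Q h f p \<le> Q h f q + ennreal ((L + h) * dist1 p q)" .
qed

lemma Q_add_const:
  assumes f: "f \<in> borel_measurable borel"
  shows "Q h (\<lambda>q. f q + ennreal d) p = Q h f p + ennreal (exp (- lam * h)) * ennreal d"
proof -
  note [measurable] = f
  have "Q h (\<lambda>q. f q + ennreal d) p = (\<integral>\<^sup>+\<omega>. gain f p (path \<omega>) h + ennreal (exp (- lam * h)) * ennreal d \<partial>M)"
    unfolding Q_def gain_def by (simp add: distrib_left add.assoc)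
  also have "\<dots> = Q h f p + (\<integral>\<^sup>+\<omega>. ennreal (exp (- lam * h)) * ennreal d \<partial>M)"
    unfolding Q_def by (subst nn_integral_add) auto
  finally show ?thesis by (simp add: emeasure_space_1)
qed

section \<open>Value iteration on a grid, its limit, and refinement of the grid\<close>

primrec value_iter :: "real \<Rightarrow> nat \<Rightarrow> real \<times> real \<Rightarrow> ennreal" where
  "value_iter h 0 = (\<lambda>_. ennreal K)"
| "value_iter h (Suc n) = (\<lambda>p. min (ennreal K) (Q h (value_iter h n) p))"

definition grid_value :: "real \<Rightarrow> real \<times> real \<Rightarrow> ennreal" where
  "grid_value h p = (INF n. value_iter h n p)"

definition limit_value :: "real \<times> real \<Rightarrow> ennreal" where
  "limit_value p = (INF k. grid_value (1 / 2 ^ k) p)"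

lemma measurable_value_iter [measurable]: "value_iter h n \<in> borel_measurable borel"
  by (induction n) (simp_all add: measurable_Q borel_measurable_min)

lemma measurable_grid_value [measurable]: "grid_value h \<in> borel_measurable borel"
  unfolding grid_value_def by measurable

lemma measurable_limit_value [measurable]: "limit_value \<in> borel_measurable borel"
  unfolding limit_value_def by measurable

lemma value_iter_le: "value_iter h n p \<le> ennreal K"
  by (cases n) auto

lemma grid_value_le_iter: "grid_value h p \<le> value_iter h n p"
  unfolding grid_value_def by (rule INF_lower) auto

lemma limit_value_le_grid: "limit_value p \<le> grid_value (1 / 2 ^ k) p"
  unfolding limit_value_def by (rule INF_lower) auto

lemma grid_value_le: "grid_value h p \<le> ennreal K"
  using grid_value_le_iter[of h p 0] by simp

lemma limit_value_le: "limit_value p \<le> ennreal K"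
  using limit_value_le_grid grid_value_le order_trans by blast

lemma value_iter_decseq: "decseq (\<lambda>n. value_iter h n p)"
proof (rule decseq_SucI)
  fix n show "value_iter h (Suc n) p \<le> value_iter h n p"
  proof (induction n arbitrary: p)
    case (Suc n)
    show ?case unfolding value_iter.simps(2)[of h "Suc n"] value_iter.simps(2)[of h n]
      by (intro min.mono order_refl Q_mono Suc[unfolded value_iter.simps(2)])
  qed simp
qed

text \<open>The start is constant and each application of \<open>Q h\<close> adds h, so the
  Lipschitz constant is the horizon n h.\<close>

lemma value_iter_lipschitz: "0 \<le> h \<Longrightarrow> lipschitz (real n * h) (value_iter h n)"
proof (induction n)
  case 0
  then show ?case by (simp add: lipschitz_def)
next
  case (Suc n)
  have "lipschitz (real n * h + h) (Q h (value_iter h n))"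
    using Suc by (intro lipschitz_Q) auto
  then show ?case
    by (auto simp: lipschitz_def algebra_simps min_def intro: add_increasing2 order_trans)
qed

text \<open>The iterates decrease, and the limit passes through \<open>Q h\<close> by dominated
  convergence: all iterates are below \<open>K\<close>, and the gain with constant \<open>K\<close>
  has finite expectation.\<close>

lemma grid_value_fixpoint:
  assumes h: "0 \<le> h"
  shows "grid_value h p = min (ennreal K) (Q h (grid_value h) p)"
proof -
  have lim: "(\<lambda>n. value_iter h n q) \<longlonglongrightarrow> grid_value h q" for q
    unfolding grid_value_def by (rule LIMSEQ_INF[OF value_iter_decseq])
  have fin: "Q h (\<lambda>_. ennreal K) p < \<infinity>"
  proof -
    have "Q h (\<lambda>_. ennreal K) p = (\<integral>\<^sup>+\<omega>. run p (path \<omega>) h \<partial>M) + (\<integral>\<^sup>+\<omega>. ennreal (exp (- lam * h)) * ennreal K \<partial>M)"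
      unfolding Q_def gain_def by (subst nn_integral_add) auto
    then show ?thesis using expected_run_finite[OF h] by (simp add: emeasure_space_1 ennreal_mult_less_top)
  qed
  have "(\<lambda>n. Q h (value_iter h n) p) \<longlonglongrightarrow> Q h (grid_value h) p"
    unfolding Q_def
  proof (rule nn_integral_dominated_convergence)
    show "(\<integral>\<^sup>+\<omega>. gain (\<lambda>_. ennreal K) p (path \<omega>) h \<partial>M) < \<infinity>" using fin by (simp add: Q_def)
    show "AE \<omega> in M. gain (value_iter h j) p (path \<omega>) h \<le> gain (\<lambda>_. ennreal K) p (path \<omega>) h" for j
      by (intro AE_I2 gain_mono value_iter_le)
    show "AE \<omega> in M. (\<lambda>j. gain (value_iter h j) p (path \<omega>) h) \<longlonglongrightarrow> gain (grid_value h) p (path \<omega>) h"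
      unfolding gain_def by (intro AE_I2 tendsto_add tendsto_const ennreal_tendsto_cmult lim) auto
  qed measurable
  then have "(\<lambda>n. value_iter h (Suc n) p) \<longlonglongrightarrow> min (ennreal K) (Q h (grid_value h) p)"
    unfolding value_iter.simps by (intro tendsto_min tendsto_const)
  moreover have "(\<lambda>n. value_iter h (Suc n) p) \<longlonglongrightarrow> grid_value h p"
    using lim by (rule LIMSEQ_Suc)
  ultimately show ?thesis by (rule LIMSEQ_unique[rotated])
qed

text \<open>Iterate n is the value when a stop is forced after n steps, which costs at most K at
  time n h. In the induction \<open>Q_add_const\<close> multiplies the error by exp(-lam h) at each
  step.\<close>

lemma value_iter_le_grid:
  assumes h: "0 \<le> h"
  shows "value_iter h n p \<le> grid_value h p + ennreal (K * exp (- lam * (real n * h)))"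
proof (induction n arbitrary: p)
  case 0
  show ?case by (simp add: add_increasing)
next
  case (Suc n)
  have "Q h (value_iter h n) p \<le> Q h (\<lambda>q. grid_value h q + ennreal (K * exp (- lam * (real n * h)))) p"
    by (intro Q_mono Suc)
  also have "\<dots> = Q h (grid_value h) p + ennreal (K * exp (- lam * (real (Suc n) * h)))"
    using K by (subst Q_add_const) (auto simp: ennreal_mult[symmetric] exp_add[symmetric] algebra_simps)
  finally have "value_iter h (Suc n) p \<le> min (ennreal K) (Q h (grid_value h) p + ennreal (K * exp (- lam * (real (Suc n) * h))))"
    unfolding value_iter.simps(2) by (intro min.mono order_refl)
  also have "\<dots> \<le> min (ennreal K) (Q h (grid_value h) p) + ennreal (K * exp (- lam * (real (Suc n) * h)))"
    by (auto simp: min_def intro: add_increasing2)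
  finally show ?case using grid_value_fixpoint[OF h, of p] by simp
qed

lemma exp_decay_tendsto: "(\<lambda>T. K * exp (- lam * real T)) \<longlonglongrightarrow> 0"
proof -
  have "(\<lambda>T. exp (- lam) ^ T) \<longlonglongrightarrow> 0" using lam by (intro LIMSEQ_realpow_zero) auto
  then have "(\<lambda>T. exp (- lam * real T)) \<longlonglongrightarrow> 0"
    by (simp add: exp_of_nat_mult[symmetric] mult.commute)
  then show ?thesis by (rule tendsto_mult_right_zero)
qed

text \<open>T is a free horizon: the first term is the error of forcing a stop at T, the second the
  Lipschitz estimate up to T. Since the mesh does not occur, the bound survives its limit.\<close>

definition has_modulus :: "(real \<times> real \<Rightarrow> ennreal) \<Rightarrow> bool" where
  "has_modulus f \<longleftrightarrow> (\<forall>p q. \<forall>T::nat. f p \<le> f q + ennreal (K * exp (- lam * T) + T * dist1 p q))"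

lemma grid_value_modulus: "has_modulus (grid_value (1 / 2 ^ k))"
  unfolding has_modulus_def
proof (intro allI)
  fix p q and T :: nat
  \<comment> \<open>With this number of steps the horizon is exactly T for every k.\<close>
  let ?h = "1 / 2 ^ k :: real" and ?n = "T * 2 ^ k"
  have n: "real ?n * ?h = real T" by simp
  have "grid_value ?h p \<le> value_iter ?h ?n p" by (rule grid_value_le_iter)
  also have "\<dots> \<le> value_iter ?h ?n q + ennreal (T * dist1 p q)"
    using value_iter_lipschitz[of ?h ?n] unfolding n lipschitz_def by (metis zero_le_divide_1_iff zero_le_numeral zero_le_power)
  also have "\<dots> \<le> grid_value ?h q + ennreal (K * exp (- lam * T)) + ennreal (T * dist1 p q)"
    using value_iter_le_grid[of ?h ?n q] unfolding n by (intro add_right_mono) simp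
  also have "\<dots> = grid_value ?h q + ennreal (K * exp (- lam * T) + T * dist1 p q)"
    using K dist1_nonneg by (simp add: add.assoc)
  finally show "grid_value ?h p \<le> grid_value ?h q + ennreal (K * exp (- lam * T) + T * dist1 p q)" .
qed

lemma limit_value_modulus: "has_modulus limit_value"
  unfolding has_modulus_def
proof (intro allI)
  fix p q and T :: nat
  let ?c = "ennreal (K * exp (- lam * T) + T * dist1 p q)"
  have "limit_value p - ?c \<le> grid_value (1 / 2 ^ k) q" for k
  proof -
    have "limit_value p \<le> grid_value (1 / 2 ^ k) p" by (rule limit_value_le_grid)
    also have "\<dots> \<le> grid_value (1 / 2 ^ k) q + ?c"
      using grid_value_modulus[of k] unfolding has_modulus_def by blast
    finally show ?thesis by (simp add: ennreal_minus_le_iff add.commute)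
  qed
  then have "limit_value p - ?c \<le> limit_value q"
    unfolding limit_value_def[of q] by (intro INF_greatest)
  then show "limit_value p \<le> limit_value q + ?c" by (simp add: ennreal_minus_le_iff add.commute)
qed

lemma has_modulus_continuous:
  assumes f: "has_modulus f" "\<And>p. f p \<le> ennreal K"
  shows "continuous_on UNIV f"
proof -
  define g where "g p = enn2real (f p)" for p
  have fg: "f p = ennreal (g p)" for p
    using f(2)[of p] by (auto simp: g_def ennreal_enn2real_if top_unique)
  have g0: "0 \<le> g p" for p by (simp add: g_def)
  have le: "g p \<le> g q + (K * exp (- lam * T) + T * dist1 p q)" for p q and T :: nat
  proof -
    have "ennreal (g p) \<le> ennreal (g q + (K * exp (- lam * T) + T * dist1 p q))"
      using f(1)[unfolded has_modulus_def, rule_format, of p q T] K dist1_nonneg[of p q] g0 by (simp add: fg)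
    then show ?thesis using K dist1_nonneg[of p q] g0[of q] by (subst (asm) ennreal_le_iff) auto
  qed
  have "continuous_on UNIV g"
    unfolding continuous_on_iff
  proof (intro ballI allI impI)
    fix p :: "real \<times> real" and e :: real assume e: "0 < e"
    note exp_decay_tendsto
    then have "eventually (\<lambda>T. K * exp (- lam * real T) < e / 2) sequentially"
      using e by (intro order_tendstoD(2)) auto
    then obtain T :: nat where T: "K * exp (- lam * real T) < e / 2"
      by (auto simp: eventually_sequentially)
    \<comment> \<open>One factor 2 compares \<open>dist1\<close> with \<open>dist\<close>, the other
      leaves e / 2 for the horizon error; T + 1 avoids a division by 0.\<close>
    let ?d = "e / (4 * (real T + 1))"
    show "\<exists>d>0. \<forall>q\<in>UNIV. dist q p < d \<longrightarrow> dist (g q) (g p) < e"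
    proof (intro exI conjI ballI impI)
      show "0 < ?d" using e by simp
      fix q assume "dist q p < ?d"
      then have "real T * dist1 p q \<le> real T * (2 * ?d)"
        using dist1_le_dist[of p q] by (intro mult_left_mono) (auto simp: dist_commute)
      also have "\<dots> \<le> e / 2" using e by (simp add: field_simps)
      finally have "K * exp (- lam * T) + T * dist1 p q < e" using T by simp
      then show "dist (g q) (g p) < e"
        using le[of p q T] le[of q p T] by (simp add: dist_real_def dist1_commute[of q p] abs_less_iff)
    qed
  qed
  then have "continuous_on UNIV (\<lambda>p. ennreal (g p))" by (rule continuous_on_ennreal)
  then show ?thesis by (simp add: fg[symmetric])
qed

lemma continuous_grid_value: "continuous_on UNIV (grid_value (1 / 2 ^ k))"
  using grid_value_modulus grid_value_le by (rule has_modulus_continuous)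

lemma continuous_limit_value: "continuous_on UNIV limit_value"
  using limit_value_modulus limit_value_le by (rule has_modulus_continuous)

lemma Q_Q:
  assumes "0 \<le> t" "0 \<le> s" "f \<in> borel_measurable borel"
  shows "Q (t + s) f p = Q t (Q s f) p"
proof -
  have "space M \<in> sets (past t)" using sets.top[of "past t"] by simp
  from Markov_step[OF this assms, of p] show ?thesis
    by (simp add: Q_def cong: nn_integral_cong)
qed

text \<open>More opportunities to stop cannot raise the value. The finer value r satisfies r \<le> Q
  r for the step h/2; doing this twice gives the same for the step h by the semigroup property, and
  an induction puts r below every iterate of mesh h.\<close>

lemma grid_value_halve: "0 \<le> h \<Longrightarrow> grid_value (h / 2) p \<le> grid_value h p"
proof -
  assume h: "0 \<le> h"
  let ?r = "grid_value (h / 2)"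
  have 1: "?r q \<le> Q (h / 2) ?r q" for q
    using grid_value_fixpoint[of "h/2" q] h by (simp add: min_def split: if_splits)
  have 2: "?r q \<le> Q h ?r q" for q
  proof -
    have "?r q \<le> Q (h / 2) ?r q" by (rule 1)
    also have "\<dots> \<le> Q (h / 2) (Q (h / 2) ?r) q" by (intro Q_mono 1)
    also have "\<dots> = Q h ?r q" using Q_Q[of "h/2" "h/2" ?r q] h by simp
    finally show ?thesis .
  qed
  have "?r q \<le> value_iter h n q" for n q
  proof (induction n arbitrary: q)
    case (Suc n)
    have "?r q \<le> Q h ?r q" by (rule 2)
    also have "\<dots> \<le> Q h (value_iter h n) q" by (intro Q_mono Suc)
    finally show ?case using grid_value_le by simp
  qed (simp add: grid_value_le)
  then show ?thesis unfolding grid_value_def[of h] by (intro INF_greatest)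
qed

lemma grid_value_decseq: "decseq (\<lambda>k. grid_value (1 / 2 ^ k) p)"
  using grid_value_halve[of "1 / 2 ^ k" p for k] by (intro decseq_SucI) (simp add: field_simps)

lemma grid_value_tendsto: "(\<lambda>k. grid_value (1 / 2 ^ k) p) \<longlonglongrightarrow> limit_value p"
  unfolding limit_value_def by (rule LIMSEQ_INF[OF grid_value_decseq])

lemma grid_value_le_Q: "0 \<le> h \<Longrightarrow> grid_value h p \<le> Q h (grid_value h) p"
  by (metis grid_value_fixpoint min.cobounded2)

text \<open>Below \<open>K\<close> the minimum in the fixed point equation is the continuation term;
  this is the supermartingale property in the continuation region.\<close>

lemma Q_le_grid_value: "0 \<le> h \<Longrightarrow> grid_value h p < ennreal K \<Longrightarrow> Q h (grid_value h) p \<le> grid_value h p"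
  by (metis grid_value_fixpoint min.strict_order_iff min_def order_refl)

end

section \<open>Optional stopping on a grid and the lower bound\<close>

context stopping_problem
begin

text \<open>The integrand cut at T dominates, and pointwise convergence can fail only at s = t0, a
  null set.\<close>

lemma run_tendsto:
  assumes w: "counting_path w" and t: "\<And>k. 0 \<le> t k" "\<And>k. t k \<le> T" "t \<longlonglongrightarrow> t0"
  shows "(\<lambda>k::nat. run p w (t k)) \<longlonglongrightarrow> run p w t0"
  unfolding run_def
proof (rule nn_integral_dominated_convergence)
  let ?F = "\<lambda>s. ennreal (exp (- lam * s)) * total_mass (state p w s)"
  have T: "0 \<le> T" using t(1)[of 0] t(2)[of 0] by simp
  have "(\<lambda>s. state p (regularize w) s) \<in> borel_measurable borel"
    by (intro measurable_state) (auto simp: space_PiM)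
  then have [measurable]: "(\<lambda>s. state p w s) \<in> borel_measurable borel" by (simp add: regularize_eq_fun w)
  show "(\<lambda>s. indicator {0..t k} s * ?F s) \<in> borel_measurable lborel" for k by measurable
  show "(\<lambda>s. indicator {0..t0} s * ?F s) \<in> borel_measurable lborel" by measurable
  show "(\<lambda>s. indicator {0..T} s * ?F s) \<in> borel_measurable lborel" by measurable
  show "(\<integral>\<^sup>+s. indicator {0..T} s * ?F s \<partial>lborel) < \<infinity>"
    using run_finite[OF w T] by (simp add: run_def)
  show "AE s in lborel. indicator {0..t k} s * ?F s \<le> indicator {0..T} s * ?F s" for k
    using order_trans[OF _ t(2)[of k]] by (intro AE_I2) (auto simp: indicator_def)
  have "AE s in lborel. s \<noteq> t0" by (rule AE_lborel_singleton)
  then show "AE s in lborel. (\<lambda>k. indicator {0..t k} s * ?F s) \<longlonglongrightarrow> indicator {0..t0} s * ?F s"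
  proof eventually_elim
    fix s assume s: "s \<noteq> t0"
    have "eventually (\<lambda>k. (s \<le> t k) = (s \<le> t0)) sequentially"
    proof (cases "s < t0")
      case True
      then show ?thesis using order_tendstoD(1)[OF t(3), of s] by (auto elim!: eventually_mono)
    next
      case False
      then have "t0 < s" using s by simp
      then show ?thesis using order_tendstoD(2)[OF t(3), of s] by (auto elim!: eventually_mono)
    qed
    then have "eventually (\<lambda>k. indicator {0..t k} s * ?F s = indicator {0..t0} s * ?F s) sequentially"
      by eventually_elim (simp add: indicator_def)
    then show "(\<lambda>k. indicator {0..t k} s * ?F s) \<longlonglongrightarrow> indicator {0..t0} s * ?F s"
      by (rule tendsto_eventually)
  qed
qed

text \<open>\<open>A i\<close> is the event of continuing at time h i. For decreasing
  \<open>A\<close> the formula is the first grid time at which \<open>A\<close> fails, capped at h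
  n; as a finite sum of indicators it is visibly measurable.\<close>

definition grid_time :: "real \<Rightarrow> (nat \<Rightarrow> 'a set) \<Rightarrow> nat \<Rightarrow> 'a \<Rightarrow> real" where
  "grid_time h A n \<omega> = h * (\<Sum>i<n. indicator (A i) \<omega>)"

lemma grid_time_cases:
  assumes "\<And>i. A (Suc i) \<subseteq> A i"
  shows "\<exists>j\<le>n. grid_time h A n \<omega> = h * real j \<and> (\<forall>i<j. \<omega> \<in> A i) \<and> (j < n \<longrightarrow> \<omega> \<notin> A j)"
proof (induction n)
  case 0
  then show ?case by (simp add: grid_time_def)
next
  case (Suc n)
  then obtain j where j: "j \<le> n" "grid_time h A n \<omega> = h * real j" "\<forall>i<j. \<omega> \<in> A i" "j < n \<longrightarrow> \<omega> \<notin> A j" by auto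
  have dec: "decseq A" using assms by (rule decseq_SucI)
  show ?case
  proof (cases "\<omega> \<in> A n")
    case True
    then have "\<omega> \<in> A j" using decseqD[OF dec j(1)] by auto
    then have "j = n" using j by auto
    then show ?thesis using j True
      by (intro exI[of _ "Suc n"]) (auto simp: grid_time_def algebra_simps less_Suc_eq)
  next
    case False
    then show ?thesis using j
      by (intro exI[of _ j]) (auto simp: grid_time_def algebra_simps less_Suc_eq dest: le_imp_less_or_eq)
  qed
qed

lemma measurable_grid_time [measurable]:
  assumes "\<And>i. A i \<in> sets M"
  shows "grid_time h A n \<in> borel_measurable M"
  using assms unfolding grid_time_def[abs_def] by measurable

text \<open>On \<open>A n\<close> the grid time is h n at stage n and h n + h at stage n + 1;
  elsewhere it no longer changes. The two expectations share \<open>B n\<close> and differ only by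
  \<open>f\<close> against \<open>Q h f\<close> on \<open>A n\<close>.\<close>

lemma grid_time_step:
  fixes p :: "real \<times> real"
  assumes A: "\<And>i. A i \<in> sets (past (h * real i))" "\<And>i. A (Suc i) \<subseteq> A i" and h: "0 \<le> h"
    and [measurable]: "f \<in> borel_measurable borel"
  defines "B \<equiv> \<lambda>n. \<integral>\<^sup>+\<omega>. indicator (space M - A n) \<omega> * gain f p (path \<omega>) (grid_time h A n \<omega>) \<partial>M"
  shows "(\<integral>\<^sup>+\<omega>. gain f p (path \<omega>) (grid_time h A n \<omega>) \<partial>M) = (\<integral>\<^sup>+\<omega>. indicator (A n) \<omega> * gain f p (path \<omega>) (h * n) \<partial>M) + B n"
    and "(\<integral>\<^sup>+\<omega>. gain f p (path \<omega>) (grid_time h A (Suc n) \<omega>) \<partial>M) = (\<integral>\<^sup>+\<omega>. indicator (A n) \<omega> * gain (Q h f) p (path \<omega>) (h * n) \<partial>M) + B n"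
proof -
  have AM [measurable]: "A i \<in> sets M" for i using A(1) sets_past_subset by blast
  have J: "grid_time h A n \<omega> = h * n" if "\<omega> \<in> A n" for \<omega>
    using grid_time_cases[of A n h \<omega>] A(2) that decseqD[OF decseq_SucI, of A _ n]
    by (metis (no_types, lifting) A(2) decseq_SucI decseqD order_le_less subsetD)
  have JS: "grid_time h A (Suc n) \<omega> = (if \<omega> \<in> A n then h * n + h else grid_time h A n \<omega>)" for \<omega>
    using J[of \<omega>] by (auto simp: grid_time_def algebra_simps)
  have "(\<integral>\<^sup>+\<omega>. gain f p (path \<omega>) (grid_time h A n \<omega>) \<partial>M) = (\<integral>\<^sup>+\<omega>. indicator (A n) \<omega> * gain f p (path \<omega>) (h * n)
      + indicator (space M - A n) \<omega> * gain f p (path \<omega>) (grid_time h A n \<omega>) \<partial>M)"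
    by (intro nn_integral_cong) (auto simp: indicator_def J)
  also have "\<dots> = (\<integral>\<^sup>+\<omega>. indicator (A n) \<omega> * gain f p (path \<omega>) (h * n) \<partial>M) + B n"
    unfolding B_def by (rule nn_integral_add) measurable
  finally show "(\<integral>\<^sup>+\<omega>. gain f p (path \<omega>) (grid_time h A n \<omega>) \<partial>M) = (\<integral>\<^sup>+\<omega>. indicator (A n) \<omega> * gain f p (path \<omega>) (h * n) \<partial>M) + B n" .
  have "(\<integral>\<^sup>+\<omega>. gain f p (path \<omega>) (grid_time h A (Suc n) \<omega>) \<partial>M) = (\<integral>\<^sup>+\<omega>. indicator (A n) \<omega> * gain f p (path \<omega>) (h * n + h)
      + indicator (space M - A n) \<omega> * gain f p (path \<omega>) (grid_time h A n \<omega>) \<partial>M)"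
    by (intro nn_integral_cong) (auto simp: indicator_def JS)
  also have "\<dots> = (\<integral>\<^sup>+\<omega>. indicator (A n) \<omega> * gain f p (path \<omega>) (h * n + h) \<partial>M) + B n"
    unfolding B_def by (rule nn_integral_add) measurable
  also have "(\<integral>\<^sup>+\<omega>. indicator (A n) \<omega> * gain f p (path \<omega>) (h * n + h) \<partial>M) = (\<integral>\<^sup>+\<omega>. indicator (A n) \<omega> * gain (Q h f) p (path \<omega>) (h * n) \<partial>M)"
    using h by (intro Markov_step A) auto
  finally show "(\<integral>\<^sup>+\<omega>. gain f p (path \<omega>) (grid_time h A (Suc n) \<omega>) \<partial>M) = (\<integral>\<^sup>+\<omega>. indicator (A n) \<omega> * gain (Q h f) p (path \<omega>) (h * n) \<partial>M) + B n" .
qed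

lemma expected_gain_0: "(\<integral>\<^sup>+\<omega>. gain f p (path \<omega>) 0 \<partial>M) = f p"
proof -
  have "(\<integral>\<^sup>+\<omega>. gain f p (path \<omega>) 0 \<partial>M) = (\<integral>\<^sup>+\<omega>. f p \<partial>M)"
    by (intro nn_integral_cong gain_0 counting_path_path) (auto simp: path_simps N_0)
  then show ?thesis by (simp add: emeasure_space_1)
qed

lemma submartingale_grid:
  assumes A: "\<And>i. A i \<in> sets (past (h * real i))" "\<And>i. A (Suc i) \<subseteq> A i" and h: "0 \<le> h"
    and f: "f \<in> borel_measurable borel" "\<And>q. f q \<le> Q h f q"
  shows "f p \<le> (\<integral>\<^sup>+\<omega>. gain f p (path \<omega>) (grid_time h A n \<omega>) \<partial>M)"
proof (induction n)
  case 0
  then show ?case by (simp add: grid_time_def expected_gain_0)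
next
  case (Suc n)
  note Suc
  also have "(\<integral>\<^sup>+\<omega>. gain f p (path \<omega>) (grid_time h A n \<omega>) \<partial>M) \<le> (\<integral>\<^sup>+\<omega>. gain f p (path \<omega>) (grid_time h A (Suc n) \<omega>) \<partial>M)"
    unfolding grid_time_step(2)[OF A h f(1), of p n] grid_time_step(1)[OF A h f(1), of p n]
    by (intro add_right_mono nn_integral_mono mult_left_mono gain_mono f) auto
  finally show ?case .
qed

text \<open>The inequality is demanded only at states reached before stopping, because
  \<open>Q h f \<le> f\<close> may fail where stopping beats continuing.\<close>

lemma supermartingale_grid:
  assumes A: "\<And>i. A i \<in> sets (past (h * real i))" "\<And>i. A (Suc i) \<subseteq> A i" and h: "0 \<le> h"
    and f: "f \<in> borel_measurable borel"
    and le: "\<And>i \<omega>. i < n \<Longrightarrow> \<omega> \<in> A i \<Longrightarrow> \<omega> \<in> space M \<Longrightarrow> Q h f (state p (path \<omega>) (h * i)) \<le> f (state p (path \<omega>) (h * i))"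
  shows "(\<integral>\<^sup>+\<omega>. gain f p (path \<omega>) (grid_time h A n \<omega>) \<partial>M) \<le> f p"
  using le
proof (induction n)
  case 0
  then show ?case by (simp add: grid_time_def expected_gain_0)
next
  case (Suc n)
  have "(\<integral>\<^sup>+\<omega>. gain f p (path \<omega>) (grid_time h A (Suc n) \<omega>) \<partial>M) \<le> (\<integral>\<^sup>+\<omega>. gain f p (path \<omega>) (grid_time h A n \<omega>) \<partial>M)"
    unfolding grid_time_step(2)[OF A h f, of p n] grid_time_step(1)[OF A h f, of p n]
  proof (intro add_right_mono nn_integral_mono)
    fix \<omega> assume \<omega>: "\<omega> \<in> space M"
    show "indicator (A n) \<omega> * gain (Q h f) p (path \<omega>) (h * n) \<le> indicator (A n) \<omega> * gain f p (path \<omega>) (h * n)"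
    proof (cases "\<omega> \<in> A n")
      case True
      then show ?thesis unfolding gain_def using Suc.prems[of n \<omega>] \<omega>
        by (intro mult_left_mono add_left_mono) auto
    qed simp
  qed
  also have "\<dots> \<le> f p" using Suc by simp
  finally show ?case .
qed

section \<open>Costs of possibly infinite stopping times and their rounding to a grid\<close>

definition run_until :: "real \<times> real \<Rightarrow> (real \<Rightarrow> nat) \<Rightarrow> ennreal \<Rightarrow> ennreal" where
  "run_until p w \<tau> = (\<integral>\<^sup>+s. indicator {s. 0 \<le> s \<and> ennreal s \<le> \<tau>} s * (ennreal (exp (- lam * s)) * total_mass (state p w s)) \<partial>lborel)"

definition discount :: "ennreal \<Rightarrow> ennreal" where
  "discount \<tau> = (if \<tau> = \<top> then 0 else ennreal (exp (- lam * enn2real \<tau>)))"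

text \<open>The original cost plus K: a terminal payment K, discounted to the stopping time, takes
  the place of the rate -lam K collected before it. Nothing is paid at infinity.\<close>

definition cost :: "real \<times> real \<Rightarrow> (real \<Rightarrow> nat) \<Rightarrow> ennreal \<Rightarrow> ennreal" where
  "cost p w \<tau> = run_until p w \<tau> + ennreal K * discount \<tau>"

lemma run_until_ennreal: "0 \<le> t \<Longrightarrow> run_until p w (ennreal t) = run p w t"
  unfolding run_until_def run_def by (intro nn_integral_cong) (auto simp: indicator_def)

lemma run_until_mono: "s \<le> t \<Longrightarrow> run_until p w s \<le> run_until p w t"
  unfolding run_until_def by (intro nn_integral_mono mult_right_mono) (auto simp: indicator_def)

lemma discount_ennreal: "0 \<le> t \<Longrightarrow> discount (ennreal t) = ennreal (exp (- lam * t))"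
  by (simp add: discount_def)

lemma measurable_discount [measurable]: "discount \<in> borel_measurable borel"
  unfolding discount_def[abs_def] by measurable

lemma measurable_run_until_path [measurable (raw)]:
  assumes [measurable]: "\<tau> \<in> borel_measurable M"
  shows "(\<lambda>\<omega>. run_until p (path \<omega>) (\<tau> \<omega>)) \<in> borel_measurable M"
  unfolding run_until_def indicator_def by (rule lborel.borel_measurable_nn_integral) (simp, measurable)

lemma measurable_cost_path [measurable (raw)]:
  assumes [measurable]: "\<tau> \<in> borel_measurable M"
  shows "(\<lambda>\<omega>. cost p (path \<omega>) (\<tau> \<omega>)) \<in> borel_measurable M"
  unfolding cost_def by measurable

lemma measurable_time:
  assumes "\<And>t. 0 \<le> t \<Longrightarrow> {\<omega>\<in>space M. \<tau> \<omega> < ennreal t} \<in> sets (past t)"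
  shows "\<tau> \<in> borel_measurable M"
proof (rule borel_measurableI_less)
  fix y :: ennreal
  show "{\<omega> \<in> space M. \<tau> \<omega> < y} \<in> sets M"
  proof (cases y)
    case (real t)
    then show ?thesis using assms sets_past_subset by blast
  next
    case top
    have "{\<omega> \<in> space M. \<tau> \<omega> < \<top>} = (\<Union>n::nat. {\<omega> \<in> space M. \<tau> \<omega> < ennreal n})"
    proof safe
      fix \<omega> assume "\<omega> \<in> space M" "\<tau> \<omega> < \<top>"
      then obtain n :: nat where "\<tau> \<omega> < of_nat n" using ennreal_Ex_less_of_nat by blast
      then show "\<omega> \<in> (\<Union>n::nat. {\<omega> \<in> space M. \<tau> \<omega> < ennreal n})"
        using \<open>\<omega> \<in> space M\<close> by (auto simp: ennreal_of_nat_eq_real_of_nat)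
    qed (auto intro: less_trans[OF _ ennreal_less_top])
    also have "\<dots> \<in> sets M"
    proof (intro sets.countable_UN subsetI)
      fix B assume "B \<in> range (\<lambda>n::nat. {\<omega> \<in> space M. \<tau> \<omega> < ennreal n})"
      then obtain n :: nat where "B = {\<omega> \<in> space M. \<tau> \<omega> < ennreal n}" by blast
      then show "B \<in> sets M" using assms[of "real n"] sets_past_subset[of "real n"] by auto
    qed
    finally show ?thesis using top by simp
  qed
qed

text \<open>\<open>out\<close> says that \<open>A\<close> fails before the horizon only once \<tau>
  is reached, \<open>inside\<close> that it holds at most up to \<tau>, so the minimum of \<tau> and
  T is rounded up by at most one mesh. Restricting \<open>out\<close> to j < n leaves room for
  events carrying a further constraint that is harmless up to the horizon.\<close>

lemma grid_time_bounds:
  fixes \<tau> :: ennreal and T :: real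
  defines "\<theta> \<equiv> enn2real (min \<tau> (ennreal T))"
  assumes A: "\<And>i. A (Suc i) \<subseteq> A i" and h: "0 < h" "h * real n = T"
    and out: "\<And>j. j < n \<Longrightarrow> \<omega> \<notin> A j \<Longrightarrow> \<tau> \<le> ennreal (h * real j)"
    and inside: "\<And>i. \<omega> \<in> A i \<Longrightarrow> ennreal (h * real i) \<le> \<tau>"
  shows "\<theta> \<le> grid_time h A n \<omega>" "grid_time h A n \<omega> \<le> \<theta> + h"
    "grid_time h A n \<omega> \<le> T" "0 \<le> grid_time h A n \<omega>"
proof -
  let ?t = "grid_time h A n \<omega>"
  have \<theta>: "ennreal \<theta> = min \<tau> (ennreal T)" "0 \<le> \<theta>"
    unfolding \<theta>_def by (auto simp: min_less_iff_disj)
  obtain j where j: "j \<le> n" "?t = h * real j" "\<forall>i<j. \<omega> \<in> A i" "j < n \<longrightarrow> \<omega> \<notin> A j"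
    using grid_time_cases[of A n h \<omega>] A by auto
  have "h * real j \<le> h * real n" using j(1) h(1) by (intro mult_left_mono of_nat_mono) auto
  then show tT: "?t \<le> T" using j(2) h(2) by linarith
  show t0: "0 \<le> ?t" using h j by simp
  have "ennreal \<theta> \<le> ennreal ?t"
  proof (cases "j < n")
    case True
    then show ?thesis unfolding \<theta> using j out[of j] by (simp add: min.coboundedI1)
  next
    case False
    then have "?t = T" using j h by simp
    then show ?thesis unfolding \<theta> by simp
  qed
  then show "\<theta> \<le> ?t" using t0 by (simp add: ennreal_le_iff)
  show "?t \<le> \<theta> + h"
  proof (cases j)
    case 0
    then show ?thesis using j h \<theta>(2) by simp
  next
    case (Suc i)
    then have "ennreal (h * real i) \<le> \<tau>" using j inside by auto
    moreover have "h * real i \<le> T" using tT j(2) Suc h(1) by (simp add: algebra_simps)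
    ultimately have "ennreal (h * real i) \<le> ennreal \<theta>" unfolding \<theta> by (simp add: ennreal_leI)
    then have "h * real i \<le> \<theta>" using \<theta>(2) by (simp add: ennreal_le_iff)
    then show ?thesis using j Suc by (simp add: algebra_simps)
  qed
qed

text \<open>The non-strict inequality makes \<open>A h i\<close> the complement of {\<tau> < h i},
  which for stopping times is an event of the past at h i. A value of \<tau> on the grid is rounded
  to the following grid point unless the horizon caps it.\<close>

lemma grid_time_stopping_bounds:
  fixes \<tau> :: "'a \<Rightarrow> ennreal" and T :: real
  defines "\<theta> \<equiv> \<lambda>\<omega>. enn2real (min (\<tau> \<omega>) (ennreal T))"
    and "A \<equiv> \<lambda>h i. {\<omega>\<in>space M. ennreal (h * real i) \<le> \<tau> \<omega>}"
  assumes \<omega>: "\<omega> \<in> space M" and h: "0 < h" "h * real n = T"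
  shows "\<theta> \<omega> \<le> grid_time h (A h) n \<omega>" "grid_time h (A h) n \<omega> \<le> \<theta> \<omega> + h"
    "grid_time h (A h) n \<omega> \<le> T" "0 \<le> grid_time h (A h) n \<omega>"
proof -
  have A_dec: "A h (Suc i) \<subseteq> A h i" for i
  proof -
    have "ennreal (h * real i) \<le> ennreal (h * real (Suc i))"
      using h(1) by (intro ennreal_leI mult_left_mono) auto
    then show ?thesis unfolding A_def using order_trans by blast
  qed
  have out: "\<tau> \<omega> \<le> ennreal (h * real j)" if "\<omega> \<notin> A h j" for j
    using that \<omega> by (auto simp: A_def not_le)
  have inside: "ennreal (h * real i) \<le> \<tau> \<omega>" if "\<omega> \<in> A h i" for i
    using that by (auto simp: A_def)
  show "\<theta> \<omega> \<le> grid_time h (A h) n \<omega>" "grid_time h (A h) n \<omega> \<le> \<theta> \<omega> + h"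
    "grid_time h (A h) n \<omega> \<le> T" "0 \<le> grid_time h (A h) n \<omega>"
    unfolding \<theta>_def by (rule grid_time_bounds[where A="A h", OF A_dec h out inside]; assumption)+
qed

text \<open>For \<tau> truncated at T and rounded up to the grid, the gain with the grid value is a
  submartingale, and the grid value is at most K. Dominated convergence in the mesh yields the bound
  for the truncated time, and truncation costs at most K exp(-lam T).\<close>

lemma limit_value_le_cost:
  assumes \<tau>: "\<And>t. 0 \<le> t \<Longrightarrow> {\<omega>\<in>space M. \<tau> \<omega> < ennreal t} \<in> sets (past t)"
  shows "limit_value p \<le> (\<integral>\<^sup>+\<omega>. cost p (path \<omega>) (\<tau> \<omega>) \<partial>M)"
proof -
  have [measurable]: "\<tau> \<in> borel_measurable M" by (rule measurable_time) fact
  define \<theta> where "\<theta> T \<omega> = enn2real (min (\<tau> \<omega>) (ennreal (real T)))" for T :: nat and \<omega>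
  have [measurable]: "\<theta> T \<in> borel_measurable M" for T unfolding \<theta>_def[abs_def] by measurable
  have \<theta>: "ennreal (\<theta> T \<omega>) = min (\<tau> \<omega>) (ennreal (real T))" "0 \<le> \<theta> T \<omega>" "\<theta> T \<omega> \<le> T" for T \<omega>
  proof -
    show e: "ennreal (\<theta> T \<omega>) = min (\<tau> \<omega>) (ennreal (real T))"
      unfolding \<theta>_def by (rule ennreal_enn2real) (simp add: min_less_iff_disj)
    show "0 \<le> \<theta> T \<omega>" by (simp add: \<theta>_def)
    have "ennreal (\<theta> T \<omega>) \<le> ennreal T" unfolding e by simp
    then show "\<theta> T \<omega> \<le> T" by (simp add: ennreal_le_iff)
  qed
  have step: "limit_value p \<le> (\<integral>\<^sup>+\<omega>. gain (\<lambda>_. ennreal K) p (path \<omega>) (\<theta> T \<omega>) \<partial>M)" for T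
  proof -
    define h where "h k = (1 / 2 ^ k :: real)" for k :: nat
    define A where "A k i = {\<omega>\<in>space M. ennreal (h k * real i) \<le> \<tau> \<omega>}" for k i
    define t where "t k = grid_time (h k) (A k) (T * 2 ^ k)" for k
    have h: "0 < h k" "0 \<le> h k" for k by (auto simp: h_def)
    have A: "A k i \<in> sets (past (h k * real i))" for k i
    proof -
      have "A k i = space (past (h k * real i)) - {\<omega>\<in>space M. \<tau> \<omega> < ennreal (h k * real i)}"
        by (auto simp: A_def not_le)
      then show ?thesis using \<tau>[of "h k * real i"] h[of k] by (metis mult_nonneg_nonneg of_nat_0_le_iff sets.compl_sets)
    qed
    have A_dec: "A k (Suc i) \<subseteq> A k i" for k i
    proof -
      have "ennreal (h k * real i) \<le> ennreal (h k * real (Suc i))"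
        using h(2)[of k] by (intro ennreal_leI mult_left_mono) auto
      then show ?thesis unfolding A_def using order_trans by blast
    qed
    have AM: "A k i \<in> sets M" for k i using A sets_past_subset by blast
    have [measurable]: "t k \<in> borel_measurable M" for k
      unfolding t_def using AM by (rule measurable_grid_time)
    have t: "\<theta> T \<omega> \<le> t k \<omega>" "t k \<omega> \<le> \<theta> T \<omega> + h k" "t k \<omega> \<le> T" "0 \<le> t k \<omega>" if \<omega>: "\<omega> \<in> space M" for k \<omega>
      unfolding t_def A_def \<theta>_def by (rule grid_time_stopping_bounds; use \<omega> h in \<open>simp add: h_def\<close>)+
    have le: "limit_value p \<le> (\<integral>\<^sup>+\<omega>. gain (\<lambda>_. ennreal K) p (path \<omega>) (t k \<omega>) \<partial>M)" for k
    proof -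
      have "limit_value p \<le> grid_value (h k) p" unfolding h_def by (rule limit_value_le_grid)
      also have "\<dots> \<le> (\<integral>\<^sup>+\<omega>. gain (grid_value (h k)) p (path \<omega>) (t k \<omega>) \<partial>M)"
        unfolding t_def by (rule submartingale_grid[OF A A_dec h(2) measurable_grid_value grid_value_le_Q[OF h(2)]])
      also have "\<dots> \<le> (\<integral>\<^sup>+\<omega>. gain (\<lambda>_. ennreal K) p (path \<omega>) (t k \<omega>) \<partial>M)"
        by (intro nn_integral_mono gain_mono grid_value_le)
      finally show ?thesis .
    qed
    have "(\<lambda>k. \<integral>\<^sup>+\<omega>. gain (\<lambda>_. ennreal K) p (path \<omega>) (t k \<omega>) \<partial>M) \<longlonglongrightarrow> (\<integral>\<^sup>+\<omega>. gain (\<lambda>_. ennreal K) p (path \<omega>) (\<theta> T \<omega>) \<partial>M)"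
    proof (rule nn_integral_dominated_convergence)
      have "(\<integral>\<^sup>+\<omega>. run p (path \<omega>) T + ennreal K \<partial>M) = (\<integral>\<^sup>+\<omega>. run p (path \<omega>) T \<partial>M) + (\<integral>\<^sup>+\<omega>. ennreal K \<partial>M)"
        by (rule nn_integral_add) measurable
      then show "(\<integral>\<^sup>+\<omega>. run p (path \<omega>) T + ennreal K \<partial>M) < \<infinity>"
        using expected_run_finite[of "real T" p] by (simp add: emeasure_space_1)
      show "AE \<omega> in M. gain (\<lambda>_. ennreal K) p (path \<omega>) (t k \<omega>) \<le> run p (path \<omega>) T + ennreal K" for k
      proof (rule AE_I2)
        fix \<omega> assume \<omega>: "\<omega> \<in> space M"
        have "ennreal (exp (- lam * t k \<omega>)) \<le> 1" using lam t(4)[OF \<omega>, of k] by simp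
        then have "ennreal (exp (- lam * t k \<omega>)) * ennreal K \<le> 1 * ennreal K" by (rule mult_right_mono) simp
        then show "gain (\<lambda>_. ennreal K) p (path \<omega>) (t k \<omega>) \<le> run p (path \<omega>) T + ennreal K"
          unfolding gain_def using t(3)[OF \<omega>] by (intro add_mono run_mono) auto
      qed
      show "AE \<omega> in M. (\<lambda>k. gain (\<lambda>_. ennreal K) p (path \<omega>) (t k \<omega>)) \<longlonglongrightarrow> gain (\<lambda>_. ennreal K) p (path \<omega>) (\<theta> T \<omega>)"
      proof (rule AE_I2)
        fix \<omega> assume \<omega>: "\<omega> \<in> space M"
        have h0: "h \<longlonglongrightarrow> 0" unfolding h_def[abs_def] using LIMSEQ_divide_realpow_zero[of 2 1] by simp
        have "(\<lambda>k. \<theta> T \<omega> + h k) \<longlonglongrightarrow> \<theta> T \<omega>" using tendsto_add[OF tendsto_const h0, of "\<theta> T \<omega>"] by simp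
        from tendsto_sandwich[OF _ _ tendsto_const this, of "\<lambda>k. t k \<omega>"] t(1,2)[OF \<omega>]
        have lim: "(\<lambda>k. t k \<omega>) \<longlonglongrightarrow> \<theta> T \<omega>" by simp
        show "(\<lambda>k. gain (\<lambda>_. ennreal K) p (path \<omega>) (t k \<omega>)) \<longlonglongrightarrow> gain (\<lambda>_. ennreal K) p (path \<omega>) (\<theta> T \<omega>)"
          unfolding gain_def
        proof (rule tendsto_add)
          show "(\<lambda>k. run p (path \<omega>) (t k \<omega>)) \<longlonglongrightarrow> run p (path \<omega>) (\<theta> T \<omega>)"
            using t[OF \<omega>] lim by (intro run_tendsto[where T=T] counting_path_path \<omega>) auto
          have "(\<lambda>k. ennreal (exp (- lam * t k \<omega>) * K)) \<longlonglongrightarrow> ennreal (exp (- lam * \<theta> T \<omega>) * K)"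
            by (intro tendsto_ennrealI tendsto_intros lim)
          then show "(\<lambda>k. ennreal (exp (- lam * t k \<omega>)) * ennreal K) \<longlonglongrightarrow> ennreal (exp (- lam * \<theta> T \<omega>)) * ennreal K"
            using K by (simp add: ennreal_mult)
        qed
      qed
    qed measurable
    then show ?thesis using le by (intro LIMSEQ_le_const) auto
  qed
  \<comment> \<open>If \<tau> \<le> T the two terminal payments agree. Otherwise the truncated time
    pays K exp(-lam T), which is charged to the error term.\<close>
  have pt: "gain (\<lambda>_. ennreal K) p w (\<theta> T \<omega>) \<le> cost p w (\<tau> \<omega>) + ennreal (K * exp (- lam * T))" for T \<omega> w
  proof -
    have r: "run p w (\<theta> T \<omega>) \<le> run_until p w (\<tau> \<omega>)"
      unfolding run_until_ennreal[OF \<theta>(2), symmetric] \<theta>(1) by (rule run_until_mono) simp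
    have "ennreal (exp (- lam * \<theta> T \<omega>)) * ennreal K \<le> ennreal K * discount (\<tau> \<omega>) + ennreal (K * exp (- lam * T))"
    proof (cases "\<tau> \<omega> \<le> ennreal T")
      case True
      then have e: "\<tau> \<omega> = ennreal (\<theta> T \<omega>)" using \<theta>(1)[of T \<omega>] by (simp add: min_absorb1)
      show ?thesis unfolding e discount_ennreal[OF \<theta>(2)] by (simp add: mult.commute)
    next
      case False
      then have "ennreal (\<theta> T \<omega>) = ennreal T" using \<theta>(1)[of T \<omega>] by (simp add: min_absorb2)
      then have "\<theta> T \<omega> = T" using \<theta>(2)[of T \<omega>] by (simp add: ennreal_inj)
      then show ?thesis using K by (simp add: ennreal_mult mult.commute)
    qed
    then show ?thesis unfolding gain_def cost_def using add_mono[OF r] by (simp add: add.assoc)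
  qed
  have "limit_value p \<le> (\<integral>\<^sup>+\<omega>. cost p (path \<omega>) (\<tau> \<omega>) \<partial>M) + ennreal (K * exp (- lam * T))" for T :: nat
  proof -
    note step[of T]
    also have "(\<integral>\<^sup>+\<omega>. gain (\<lambda>_. ennreal K) p (path \<omega>) (\<theta> T \<omega>) \<partial>M) \<le> (\<integral>\<^sup>+\<omega>. cost p (path \<omega>) (\<tau> \<omega>) + ennreal (K * exp (- lam * T)) \<partial>M)"
      by (intro nn_integral_mono pt)
    also have "\<dots> = (\<integral>\<^sup>+\<omega>. cost p (path \<omega>) (\<tau> \<omega>) \<partial>M) + (\<integral>\<^sup>+\<omega>. ennreal (K * exp (- lam * T)) \<partial>M)"
      by (rule nn_integral_add) measurable
    finally show ?thesis by (simp add: emeasure_space_1)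
  qed
  moreover have "(\<lambda>T. (\<integral>\<^sup>+\<omega>. cost p (path \<omega>) (\<tau> \<omega>) \<partial>M) + ennreal (K * exp (- lam * real T))) \<longlonglongrightarrow> (\<integral>\<^sup>+\<omega>. cost p (path \<omega>) (\<tau> \<omega>) \<partial>M) + ennreal 0"
    by (intro tendsto_add tendsto_const tendsto_ennrealI exp_decay_tendsto)
  ultimately show ?thesis by (intro LIMSEQ_le_const) auto
qed

end

section \<open>Optimality for positive tolerance\<close>

context stopping_problem
begin

lemma state_bound:
  assumes w: "counting_path w" and t: "0 \<le> t" "t \<le> T" and n: "w t \<le> B"
  shows "\<bar>fst (state p w t)\<bar> \<le> flow_bound (lam + 1) (1 - 1/\<mu>) a (fst p) T B"
    and "\<bar>snd (state p w t)\<bar> \<le> flow_bound (lam - 1) (1 + 1/\<mu>) b (snd p) T B"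
proof -
  have T: "0 \<le> T" using t by simp
  show "\<bar>fst (state p w t)\<bar> \<le> flow_bound (lam + 1) (1 - 1/\<mu>) a (fst p) T B"
    unfolding state_def fst_conv
    by (rule order_trans[OF flow_bound[OF w z_pos(1) t(1) order_refl] order_trans[OF flow_bound_mono_time[OF t] flow_bound_mono[OF n T]]])
  show "\<bar>snd (state p w t)\<bar> \<le> flow_bound (lam - 1) (1 + 1/\<mu>) b (snd p) T B"
    unfolding state_def snd_conv
    by (rule order_trans[OF flow_bound[OF w z_pos(2) t(1) order_refl] order_trans[OF flow_bound_mono_time[OF t] flow_bound_mono[OF n T]]])
qed

lemma state_tendsto_right:
  assumes w: "counting_path w" and t: "0 \<le> t" "\<And>k. t \<le> u k" "u \<longlonglongrightarrow> t"
  shows "(\<lambda>k::nat. state p w (u k)) \<longlonglongrightarrow> state p w t"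
  unfolding state_def by (intro tendsto_Pair continuous_flow_right w z_pos t)

text \<open>A Dini argument: positive \<epsilon> forces r < K on C, so the open sets where the grid
  value is below K cover C, and they increase with k.\<close>

lemma grid_value_less_on_compact:
  assumes "0 < \<epsilon>" and C: "compact C" "\<And>q. q \<in> C \<Longrightarrow> limit_value q + ennreal \<epsilon> \<le> ennreal K"
  shows "\<exists>k0. \<forall>k\<ge>k0. \<forall>q\<in>C. grid_value (1 / 2 ^ k) q < ennreal K"
proof -
  let ?O = "\<lambda>k. {q. grid_value (1 / 2 ^ k) q < ennreal K}"
  have op: "open (?O k)" for k
    by (intro open_Collect_less continuous_grid_value continuous_on_const)
  have cov: "C \<subseteq> (\<Union>k\<in>UNIV. ?O k)"
  proof
    fix q assume "q \<in> C"
    then have "limit_value q + ennreal \<epsilon> \<le> ennreal K" by (rule C)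
    moreover have "limit_value q < limit_value q + ennreal \<epsilon>"
    proof -
      have "limit_value q \<noteq> \<top>" using limit_value_le[of q] by (auto simp: top_unique)
      then show ?thesis using \<open>0 < \<epsilon>\<close> by (cases "limit_value q") (auto simp: ennreal_plus[symmetric] ennreal_less_iff simp del: ennreal_plus)
    qed
    ultimately have "limit_value q < ennreal K" by (rule less_le_trans[rotated])
    then show "q \<in> (\<Union>k\<in>UNIV. ?O k)" unfolding limit_value_def by (auto simp: INF_less_iff)
  qed
  obtain I where I: "finite I" "C \<subseteq> (\<Union>k\<in>I. ?O k)"
    using compactE_image[OF C(1) op cov] by metis
  show ?thesis
  proof (intro exI allI impI ballI)
    fix k q assume k: "k \<ge> Max (insert 0 I)" and q: "q \<in> C"
    then obtain i where i: "i \<in> I" "grid_value (1 / 2 ^ i) q < ennreal K" using I by auto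
    then have "i \<le> k" using k I by simp
    then have "grid_value (1 / 2 ^ k) q \<le> grid_value (1 / 2 ^ i) q"
      by (rule decseqD[OF grid_value_decseq])
    then show "grid_value (1 / 2 ^ k) q < ennreal K" using i(2) by (rule le_less_trans)
  qed
qed

text \<open>The event is the union of {U \<le> t - t/(n+1)} and so involves only times strictly
  before \<open>t\<close>; this absorbs the right-continuous enlargement at those times.\<close>

lemma sets_past_lessI:
  fixes U :: "'a \<Rightarrow> ennreal"
  assumes "0 \<le> t" and le: "\<And>s. 0 \<le> s \<Longrightarrow> s < t \<Longrightarrow> {\<omega>\<in>space M. U \<omega> \<le> ennreal s} \<in> sets (past t)"
  shows "{\<omega>\<in>space M. U \<omega> < ennreal t} \<in> sets (past t)"
proof (cases "t = 0")
  case False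
  then have t: "t > 0" using \<open>0 \<le> t\<close> by simp
  have "{\<omega>\<in>space M. U \<omega> < ennreal t} = (\<Union>n::nat. {\<omega>\<in>space M. U \<omega> \<le> ennreal (t - t / Suc n)})"
  proof safe
    fix \<omega> assume \<omega>: "\<omega> \<in> space M" and "U \<omega> < ennreal t"
    then obtain u where u: "U \<omega> = ennreal u" "0 \<le> u" "u < t"
      by (cases "U \<omega>") (auto simp: ennreal_less_iff)
    then obtain n :: nat where "1 / real (Suc n) < (t - u) / t"
      using nat_approx_posE[of "(t - u) / t"] t by auto
    then have "t / real (Suc n) < t - u" using t by (simp add: field_simps)
    then have "U \<omega> \<le> ennreal (t - t / Suc n)" unfolding u by (intro ennreal_leI) simp
    then show "\<omega> \<in> (\<Union>n::nat. {\<omega>\<in>space M. U \<omega> \<le> ennreal (t - t / Suc n)})" using \<omega> by blast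
  next
    fix \<omega> n assume le: "U \<omega> \<le> ennreal (t - t / real (Suc n))"
    have "ennreal (t - t / real (Suc n)) < ennreal t" using t by (intro ennreal_lessI) auto
    then show "U \<omega> < ennreal t" using le by (rule le_less_trans[rotated])
  qed
  also have "\<dots> \<in> sets (past t)"
  proof (intro sets.countable_UN subsetI)
    fix E assume "E \<in> range (\<lambda>n::nat. {\<omega>\<in>space M. U \<omega> \<le> ennreal (t - t / Suc n)})"
    then obtain n :: nat where E: "E = {\<omega>\<in>space M. U \<omega> \<le> ennreal (t - t / Suc n)}" by blast
    have "0 \<le> t - t / Suc n" "t - t / Suc n < t" using t by (auto simp: field_simps)
    then show "E \<in> sets (past t)" unfolding E by (rule le)
  qed
  finally show ?thesis .
qed (simp add: not_less)

lemma adapted_less: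
  assumes adapted: "\<And>t. 0 \<le> t \<Longrightarrow> {\<omega>\<in>space M. U \<omega> \<le> ennreal t} \<in> sets (past t)" and t: "0 \<le> t"
  shows "{\<omega>\<in>space M. U \<omega> < ennreal t} \<in> sets (past t)"
proof (rule sets_past_lessI[OF t])
  fix s assume "0 \<le> s" "s < t"
  then show "{\<omega>\<in>space M. U \<omega> \<le> ennreal s} \<in> sets (past t)"
    using adapted[of s] past_mono[of s t] by auto
qed

text \<open>Before U the state lies in the closed set r + \<epsilon> \<le> K, where fine grid values
  give supermartingales uniformly on bounded sets; at U the payment K is covered by r + \<epsilon>.
  An abstract U keeps the measurability of hitting times apart from this estimate.\<close>

lemma expected_cost_hitting_le:
  assumes "0 < \<epsilon>"
    and adapted: "\<And>t. 0 \<le> t \<Longrightarrow> {\<omega>\<in>space M. U \<omega> \<le> ennreal t} \<in> sets (past t)"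
    and before: "\<And>\<omega> t. \<omega> \<in> space M \<Longrightarrow> 0 \<le> t \<Longrightarrow> ennreal t < U \<omega> \<Longrightarrow>
        limit_value (state p (path \<omega>) t) + ennreal \<epsilon> \<le> ennreal K"
    and at: "\<And>\<omega> t. \<omega> \<in> space M \<Longrightarrow> 0 \<le> t \<Longrightarrow> U \<omega> = ennreal t \<Longrightarrow>
        ennreal K \<le> limit_value (state p (path \<omega>) t) + ennreal \<epsilon>"
  shows "(\<integral>\<^sup>+\<omega>. cost p (path \<omega>) (U \<omega>) \<partial>M) \<le> limit_value p + ennreal \<epsilon>"
proof -
  define v where "v q = limit_value q + ennreal \<epsilon>" for q
  have v [measurable]: "v \<in> borel_measurable borel" unfolding v_def[abs_def] by measurable
  have vc: "continuous_on UNIV v"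
    unfolding v_def[abs_def] by (intro continuous_on_add continuous_limit_value continuous_on_const)
  \<comment> \<open>The cost truncated at T, with the payment K only if U occurs before T: at the
    horizon r + \<epsilon> may be smaller than K.\<close>
  define H where "H T \<omega> = run_until p (path \<omega>) (min (U \<omega>) (ennreal (real T))) +
      (if U \<omega> < ennreal (real T) then ennreal K * discount (U \<omega>) else 0)" for T :: nat and \<omega>
  note U_less = adapted_less[of U, OF adapted]
  have [measurable]: "U \<in> borel_measurable M" by (rule measurable_time[OF U_less])
  have [measurable]: "H T \<in> borel_measurable M" for T unfolding H_def[abs_def] by measurable
  have bounded_run: "(\<integral>\<^sup>+\<omega>. indicator {\<omega>\<in>space M. N (real T) \<omega> \<le> B} \<omega> * H T \<omega> \<partial>M) \<le> limit_value p + ennreal \<epsilon>" for T B :: nat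
  proof -
    let ?E = "{\<omega>\<in>space M. N (real T) \<omega> \<le> B}"
    have [measurable]: "N (real T) \<in> measurable M (count_space UNIV)" by (rule measurable_N) simp
    define b0 where "b0 = flow_bound (lam + 1) (1 - 1/\<mu>) a (fst p) T B"
    define b1 where "b1 = flow_bound (lam - 1) (1 + 1/\<mu>) b (snd p) T B"
    define C where "C = cbox (-b0, -b1) (b0, b1) \<inter> {q. v q \<le> ennreal K}"
    have "compact C" unfolding C_def
      by (intro compact_Int_closed compact_cbox closed_Collect_le vc continuous_on_const)
    then obtain k0 where k0: "\<And>k q. k \<ge> k0 \<Longrightarrow> q \<in> C \<Longrightarrow> grid_value (1 / 2 ^ k) q < ennreal K"
    proof -
      have "limit_value q + ennreal \<epsilon> \<le> ennreal K" if "q \<in> C" for q using that by (simp add: C_def v_def)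
      from grid_value_less_on_compact[OF \<open>0 < \<epsilon>\<close> \<open>compact C\<close> this] show ?thesis using that by blast
    qed
    \<comment> \<open>The index starts at k0, from which on all grid values are below K on
      C.\<close>
    define h where "h k = (1 / 2 ^ (k0 + k) :: real)" for k :: nat
    \<comment> \<open>Giving up once the count exceeds B confines the states at which the
      supermartingale inequality is invoked to the box of half-widths b0 and b1.\<close>
    define A where "A k i = {\<omega>\<in>space M. ennreal (h k * real i) < U \<omega> \<and> N (h k * real i) \<omega> \<le> B}" for k i
    define n where "n k = T * 2 ^ (k0 + k)" for k
    define t where "t k = grid_time (h k) (A k) (n k)" for k
    have h: "0 < h k" "0 \<le> h k" for k by (auto simp: h_def)
    have hi: "0 \<le> h k * real i" for k i using h[of k] by simp
    have hn: "h k * real (n k) = T" for k by (simp add: h_def n_def)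
    have hi_le: "h k * real i \<le> T" if "i \<le> n k" for i k
    proof -
      have "h k * real i \<le> h k * real (n k)" using that h(2) by (intro mult_left_mono of_nat_mono)
      then show ?thesis by (simp only: hn)
    qed
    have A: "A k i \<in> sets (past (h k * real i))" for k i
    proof -
      let ?t = "h k * real i"
      have "A k i = (space (past ?t) - {\<omega>\<in>space M. U \<omega> \<le> ennreal ?t}) \<inter> (N ?t -` {..B} \<inter> space (past ?t))"
        by (auto simp: A_def not_le)
      moreover have "N ?t -` {..B} \<inter> space (past ?t) \<in> sets (past ?t)"
        by (rule measurable_sets[OF measurable_N_past[OF hi order_refl]]) simp
      ultimately show ?thesis using sets.Int[OF sets.compl_sets[OF adapted[OF hi]]] by simp
    qed
    have A_dec: "A k (Suc i) \<subseteq> A k i" for k i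
    proof
      fix \<omega> assume \<omega>: "\<omega> \<in> A k (Suc i)"
      have le: "h k * real i \<le> h k * real (Suc i)" using h(2)[of k] by (intro mult_left_mono) auto
      have "N (h k * real i) \<omega> \<le> N (h k * real (Suc i)) \<omega>" using \<omega> le hi by (intro N_mono) (auto simp: A_def)
      moreover have "ennreal (h k * real i) \<le> ennreal (h k * real (Suc i))" using le by (rule ennreal_leI)
      ultimately show "\<omega> \<in> A k i" using \<omega> unfolding A_def by (auto simp del: of_nat_Suc)
    qed
    have AM: "A k i \<in> sets M" for k i using A sets_past_subset by blast
    have [measurable]: "t k \<in> borel_measurable M" for k
      unfolding t_def using AM by (rule measurable_grid_time)
    have super: "(\<integral>\<^sup>+\<omega>. gain (grid_value (h k)) p (path \<omega>) (t k \<omega>) \<partial>M) \<le> grid_value (h k) p" for k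
      unfolding t_def
    proof (rule supermartingale_grid[OF A A_dec h(2) measurable_grid_value])
      fix i \<omega> assume i: "i < n k" "\<omega> \<in> A k i" "\<omega> \<in> space M"
      let ?q = "state p (path \<omega>) (h k * real i)"
      have "path \<omega> (h k * real i) \<le> B" using i(2) hi[of k i] by (simp add: A_def path_simps)
      note sb = state_bound[OF counting_path_path[OF i(3)] hi hi_le[OF less_imp_le[OF i(1)]] this, of p]
      have "?q \<in> cbox (-b0, -b1) (b0, b1)"
        using sb unfolding b0_def[symmetric] b1_def[symmetric]
        by (cases ?q) (auto simp: cbox_Pair_eq abs_le_iff)
      moreover have "v ?q \<le> ennreal K" unfolding v_def using i hi by (intro before) (auto simp: A_def)
      ultimately have "?q \<in> C" by (simp add: C_def)
      then have "grid_value (h k) ?q < ennreal K" unfolding h_def using k0[of "k0 + k"] by simp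
      then show "Q (h k) (grid_value (h k)) ?q \<le> grid_value (h k) ?q" by (rule Q_le_grid_value[OF h(2)])
    qed
    have le: "(\<integral>\<^sup>+\<omega>. indicator ?E \<omega> * gain v p (path \<omega>) (t k \<omega>) \<partial>M) \<le> grid_value (h k) p + ennreal \<epsilon>" for k
    proof -
      have "(\<integral>\<^sup>+\<omega>. indicator ?E \<omega> * gain v p (path \<omega>) (t k \<omega>) \<partial>M) \<le> (\<integral>\<^sup>+\<omega>. gain (grid_value (h k)) p (path \<omega>) (t k \<omega>) + ennreal \<epsilon> \<partial>M)"
      proof (rule nn_integral_mono)
        fix \<omega> assume \<omega>: "\<omega> \<in> space M"
        have "0 \<le> t k \<omega>" unfolding t_def grid_time_def using h(2)[of k] by (intro mult_nonneg_nonneg sum_nonneg) auto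
        then have e1: "ennreal (exp (- lam * t k \<omega>)) \<le> 1" using lam by simp
        have "gain v p (path \<omega>) (t k \<omega>) = gain limit_value p (path \<omega>) (t k \<omega>) + ennreal (exp (- lam * t k \<omega>)) * ennreal \<epsilon>"
          by (simp add: gain_def v_def distrib_left add.assoc)
        also have "\<dots> \<le> gain (grid_value (h k)) p (path \<omega>) (t k \<omega>) + 1 * ennreal \<epsilon>"
          using e1 by (intro add_mono gain_mono mult_right_mono) (auto simp: h_def limit_value_le_grid)
        finally show "indicator ?E \<omega> * gain v p (path \<omega>) (t k \<omega>) \<le> gain (grid_value (h k)) p (path \<omega>) (t k \<omega>) + ennreal \<epsilon>"
          by (auto simp: indicator_def)
      qed
      also have "\<dots> = (\<integral>\<^sup>+\<omega>. gain (grid_value (h k)) p (path \<omega>) (t k \<omega>) \<partial>M) + (\<integral>\<^sup>+\<omega>. ennreal \<epsilon> \<partial>M)"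
        by (rule nn_integral_add) measurable
      also have "\<dots> \<le> grid_value (h k) p + ennreal \<epsilon>"
        using super[of k] by (simp add: emeasure_space_1)
      finally show ?thesis .
    qed
    show ?thesis
    proof (rule nn_integral_le_Fatou[OF _ le])
      show "(\<lambda>\<omega>. indicator ?E \<omega> * gain v p (path \<omega>) (t k \<omega>)) \<in> borel_measurable M" for k by measurable
      show "(\<lambda>k. grid_value (h k) p + ennreal \<epsilon>) \<longlonglongrightarrow> limit_value p + ennreal \<epsilon>"
      proof (intro tendsto_add tendsto_const)
        show "(\<lambda>k. grid_value (h k) p) \<longlonglongrightarrow> limit_value p"
          using LIMSEQ_ignore_initial_segment[OF grid_value_tendsto[of p], of k0] by (simp add: h_def add.commute)
      qed
      fix \<omega> assume \<omega>: "\<omega> \<in> space M"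
      show "indicator ?E \<omega> * H T \<omega> \<le> liminf (\<lambda>k. indicator ?E \<omega> * gain v p (path \<omega>) (t k \<omega>))"
      proof (cases "\<omega> \<in> ?E")
        case True
        define \<theta> where "\<theta> = enn2real (min (U \<omega>) (ennreal (real T)))"
        have \<theta>: "ennreal \<theta> = min (U \<omega>) (ennreal (real T))" "0 \<le> \<theta>"
          unfolding \<theta>_def by (auto simp: min_less_iff_disj)
        \<comment> \<open>On \<open>?E\<close> the count stays at most B up to T, so before the
          horizon \<open>A\<close> fails only because of U.\<close>
        have t: "\<theta> \<le> t k \<omega>" "t k \<omega> \<le> \<theta> + h k" "t k \<omega> \<le> T" "0 \<le> t k \<omega>" for k
        proof -
          have out: "U \<omega> \<le> ennreal (h k * real j)" if "j < n k" "\<omega> \<notin> A k j" for j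
          proof -
            have "N (h k * real j) \<omega> \<le> N T \<omega>" using hi hi_le[of j k] that by (intro N_mono \<omega>) auto
            then show ?thesis using that \<omega> \<open>\<omega> \<in> ?E\<close> by (auto simp: A_def not_less)
          qed
          have inside: "ennreal (h k * real i) \<le> U \<omega>" if "\<omega> \<in> A k i" for i
            using that by (auto simp: A_def)
          show "\<theta> \<le> t k \<omega>" "t k \<omega> \<le> \<theta> + h k" "t k \<omega> \<le> T" "0 \<le> t k \<omega>"
            unfolding \<theta>_def t_def by (rule grid_time_bounds[where A="A k" and h="h k" and n="n k", OF A_dec h(1) hn out inside]; assumption)+
        qed
        have h0: "h \<longlonglongrightarrow> 0"
          unfolding h_def[abs_def]
          using LIMSEQ_ignore_initial_segment[OF LIMSEQ_divide_realpow_zero[of 2 1], of k0] by (simp add: add.commute)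
        have "(\<lambda>k. \<theta> + h k) \<longlonglongrightarrow> \<theta>" using tendsto_add[OF tendsto_const h0, of \<theta>] by simp
        from tendsto_sandwich[OF _ _ tendsto_const this, of "\<lambda>k. t k \<omega>"] t
        have lim: "(\<lambda>k. t k \<omega>) \<longlonglongrightarrow> \<theta>" by simp
        have r: "(\<lambda>k. run p (path \<omega>) (t k \<omega>)) \<longlonglongrightarrow> run p (path \<omega>) \<theta>"
          using t lim by (intro run_tendsto[where T=T] counting_path_path \<omega>) auto
        \<comment> \<open>Rounding up means that the times approach \<theta> from the right, where
          the state is continuous even if N jumps at \<theta>.\<close>
        have "(\<lambda>k. state p (path \<omega>) (t k \<omega>)) \<longlonglongrightarrow> state p (path \<omega>) \<theta>"
          using t \<theta>(2) lim by (intro state_tendsto_right counting_path_path \<omega>) auto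
        then have vl: "(\<lambda>k. v (state p (path \<omega>) (t k \<omega>))) \<longlonglongrightarrow> v (state p (path \<omega>) \<theta>)"
          by (rule continuous_on_tendsto_compose[OF vc]) auto
        have vfin: "v q < \<top>" for q
          using limit_value_le[of q] by (auto simp: v_def less_top[symmetric] top_unique)
        have g: "(\<lambda>k. gain v p (path \<omega>) (t k \<omega>)) \<longlonglongrightarrow> gain v p (path \<omega>) \<theta>"
          unfolding gain_def
        proof (intro tendsto_add r)
          have vr: "v q = ennreal (enn2real (v q))" for q using vfin[of q] by simp
          have ev: "(\<lambda>k. enn2real (v (state p (path \<omega>) (t k \<omega>)))) \<longlonglongrightarrow> enn2real (v (state p (path \<omega>) \<theta>))"
            by (rule tendsto_enn2real) (simp_all add: vl vr[symmetric])
          then have "(\<lambda>k. ennreal (exp (- lam * t k \<omega>) * enn2real (v (state p (path \<omega>) (t k \<omega>))))) \<longlonglongrightarrow>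
             ennreal (exp (- lam * \<theta>) * enn2real (v (state p (path \<omega>) \<theta>)))"
            by (intro tendsto_ennrealI tendsto_mult tendsto_exp tendsto_const lim ev)
          then show "(\<lambda>k. ennreal (exp (- lam * t k \<omega>)) * v (state p (path \<omega>) (t k \<omega>))) \<longlonglongrightarrow>
             ennreal (exp (- lam * \<theta>)) * v (state p (path \<omega>) \<theta>)"
            using vfin by (simp add: ennreal_mult)
        qed
        have "H T \<omega> \<le> gain v p (path \<omega>) \<theta>"
        proof -
          have 1: "run_until p (path \<omega>) (min (U \<omega>) (ennreal (real T))) = run p (path \<omega>) \<theta>"
            unfolding \<theta>(1)[symmetric] by (rule run_until_ennreal[OF \<theta>(2)])
          have 2: "(if U \<omega> < ennreal (real T) then ennreal K * discount (U \<omega>) else 0) \<le> ennreal (exp (- lam * \<theta>)) * v (state p (path \<omega>) \<theta>)"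
          proof (cases "U \<omega> < ennreal (real T)")
            case True
            then have U: "U \<omega> = ennreal \<theta>" using \<theta>(1) by (simp add: min_absorb1 less_imp_le)
            have "ennreal K \<le> v (state p (path \<omega>) \<theta>)" unfolding v_def by (rule at[OF \<omega> \<theta>(2) U])
            then have "ennreal (exp (- lam * \<theta>)) * ennreal K \<le> ennreal (exp (- lam * \<theta>)) * v (state p (path \<omega>) \<theta>)"
              by (rule mult_left_mono) simp
            then show ?thesis using True unfolding U discount_ennreal[OF \<theta>(2)]
              by (simp only: if_True mult.commute)
          qed simp
          show ?thesis unfolding H_def gain_def 1 by (intro add_left_mono 2)
        qed
        then show ?thesis using True lim_imp_Liminf[OF _ g] by simp
      qed simp
    qed
  qed
  \<comment> \<open>Every path has a finite count at T, so the indicator is eventually 1 as B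
    grows.\<close>
  have bounded_T: "(\<integral>\<^sup>+\<omega>. H T \<omega> \<partial>M) \<le> limit_value p + ennreal \<epsilon>" for T
  proof (rule nn_integral_le_Fatou[OF _ bounded_run tendsto_const])
    have [measurable]: "N (real T) \<in> measurable M (count_space UNIV)" by (rule measurable_N) simp
    show "(\<lambda>\<omega>. indicator {\<omega> \<in> space M. N (real T) \<omega> \<le> B} \<omega> * H T \<omega>) \<in> borel_measurable M" for B by measurable
    fix \<omega> assume \<omega>: "\<omega> \<in> space M"
    have "eventually (\<lambda>B. H T \<omega> \<le> indicator {\<omega> \<in> space M. N (real T) \<omega> \<le> B} \<omega> * H T \<omega>) sequentially"
      using eventually_ge_at_top[of "N (real T) \<omega>"] by eventually_elim (simp add: \<omega>)
    then show "H T \<omega> \<le> liminf (\<lambda>B. indicator {\<omega> \<in> space M. N (real T) \<omega> \<le> B} \<omega> * H T \<omega>)"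
      by (rule Liminf_bounded)
  qed
  \<comment> \<open>Letting T grow: for finite U the truncation eventually has no effect; for
    infinite U there is no terminal payment and only the running part has to be recovered.\<close>
  show ?thesis
  proof (rule nn_integral_le_Fatou[OF _ bounded_T tendsto_const])
    show "H T \<in> borel_measurable M" for T by measurable
    fix \<omega> assume \<omega>: "\<omega> \<in> space M"
    show "cost p (path \<omega>) (U \<omega>) \<le> liminf (\<lambda>T. H T \<omega>)"
    proof (cases "U \<omega> = \<top>")
      case True
      let ?F = "\<lambda>s. ennreal (exp (- lam * s)) * total_mass (state p (path \<omega>) s)"
      have st [measurable]: "(\<lambda>s. state p (path \<omega>) s) \<in> borel_measurable borel"
        by (rule measurable_state_path) (use \<omega> in auto)
      have "(\<integral>\<^sup>+s. indicator {s. 0 \<le> s \<and> ennreal s \<le> \<top>} s * ?F s \<partial>lborel) \<le> liminf (\<lambda>T. run p (path \<omega>) (real T))"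
      proof (rule order_trans[OF _ nn_integral_liminf[of "\<lambda>T s. indicator {0..real T} s * ?F s" lborel, folded run_def]])
        show "(\<integral>\<^sup>+s. indicator {s. 0 \<le> s \<and> ennreal s \<le> \<top>} s * ?F s \<partial>lborel) \<le> (\<integral>\<^sup>+s. liminf (\<lambda>T. indicator {0..real T} s * ?F s) \<partial>lborel)"
        proof (rule nn_integral_mono, rule Liminf_bounded)
          fix s :: real
          show "eventually (\<lambda>T::nat. indicator {s. 0 \<le> s \<and> ennreal s \<le> \<top>} s * ?F s \<le> indicator {0..real T} s * ?F s) sequentially"
            using eventually_ge_at_top[of "nat \<lceil>s\<rceil>"] by eventually_elim (auto simp: indicator_def)
        qed
      qed measurable
      moreover have "H T \<omega> = run p (path \<omega>) (real T)" for T
        using True run_until_ennreal[of "real T" p "path \<omega>"] by (simp add: H_def)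
      ultimately show ?thesis using True by (simp add: cost_def discount_def run_until_def)
    next
      case False
      then obtain n :: nat where n: "U \<omega> < of_nat n" using ennreal_Ex_less_of_nat[of "U \<omega>"] by (auto simp: less_top)
      have "eventually (\<lambda>T. cost p (path \<omega>) (U \<omega>) \<le> H T \<omega>) sequentially"
        using eventually_ge_at_top[of n]
      proof eventually_elim
        case (elim T)
        have "of_nat n \<le> ennreal (real T)" using elim by (simp add: ennreal_of_nat_eq_real_of_nat)
        then have "U \<omega> < ennreal (real T)" using n by (rule less_le_trans[rotated])
        then show ?case by (simp add: H_def cost_def min_absorb1 less_imp_le)
      qed
      then show ?thesis by (rule Liminf_bounded)
    qed
  qed
qed

end

section \<open>Hitting times and tolerance zero\<close>

context stopping_problem
begin

text \<open>With V = r - K the condition V \<ge> -\<epsilon> reads K \<le> r + \<epsilon>. Stated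
  through r, the hitting time can be studied before V is known, and it then serves to compute
  V.\<close>

definition stop_times :: "real \<Rightarrow> real \<times> real \<Rightarrow> 'a \<Rightarrow> real set" where
  "stop_times \<epsilon> p \<omega> = {t. 0 \<le> t \<and> ennreal K \<le> limit_value (state p (path \<omega>) t) + ennreal \<epsilon>}"

definition hit :: "real \<Rightarrow> real \<times> real \<Rightarrow> 'a \<Rightarrow> ennreal" where
  "hit \<epsilon> p \<omega> = Inf (ennreal ` stop_times \<epsilon> p \<omega>)"

lemma continuous_value_add: "continuous_on UNIV (\<lambda>q. limit_value q + ennreal d)"
  by (intro continuous_on_add continuous_limit_value continuous_on_const)

lemma value_add_tendsto:
  assumes "(\<lambda>k. state p w (u k)) \<longlonglongrightarrow> q"
  shows "(\<lambda>k::nat. limit_value (state p w (u k)) + ennreal d) \<longlonglongrightarrow> limit_value q + ennreal d"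
  by (rule continuous_on_tendsto_compose[OF continuous_value_add assms]) auto

text \<open>Elements of the set approach the infimum from the right, where the state is right
  continuous; r is continuous, so the closed condition passes to the limit.\<close>

lemma hit_attained:
  assumes \<omega>: "\<omega> \<in> space M" and t: "0 \<le> t" "hit \<epsilon> p \<omega> = ennreal t"
  shows "t \<in> stop_times \<epsilon> p \<omega>"
proof -
  have "\<exists>u\<in>stop_times \<epsilon> p \<omega>. t \<le> u \<and> u \<le> t + 1 / real (Suc k)" for k
  proof -
    have "hit \<epsilon> p \<omega> < ennreal (t + 1 / real (Suc k))" unfolding t(2) using add_nonneg_pos[OF t(1), of "1 / real (Suc k)"]
      by (intro ennreal_lessI) auto
    then obtain u where u: "u \<in> stop_times \<epsilon> p \<omega>" "ennreal u < ennreal (t + 1 / real (Suc k))"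
      unfolding hit_def by (auto simp: Inf_less_iff)
    have "hit \<epsilon> p \<omega> \<le> ennreal u" unfolding hit_def by (rule Inf_lower) (use u in auto)
    moreover have "0 \<le> u" using u by (auto simp: stop_times_def)
    ultimately have "t \<le> u" unfolding t by (simp add: ennreal_le_iff)
    moreover have "u < t + 1 / real (Suc k)" using u(2) \<open>0 \<le> u\<close> by (simp add: ennreal_less_iff)
    ultimately show ?thesis using u(1) by (intro bexI[of _ u]) auto
  qed
  then obtain u where u: "\<And>k. u k \<in> stop_times \<epsilon> p \<omega>" "\<And>k. t \<le> u k" "\<And>k. u k \<le> t + 1 / real (Suc k)" by metis
  have "(\<lambda>k. t + 1 / real (Suc k)) \<longlonglongrightarrow> t + 0"
    by (intro tendsto_add tendsto_const LIMSEQ_Suc lim_1_over_n)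
  then have r: "(\<lambda>k. t + 1 / real (Suc k)) \<longlonglongrightarrow> t" by simp
  from tendsto_sandwich[OF _ _ tendsto_const r, of u] u(2,3) have lim: "u \<longlonglongrightarrow> t" by simp
  have "(\<lambda>k. limit_value (state p (path \<omega>) (u k)) + ennreal \<epsilon>) \<longlonglongrightarrow> limit_value (state p (path \<omega>) t) + ennreal \<epsilon>"
    by (intro value_add_tendsto state_tendsto_right counting_path_path \<omega> t u lim)
  then have "ennreal K \<le> limit_value (state p (path \<omega>) t) + ennreal \<epsilon>"
    by (rule LIMSEQ_le_const) (use u(1) in \<open>auto simp: stop_times_def\<close>)
  then show ?thesis using t by (simp add: stop_times_def)
qed

lemma hit_le_iff:
  assumes \<omega>: "\<omega> \<in> space M" and t: "0 \<le> t"
  shows "hit \<epsilon> p \<omega> \<le> ennreal t \<longleftrightarrow> (\<exists>u\<in>stop_times \<epsilon> p \<omega>. u \<le> t)"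
proof
  assume le: "hit \<epsilon> p \<omega> \<le> ennreal t"
  then obtain u where u: "hit \<epsilon> p \<omega> = ennreal u" "0 \<le> u" by (cases "hit \<epsilon> p \<omega>") (auto simp: top_unique)
  then show "\<exists>u\<in>stop_times \<epsilon> p \<omega>. u \<le> t"
    using hit_attained[OF \<omega> u(2,1)] le t by (auto simp: ennreal_le_iff)
next
  assume "\<exists>u\<in>stop_times \<epsilon> p \<omega>. u \<le> t"
  then show "hit \<epsilon> p \<omega> \<le> ennreal t"
    unfolding hit_def by (auto intro!: Inf_lower2 ennreal_leI)
qed

lemma sigma_N_le: "\<omega> \<in> space M \<Longrightarrow> 0 \<le> t \<Longrightarrow> \<sigma> (N t \<omega>) \<omega> \<le> t"
  using N_eq_iff[of \<omega> t "N t \<omega>"] by auto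

lemma N_between: "\<omega> \<in> space M \<Longrightarrow> 0 \<le> t \<Longrightarrow> \<sigma> (N t \<omega>) \<omega> \<le> s \<Longrightarrow> s \<le> t \<Longrightarrow> N s \<omega> = N t \<omega>"
  using N_eq_iff[of \<omega> t "N t \<omega>"] N_eq_iff[of \<omega> s "N t \<omega>"] sigma_nonneg[of \<omega> "N t \<omega>"] by auto

text \<open>The count is constant from the last jump up to and including q. The resulting interval
  is compact, which the search for cluster points requires.\<close>

lemma continuous_state_between_jumps:
  assumes \<omega>: "\<omega> \<in> space M" and q: "0 \<le> q"
  shows "continuous_on {\<sigma> (N q \<omega>) \<omega>..q} (state p (path \<omega>))"
proof -
  let ?S = "{\<sigma> (N q \<omega>) \<omega>..q}"
  have S: "?S \<subseteq> {0..q}" using sigma_nonneg[OF \<omega>] by auto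
  have c: "path \<omega> s = N q \<omega>" if "s \<in> ?S" for s
    using that S N_between[OF \<omega> q, of s] by (auto simp: path_simps)
  show ?thesis unfolding state_def
    by (intro continuous_on_Pair continuous_on_flow[OF counting_path_path[OF \<omega>] _ S c] z_pos)
qed

text \<open>Adaptedness requires countably many conditions. A hit at u is seen, with slack 1/(k+1),
  at rational times just after u. Conversely, equality of counts keeps all approximate hits between
  one jump and q, a compact interval on which the state is continuous, so a cluster point is a
  genuine hit.\<close>

lemma hit_le_iff_countable:
  assumes \<omega>: "\<omega> \<in> space M" and t: "0 \<le> t"
  defines "D \<equiv> \<lambda>s. insert s (\<rat> \<inter> {0..s})"
  shows "hit \<epsilon> p \<omega> \<le> ennreal t \<longleftrightarrow> (\<exists>q\<in>D t. \<forall>k::nat. \<exists>u\<in>D q. N u \<omega> = N q \<omega> \<and>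
     ennreal K < limit_value (state p (path \<omega>) u) + ennreal \<epsilon> + ennreal (1 / Suc k))"
proof
  assume "hit \<epsilon> p \<omega> \<le> ennreal t"
  then obtain u where u: "0 \<le> u" "u \<le> t" "ennreal K \<le> limit_value (state p (path \<omega>) u) + ennreal \<epsilon>"
    unfolding hit_le_iff[OF \<omega> t] by (auto simp: stop_times_def)
  \<comment> \<open>q must lie in the same jump interval as u, at or after it. For u = t this leaves
    only t itself, which is why \<open>D t\<close> contains its end point.\<close>
  have "\<exists>q\<in>D t. u \<le> q \<and> N q \<omega> = N u \<omega> \<and> (q \<noteq> u \<longrightarrow> u < q)"
  proof (cases "u = t")
    case False
    obtain d where d: "d > 0" "\<And>s. u \<le> s \<Longrightarrow> s < u + d \<Longrightarrow> path \<omega> s = path \<omega> u"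
      using counting_pathD(2)[OF counting_path_path[OF \<omega>], of u] by blast
    obtain q where q: "q \<in> \<rat>" "u < q" "q < min t (u + d)"
      using Rats_dense_in_real[of u "min t (u + d)"] False u d by auto
    have "path \<omega> q = path \<omega> u" by (rule d(2)) (use q in auto)
    then show ?thesis using q u by (intro bexI[of _ q]) (auto simp: D_def path_simps)
  qed (use u in \<open>auto simp: D_def\<close>)
  then obtain q where q: "q \<in> D t" "u \<le> q" "N q \<omega> = N u \<omega>" by blast
  show "\<exists>q\<in>D t. \<forall>k::nat. \<exists>u\<in>D q. N u \<omega> = N q \<omega> \<and>
     ennreal K < limit_value (state p (path \<omega>) u) + ennreal \<epsilon> + ennreal (1 / Suc k)"
  proof (rule bexI[of _ q], rule allI)
    show "q \<in> D t" by (rule q)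
    fix k :: nat
    let ?v = "\<lambda>u. limit_value (state p (path \<omega>) u) + ennreal \<epsilon> + ennreal (1 / Suc k)"
    have "ennreal K < ennreal K + ennreal (1 / Suc k)"
      using K by (simp add: ennreal_plus[symmetric] ennreal_less_iff del: ennreal_plus)
    also have "\<dots> \<le> ?v u" by (intro add_right_mono u)
    finally have less: "ennreal K < ?v u" .
    show "\<exists>u\<in>D q. N u \<omega> = N q \<omega> \<and> ennreal K < ?v u"
    proof (cases "u = q")
      case True
      then show ?thesis using less by (auto simp: D_def)
    next
      case False
      then have uq: "u < q" using q by simp
      have "\<exists>r\<in>\<rat>. u < r \<and> r < min q (u + 1 / real (Suc j))" for j
        using Rats_dense_in_real[of u "min q (u + 1 / real (Suc j))"] uq by auto
      then obtain r where r: "\<And>j. r j \<in> \<rat>" "\<And>j. u < r j" "\<And>j. r j < min q (u + 1 / real (Suc j))" by metis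
      have "(\<lambda>k. u + 1 / real (Suc k)) \<longlonglongrightarrow> u + 0"
        by (intro tendsto_add tendsto_const LIMSEQ_Suc lim_1_over_n)
      then have lim1: "(\<lambda>k. u + 1 / real (Suc k)) \<longlonglongrightarrow> u" by simp
      have "r j \<le> u + 1 / real (Suc j)" for j using r(3)[of j] by simp
      with tendsto_sandwich[OF _ _ tendsto_const lim1, of r] r(2) have lim: "r \<longlonglongrightarrow> u"
        by (simp add: less_imp_le)
      have "(\<lambda>j. ?v (r j)) \<longlonglongrightarrow> ?v u"
        by (intro tendsto_add[OF value_add_tendsto tendsto_const] state_tendsto_right counting_path_path \<omega> u lim less_imp_le[OF r(2)])
      then have "eventually (\<lambda>j. ennreal K < ?v (r j)) sequentially" using less by (rule order_tendstoD)
      then obtain j where j: "ennreal K < ?v (r j)" by (auto simp: eventually_sequentially)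
      have "N u \<omega> \<le> N (r j) \<omega>" "N (r j) \<omega> \<le> N q \<omega>" using r(2,3)[of j] u by (auto intro!: N_mono \<omega>)
      then have "N (r j) \<omega> = N q \<omega>" using q by simp
      moreover have "r j \<in> D q" using r(1-3)[of j] u by (auto simp: D_def)
      ultimately show ?thesis using j by blast
    qed
  qed
next
  assume "\<exists>q\<in>D t. \<forall>k::nat. \<exists>u\<in>D q. N u \<omega> = N q \<omega> \<and>
     ennreal K < limit_value (state p (path \<omega>) u) + ennreal \<epsilon> + ennreal (1 / Suc k)"
  then obtain q u where q: "q \<in> D t" and u: "\<And>k::nat. u k \<in> D q" "\<And>k. N (u k) \<omega> = N q \<omega>"
    "\<And>k. ennreal K < limit_value (state p (path \<omega>) (u k)) + ennreal \<epsilon> + ennreal (1 / Suc k)" by metis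
  have q0: "0 \<le> q" "q \<le> t" using q t by (auto simp: D_def)
  let ?S = "{\<sigma> (N q \<omega>) \<omega>..q}"
  have u0: "0 \<le> u k" "u k \<le> q" for k using u(1)[of k] q0 by (auto simp: D_def)
  have "u k \<in> ?S" for k using sigma_N_le[OF \<omega> u0(1), of k] u0(2)[of k] u(2)[of k] by simp
  then obtain l r where lr: "l \<in> ?S" "strict_mono r" "(u \<circ> r) \<longlonglongrightarrow> l"
    using compact_Icc[of "\<sigma> (N q \<omega>) \<omega>" q] unfolding compact_def by metis
  have "(\<lambda>k. state p (path \<omega>) ((u \<circ> r) k)) \<longlonglongrightarrow> state p (path \<omega>) l"
    by (rule continuous_on_tendsto_compose[OF continuous_state_between_jumps[OF \<omega> q0(1)] lr(3,1)])
      (use \<open>\<And>k. u k \<in> ?S\<close> in auto)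
  then have "(\<lambda>k. limit_value (state p (path \<omega>) ((u \<circ> r) k)) + ennreal \<epsilon>) \<longlonglongrightarrow> limit_value (state p (path \<omega>) l) + ennreal \<epsilon>"
    by (rule value_add_tendsto)
  moreover have "(\<lambda>k. ennreal (1 / Suc (r k))) \<longlonglongrightarrow> ennreal 0"
    using LIMSEQ_subseq_LIMSEQ[OF LIMSEQ_Suc[OF lim_1_over_n] lr(2)]
    by (intro tendsto_ennrealI) (simp add: comp_def)
  ultimately have "(\<lambda>k. limit_value (state p (path \<omega>) ((u \<circ> r) k)) + ennreal \<epsilon> + ennreal (1 / Suc (r k))) \<longlonglongrightarrow>
     limit_value (state p (path \<omega>) l) + ennreal \<epsilon> + ennreal 0" by (rule tendsto_add)
  then have "ennreal K \<le> limit_value (state p (path \<omega>) l) + ennreal \<epsilon> + ennreal 0"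
    by (rule LIMSEQ_le_const) (use u(3) in \<open>auto intro: less_imp_le\<close>)
  moreover have "0 \<le> l" using lr(1) sigma_nonneg[OF \<omega>, of "N q \<omega>"] by simp
  ultimately have "l \<in> stop_times \<epsilon> p \<omega>" by (simp add: stop_times_def)
  then show "hit \<epsilon> p \<omega> \<le> ennreal t"
    unfolding hit_le_iff[OF \<omega> t] using lr(1) q0 by (intro bexI[of _ l]) auto
qed

lemma hit_adapted:
  assumes t: "0 \<le> t"
  shows "{\<omega>\<in>space M. hit \<epsilon> p \<omega> \<le> ennreal t} \<in> sets (past t)"
proof -
  have meas: "{x\<in>space R. f x = g x \<and> ennreal K < limit_value (s x) + ennreal \<epsilon> + e} \<in> sets R"
    if f: "f \<in> measurable R (count_space UNIV)" and g: "g \<in> measurable R (count_space UNIV)"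
      and [measurable]: "s \<in> borel_measurable R"
    for R :: "'a measure" and f g :: "'a \<Rightarrow> nat" and s e
  proof -
    define F where "F x = real (f x)" for x
    define G where "G x = real (g x)" for x
    have [measurable]: "F \<in> borel_measurable R" "G \<in> borel_measurable R"
      unfolding F_def G_def by (auto intro!: measurable_compose[OF f] measurable_compose[OF g])
    have "{x\<in>space R. F x = G x \<and> ennreal K < limit_value (s x) + ennreal \<epsilon> + e} \<in> sets R"
      by measurable
    then show ?thesis by (simp add: F_def G_def)
  qed
  define D where "D s = insert s (\<rat> \<inter> {0..s})" for s :: real
  define E where "E q u k = {\<omega>\<in>space M. N u \<omega> = N q \<omega> \<and>
     ennreal K < limit_value (state p (path \<omega>) u) + ennreal \<epsilon> + ennreal (1 / Suc k)}" for q u and k :: nat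
  have D: "countable (D s)" for s unfolding D_def using countable_rat by auto
  have iff: "hit \<epsilon> p \<omega> \<le> ennreal t \<longleftrightarrow> (\<exists>q\<in>D t. \<forall>k. \<exists>u\<in>D q. \<omega> \<in> E q u k)" if "\<omega> \<in> space M" for \<omega>
    unfolding hit_le_iff_countable[OF that t] D_def E_def mem_Collect_eq by (simp only: that simp_thms)
  have "{\<omega>\<in>space M. hit \<epsilon> p \<omega> \<le> ennreal t} = (\<Union>q\<in>D t. \<Inter>k. \<Union>u\<in>D q. E q u k)" (is "?L = ?R")
  proof (intro set_eqI iffI)
    fix \<omega> assume "\<omega> \<in> ?L"
    then show "\<omega> \<in> ?R" using iff[of \<omega>] by (simp only: mem_Collect_eq UN_iff INT_iff UNIV_I simp_thms ball_UNIV)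
  next
    fix \<omega> assume "\<omega> \<in> ?R"
    then have ex: "\<exists>q\<in>D t. \<forall>k. \<exists>u\<in>D q. \<omega> \<in> E q u k" by (simp only: UN_iff INT_iff ball_UNIV)
    then have "\<omega> \<in> space M" by (auto simp: E_def)
    then show "\<omega> \<in> ?L" using iff ex by (simp only: mem_Collect_eq simp_thms)
  qed
  also have "\<dots> \<in> sets (past t)"
  proof (intro sets.countable_UN'' sets.countable_INT image_subsetI D)
    fix q u k assume q: "q \<in> D t" and u: "u \<in> D q"
    have 0: "0 \<le> q" "q \<le> t" using q t by (auto simp: D_def)
    have 1: "0 \<le> u" "u \<le> q" using u 0 by (auto simp: D_def)
    have "{\<omega>\<in>space (past t). N u \<omega> = N q \<omega> \<and>
     ennreal K < limit_value (state p (path \<omega>) u) + ennreal \<epsilon> + ennreal (1 / Suc k)} \<in> sets (past t)"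
      using 0 1 by (intro meas measurable_N_past measurable_past_mono[OF _ measurable_state_past]) auto
    then show "E q u k \<in> sets (past t)" by (simp add: E_def)
  qed simp
  finally show ?thesis .
qed

lemma expected_cost_hit_pos:
  assumes "0 < \<epsilon>"
  shows "(\<integral>\<^sup>+\<omega>. cost p (path \<omega>) (hit \<epsilon> p \<omega>) \<partial>M) \<le> limit_value p + ennreal \<epsilon>"
proof (rule expected_cost_hitting_le[OF assms hit_adapted])
  fix \<omega> and t :: real assume \<omega>: "\<omega> \<in> space M" and t: "0 \<le> t"
  show "limit_value (state p (path \<omega>) t) + ennreal \<epsilon> \<le> ennreal K" if "ennreal t < hit \<epsilon> p \<omega>"
  proof (rule ccontr)
    assume "\<not> ?thesis"
    then have "t \<in> stop_times \<epsilon> p \<omega>" using t by (auto simp: stop_times_def)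
    then have "hit \<epsilon> p \<omega> \<le> ennreal t" unfolding hit_le_iff[OF \<omega> t] by auto
    then show False using that by simp
  qed
  show "ennreal K \<le> limit_value (state p (path \<omega>) t) + ennreal \<epsilon>" if "hit \<epsilon> p \<omega> = ennreal t"
    using hit_attained[OF \<omega> t that] by (simp add: stop_times_def)
qed

section \<open>Total inaccessibility of the jump times\<close>

lemma prob_jump_after:
  assumes C: "C \<in> sets (past t)" and t: "0 \<le> t" and h: "0 < h"
  shows "emeasure M (C \<inter> {\<omega>\<in>space M. 1 \<le> N (t + h) \<omega> - N t \<omega>}) \<le> ennreal (\<mu> * h) * emeasure M C"
proof -
  let ?b = "{w :: real \<Rightarrow> nat. 1 \<le> w h}"
  have b: "?b \<in> sets path_space"
  proof -
    have "{w \<in> space path_space. w h \<in> {1..}} \<in> sets path_space"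
      by (rule measurable_sets_Collect[OF measurable_component_singleton]) auto
    then show ?thesis by (simp add: space_PiM)
  qed
  have eq: "incr t -` ?b \<inter> space M = {\<omega>\<in>space M. 1 \<le> N (t + h) \<omega> - N t \<omega>}"
    using h by (auto simp: incr_eq[OF t])
  have "emeasure M (C \<inter> (incr t -` ?b \<inter> space M)) = emeasure M C * emeasure M (incr t -` ?b \<inter> space M)"
    using indep_past_future[OF t C b] by (simp add: emeasure_eq_measure ennreal_mult)
  also have "\<dots> \<le> emeasure M C * ennreal (\<mu> * h)"
    unfolding eq by (intro mult_left_mono prob_increment_ge_1 t h) simp
  finally show ?thesis unfolding eq by (simp add: mult.commute)
qed

text \<open>The jump times of \<open>N\<close> are totally inaccessible: between an announcing time \<open>\<tau>\<^sub>j\<close> and its limit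
  \<open>\<tau>\<close>, the expected number of jumps is at most \<open>\<mu>\<close> times the expected length.\<close>

lemma AE_no_announced_jump:
  fixes \<tau> :: "nat \<Rightarrow> 'a \<Rightarrow> ennreal"
  assumes adapted: "\<And>j t. 0 \<le> t \<Longrightarrow> {\<omega>\<in>space M. \<tau> j \<omega> \<le> ennreal t} \<in> sets (past t)"
    and mono: "\<And>\<omega>. incseq (\<lambda>j. \<tau> j \<omega>)"
  defines "\<rho> \<equiv> \<lambda>\<omega>. SUP j. \<tau> j \<omega>"
  shows "AE \<omega> in M. \<not> ((\<forall>j. \<tau> j \<omega> < \<rho> \<omega>) \<and> \<rho> \<omega> < \<top> \<and> (\<forall>s. 0 \<le> s \<longrightarrow> ennreal s < \<rho> \<omega> \<longrightarrow> N s \<omega> < N (enn2real (\<rho> \<omega>)) \<omega>))"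
proof -
  have \<rho>_adapted: "{\<omega>\<in>space M. \<rho> \<omega> \<le> ennreal t} \<in> sets (past t)" if "0 \<le> t" for t
  proof -
    have "{\<omega>\<in>space M. \<rho> \<omega> \<le> ennreal t} = (\<Inter>j. {\<omega>\<in>space M. \<tau> j \<omega> \<le> ennreal t})"
      unfolding \<rho>_def by (auto simp: SUP_le_iff)
    also have "\<dots> \<in> sets (past t)"
      using adapted[OF that] by (intro sets.countable_INT) auto
    finally show ?thesis .
  qed
  have \<tau>_less: "{\<omega>\<in>space M. \<tau> j \<omega> < ennreal t} \<in> sets (past t)" if "0 \<le> t" for t j
    using adapted that by (rule adapted_less)
  have \<rho>_less: "{\<omega>\<in>space M. \<rho> \<omega> < ennreal t} \<in> sets (past t)" if "0 \<le> t" for t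
    using \<rho>_adapted that by (rule adapted_less)
  have [measurable]: "\<tau> j \<in> borel_measurable M" for j by (rule measurable_time[OF \<tau>_less])
  have [measurable]: "\<rho> \<in> borel_measurable M" by (rule measurable_time[OF \<rho>_less])
  \<comment> \<open>The last clause says that N jumps at \<rho>: no earlier time has the same
    count.\<close>
  define bad where "bad \<omega> \<longleftrightarrow> (\<forall>j. \<tau> j \<omega> < \<rho> \<omega>) \<and> \<rho> \<omega> < \<top> \<and> (\<forall>s. 0 \<le> s \<longrightarrow> ennreal s < \<rho> \<omega> \<longrightarrow> N s \<omega> < N (enn2real (\<rho> \<omega>)) \<omega>)" for \<omega>
  have "AE \<omega> in M. \<not> (bad \<omega> \<and> \<rho> \<omega> < ennreal (real T))" for T :: nat
  proof -
    define h where "h k = (1 / 2 ^ k :: real)" for k :: nat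
    have h: "0 < h k" "h k * real (T * 2 ^ k) = real T" for k by (auto simp: h_def)
    have hi: "0 \<le> h k * real i" for k i using h(1)[of k] by simp
    \<comment> \<open>\<open>C\<close> selects the grid points in (\<tau>_j, \<rho>],
      \<open>J\<close> asks for a jump in the cell to the right of the point, and \<open>S\<close>
      counts the cells with both. Membership in \<open>C\<close> is known at the left end of the
      cell, hence independent of the jump.\<close>
    define C where "C j k i = {\<omega>\<in>space M. \<tau> j \<omega> < ennreal (h k * real i) \<and> ennreal (h k * real i) \<le> \<rho> \<omega>}" for j k i
    define J where "J k i = {\<omega>\<in>space M. 1 \<le> N (h k * real i + h k) \<omega> - N (h k * real i) \<omega>}" for k i
    define S where "S j k \<omega> = (\<Sum>i<T * 2 ^ k. indicator (C j k i \<inter> J k i) \<omega> :: ennreal)" for j k \<omega>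
    define r where "r \<omega> = enn2real (min (\<rho> \<omega>) (ennreal (real T)))" for \<omega>
    define x where "x j \<omega> = enn2real (min (\<tau> j \<omega>) (ennreal (real T)))" for j \<omega>
    have [measurable]: "r \<in> borel_measurable M" "x j \<in> borel_measurable M" for j
      unfolding r_def[abs_def] x_def[abs_def] by measurable
    have re: "ennreal (r \<omega>) = min (\<rho> \<omega>) (ennreal (real T))" and xe: "ennreal (x j \<omega>) = min (\<tau> j \<omega>) (ennreal (real T))" for j \<omega>
      unfolding r_def x_def by (auto simp: min_less_iff_disj)
    have rx0: "0 \<le> r \<omega>" "0 \<le> x j \<omega>" for j \<omega> by (auto simp: r_def x_def)
    have \<tau>_le: "\<tau> j \<omega> \<le> \<rho> \<omega>" for j \<omega> unfolding \<rho>_def by (rule SUP_upper) simp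
    have xr: "x j \<omega> \<le> r \<omega>" for j \<omega>
    proof -
      have "ennreal (x j \<omega>) \<le> ennreal (r \<omega>)" unfolding re xe by (intro min.mono \<tau>_le order_refl)
      then show ?thesis using rx0 by (simp add: ennreal_le_iff)
    qed
    have rT: "r \<omega> \<le> T" for \<omega>
    proof -
      have "ennreal (r \<omega>) \<le> ennreal (real T)" unfolding re by simp
      then show ?thesis by (simp add: ennreal_le_iff)
    qed
    have C_past: "C j k i \<in> sets (past (h k * real i))" for j k i
    proof -
      let ?t = "h k * real i"
      have "C j k i = {\<omega>\<in>space M. \<tau> j \<omega> < ennreal ?t} \<inter> (space (past ?t) - {\<omega>\<in>space M. \<rho> \<omega> < ennreal ?t})"
        by (auto simp: C_def not_less)
      then show ?thesis using sets.Int[OF \<tau>_less[OF hi] sets.compl_sets[OF \<rho>_less[OF hi]]] by simp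
    qed
    have CM [measurable]: "C j k i \<in> sets M" for j k i using C_past sets_past_subset by blast
    have JM [measurable]: "J k i \<in> sets M" for k i
    proof -
      have [measurable]: "N (h k * real i + h k) \<in> measurable M (count_space UNIV)" "N (h k * real i) \<in> measurable M (count_space UNIV)"
        using hi[of k i] h(1)[of k] by (auto intro!: measurable_N)
      show ?thesis unfolding J_def by measurable
    qed
    have SM [measurable]: "S j k \<in> borel_measurable M" for j k unfolding S_def[abs_def] by measurable
    \<comment> \<open>The number of grid points in (\<tau>_j, \<rho>] is a difference of two rounded
      times, so the rounding error is at most one mesh.\<close>
    have count: "h k * (\<Sum>i<T * 2 ^ k. indicator (C j k i) \<omega>) \<le> r \<omega> - x j \<omega> + h k" if \<omega>: "\<omega> \<in> space M" for j k \<omega>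
    proof -
      let ?n = "T * 2 ^ k"
      let ?A = "\<lambda>h i. {\<omega>\<in>space M. ennreal (h * real i) \<le> \<rho> \<omega>}"
      let ?B = "\<lambda>h i. {\<omega>\<in>space M. ennreal (h * real i) \<le> \<tau> j \<omega>}"
      have "(indicator (C j k i) \<omega> :: real) = indicator (?A (h k) i) \<omega> - indicator (?B (h k) i) \<omega>" for i
        using \<omega> order_trans[OF _ \<tau>_le[of j \<omega>]] by (auto simp: indicator_def C_def not_le)
      then have "h k * (\<Sum>i<?n. indicator (C j k i) \<omega>) = grid_time (h k) (?A (h k)) ?n \<omega> - grid_time (h k) (?B (h k)) ?n \<omega>"
        by (simp add: grid_time_def sum_subtractf right_diff_distrib)
      also have "\<dots> \<le> (r \<omega> + h k) - x j \<omega>"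
        unfolding r_def x_def by (intro diff_mono grid_time_stopping_bounds \<omega> h)
      finally show ?thesis by simp
    qed
    have S_int: "(\<integral>\<^sup>+\<omega>. S j k \<omega> \<partial>M) \<le> ennreal \<mu> * ((\<integral>\<^sup>+\<omega>. ennreal (r \<omega> - x j \<omega>) \<partial>M) + ennreal (h k))" for j k
    proof -
      let ?n = "T * 2 ^ k"
      have "(\<integral>\<^sup>+\<omega>. S j k \<omega> \<partial>M) = (\<Sum>i<?n. emeasure M (C j k i \<inter> J k i))"
        unfolding S_def by (subst nn_integral_sum) auto
      also have "\<dots> \<le> (\<Sum>i<?n. ennreal (\<mu> * h k) * emeasure M (C j k i))"
        unfolding J_def by (intro sum_mono prob_jump_after C_past hi h)
      also have "\<dots> = (\<integral>\<^sup>+\<omega>. (\<Sum>i<?n. ennreal (\<mu> * h k) * indicator (C j k i) \<omega>) \<partial>M)"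
        by (subst nn_integral_sum) (auto simp: nn_integral_cmult)
      also have "\<dots> \<le> (\<integral>\<^sup>+\<omega>. ennreal \<mu> * (ennreal (r \<omega> - x j \<omega>) + ennreal (h k)) \<partial>M)"
      proof (rule nn_integral_mono)
        fix \<omega> assume \<omega>: "\<omega> \<in> space M"
        have "(\<Sum>i<?n. ennreal (\<mu> * h k) * indicator (C j k i) \<omega>) = (\<Sum>i<?n. ennreal (\<mu> * h k * indicator (C j k i) \<omega>))"
          by (intro sum.cong) (auto simp: indicator_def)
        also have "\<dots> = ennreal (\<Sum>i<?n. \<mu> * h k * indicator (C j k i) \<omega>)"
          using mu_pos h(1)[of k] by (intro sum_ennreal) auto
        also have "(\<Sum>i<?n. \<mu> * h k * indicator (C j k i) \<omega>) = \<mu> * (h k * (\<Sum>i<?n. indicator (C j k i) \<omega>))"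
          by (simp only: sum_distrib_left mult.assoc)
        also have "ennreal \<dots> \<le> ennreal (\<mu> * (r \<omega> - x j \<omega> + h k))"
          using count[OF \<omega>] mu_pos by (intro ennreal_leI mult_left_mono) auto
        also have "\<dots> = ennreal \<mu> * (ennreal (r \<omega> - x j \<omega>) + ennreal (h k))"
          using mu_pos h(1)[of k] xr[of j \<omega>] by (simp add: ennreal_mult ennreal_plus[symmetric] del: ennreal_plus)
        finally show "(\<Sum>i<?n. ennreal (\<mu> * h k) * indicator (C j k i) \<omega>) \<le> ennreal \<mu> * (ennreal (r \<omega> - x j \<omega>) + ennreal (h k))" .
      qed
      also have "\<dots> = ennreal \<mu> * ((\<integral>\<^sup>+\<omega>. ennreal (r \<omega> - x j \<omega>) \<partial>M) + ennreal (h k))"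
        by (simp add: nn_integral_cmult nn_integral_add emeasure_space_1)
      finally show ?thesis .
    qed
    have h0: "h \<longlonglongrightarrow> 0" unfolding h_def[abs_def] using LIMSEQ_divide_realpow_zero[of 2 1] by simp
    define F where "F j \<omega> = liminf (\<lambda>k. S j k \<omega>)" for j \<omega>
    have FM [measurable]: "F j \<in> borel_measurable M" for j unfolding F_def[abs_def] by measurable
    have F_int: "(\<integral>\<^sup>+\<omega>. F j \<omega> \<partial>M) \<le> ennreal \<mu> * (\<integral>\<^sup>+\<omega>. ennreal (r \<omega> - x j \<omega>) \<partial>M)" for j
    proof (rule nn_integral_le_Fatou[OF SM S_int])
      have "(\<lambda>k. ennreal \<mu> * ((\<integral>\<^sup>+\<omega>. ennreal (r \<omega> - x j \<omega>) \<partial>M) + ennreal (h k))) \<longlonglongrightarrow> ennreal \<mu> * ((\<integral>\<^sup>+\<omega>. ennreal (r \<omega> - x j \<omega>) \<partial>M) + ennreal 0)"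
        by (intro ennreal_tendsto_cmult tendsto_add tendsto_const tendsto_ennrealI h0) auto
      then show "(\<lambda>k. ennreal \<mu> * ((\<integral>\<^sup>+\<omega>. ennreal (r \<omega> - x j \<omega>) \<partial>M) + ennreal (h k))) \<longlonglongrightarrow> ennreal \<mu> * (\<integral>\<^sup>+\<omega>. ennreal (r \<omega> - x j \<omega>) \<partial>M)"
        by simp
    qed (simp add: F_def)
    \<comment> \<open>The times \<tau>_j increase to \<rho>, so the truncated lengths tend to 0, and
      with them the bound on the expected number of counted cells.\<close>
    have lim0: "(\<lambda>j. ennreal \<mu> * (\<integral>\<^sup>+\<omega>. ennreal (r \<omega> - x j \<omega>) \<partial>M)) \<longlonglongrightarrow> ennreal \<mu> * (\<integral>\<^sup>+\<omega>. 0 \<partial>M)"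
    proof (intro ennreal_tendsto_cmult nn_integral_dominated_convergence[where w="\<lambda>_. ennreal (real T)"])
      show "AE \<omega> in M. ennreal (r \<omega> - x j \<omega>) \<le> ennreal (real T)" for j
        using rT rx0 by (intro AE_I2 ennreal_leI) (metis add.commute add_increasing2 diff_le_eq order_trans)
      show "AE \<omega> in M. (\<lambda>j. ennreal (r \<omega> - x j \<omega>)) \<longlonglongrightarrow> 0"
      proof (rule AE_I2)
        fix \<omega>
        have "(\<lambda>j. \<tau> j \<omega>) \<longlonglongrightarrow> \<rho> \<omega>" unfolding \<rho>_def by (rule LIMSEQ_SUP[OF mono])
        then have "(\<lambda>j. min (\<tau> j \<omega>) (ennreal (real T))) \<longlonglongrightarrow> min (\<rho> \<omega>) (ennreal (real T))"
          by (intro tendsto_min tendsto_const)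
        then have "(\<lambda>j. ennreal (x j \<omega>)) \<longlonglongrightarrow> ennreal (r \<omega>)" by (simp only: re xe)
        then have "(\<lambda>j. x j \<omega>) \<longlonglongrightarrow> r \<omega>" using rx0 by (subst (asm) tendsto_ennreal_iff) auto
        then have "(\<lambda>j. ennreal (r \<omega> - x j \<omega>)) \<longlonglongrightarrow> ennreal (r \<omega> - r \<omega>)"
          by (intro tendsto_ennrealI tendsto_diff tendsto_const)
        then show "(\<lambda>j. ennreal (r \<omega> - x j \<omega>)) \<longlonglongrightarrow> 0" by simp
      qed
    qed (auto simp: emeasure_space_1)
    have "(\<integral>\<^sup>+\<omega>. liminf (\<lambda>j. F j \<omega>) \<partial>M) \<le> 0"
      by (rule nn_integral_le_Fatou[OF FM F_int _ order_refl]) (use lim0 in simp)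
    then have ae: "AE \<omega> in M. liminf (\<lambda>j. F j \<omega>) = 0"
      by (subst (asm) le_zero_eq, subst (asm) nn_integral_0_iff_AE) auto
    have "1 \<le> F j \<omega>" if \<omega>: "\<omega> \<in> space M" "bad \<omega>" "\<rho> \<omega> < ennreal (real T)" for j \<omega>
    proof -
      obtain u where u: "\<rho> \<omega> = ennreal u" "0 \<le> u" using \<omega>(2) by (cases "\<rho> \<omega>") (auto simp: bad_def)
      have uT: "u < T" using \<omega>(3) u by (simp add: ennreal_less_iff)
      have "\<tau> j \<omega> < ennreal u" using \<omega>(2) u by (auto simp: bad_def)
      then obtain y where y: "\<tau> j \<omega> = ennreal y" "0 \<le> y" "y < u"
        by (cases "\<tau> j \<omega>") (auto simp: ennreal_less_iff)
      have "eventually (\<lambda>k. h k < u - y) sequentially" using y by (intro order_tendstoD(2)[OF h0]) auto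
      then have "eventually (\<lambda>k. 1 \<le> S j k \<omega>) sequentially"
      proof eventually_elim
        case (elim k)
        \<comment> \<open>The ceiling minus 1 picks the cell (h i, h i + h] containing u. Being open
          on the left it forces a strictly smaller count at h i, and h i exceeds y because the mesh
          is below u - y.\<close>
        define i where "i = nat (\<lceil>u / h k\<rceil> - 1)"
        have "0 < u / h k" using y h(1)[of k] by simp
        then have i: "real i = real_of_int \<lceil>u / h k\<rceil> - 1" unfolding i_def by (simp add: of_nat_nat)
        have "real i < u / h k" "u / h k \<le> real i + 1" unfolding i by linarith+
        then have iu: "h k * real i < u" "u \<le> h k * real i + h k" using h(1)[of k] by (auto simp: field_simps)
        have "h k * real i < h k * real (T * 2 ^ k)" using iu uT h(2)[of k] by linarith
        then have "i < T * 2 ^ k" using h(1)[of k] by (simp add: mult_less_cancel_left_pos del: of_nat_mult)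
        have "y < h k * real i" using elim iu by linarith
        then have "\<omega> \<in> C j k i" using \<omega>(1) iu y u by (auto simp: C_def intro!: ennreal_lessI ennreal_leI)
        moreover have "\<omega> \<in> J k i"
        proof -
          have "N (h k * real i) \<omega> < N u \<omega>"
            using \<omega>(2) u iu(1) hi[of k i] by (auto simp: bad_def ennreal_less_iff)
          also have "\<dots> \<le> N (h k * real i + h k) \<omega>" using iu u by (intro N_mono \<omega>) auto
          finally show ?thesis using \<omega>(1) by (simp add: J_def)
        qed
        ultimately have "1 = (indicator (C j k i \<inter> J k i) \<omega> :: ennreal)" by simp
        also have "\<dots> \<le> S j k \<omega>"
          unfolding S_def by (rule member_le_sum) (use \<open>i < T * 2 ^ k\<close> in auto)
        finally show ?case .
      qed
      then show ?thesis unfolding F_def by (rule Liminf_bounded)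
    qed
    then have ge: "1 \<le> liminf (\<lambda>j. F j \<omega>)" if "\<omega> \<in> space M" "bad \<omega>" "\<rho> \<omega> < ennreal (real T)" for \<omega>
      using that by (intro Liminf_bounded) auto
    from ae show ?thesis
    proof (rule AE_mp, intro AE_I2 impI)
      fix \<omega> assume "\<omega> \<in> space M" "liminf (\<lambda>j. F j \<omega>) = 0"
      then show "\<not> (bad \<omega> \<and> \<rho> \<omega> < ennreal (real T))" using ge[of \<omega>] by auto
    qed
  qed
  then have "AE \<omega> in M. \<forall>T::nat. \<not> (bad \<omega> \<and> \<rho> \<omega> < ennreal (real T))" unfolding AE_all_countable by blast
  then show ?thesis unfolding bad_def[symmetric]
  proof eventually_elim
    case (elim \<omega>)
    show ?case
    proof
      assume b: "bad \<omega>"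
      then obtain n :: nat where "\<rho> \<omega> < of_nat n" using ennreal_Ex_less_of_nat[of "\<rho> \<omega>"] by (auto simp: bad_def)
      then show False using elim b by (auto simp: ennreal_of_nat_eq_real_of_nat)
    qed
  qed
qed

section \<open>From positive tolerances to tolerance zero\<close>

lemma hit_antimono: "\<epsilon> \<le> \<delta> \<Longrightarrow> hit \<delta> p \<omega> \<le> hit \<epsilon> p \<omega>"
  unfolding hit_def stop_times_def
  by (intro Inf_superset_mono image_mono) (auto intro: order_trans[OF _ add_left_mono] ennreal_leI)

lemma discount_antimono: "s \<le> t \<Longrightarrow> discount t \<le> discount s"
proof -
  assume st: "s \<le> t"
  show ?thesis
  proof (cases "t = \<top>")
    case False
    then have "enn2real s \<le> enn2real t" using st by (intro enn2real_mono) (auto simp: less_top)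
    then have "exp (- lam * enn2real t) \<le> exp (- lam * enn2real s)" using lam by simp
    then show ?thesis using False st by (auto simp: discount_def top_unique intro!: ennreal_leI)
  qed (simp add: discount_def)
qed

text \<open>Let u be the limit of the times for tolerance 1/(j+1), if finite. If it is reached, the
  states are eventually the state at u; if not, it is announced, so almost surely N does not jump at
  u and the state is left continuous there. Either way K \<le> r holds at u in the limit.\<close>

lemma hit_zero_limit:
  "AE \<omega> in M. (SUP j. hit (1 / Suc j) p \<omega>) = hit 0 p \<omega>"
proof -
  let ?\<rho> = "\<lambda>\<omega>. SUP j. hit (1 / Suc j) p \<omega>"
  have mono: "incseq (\<lambda>j. hit (1 / Suc j) p \<omega>)" for \<omega>
    by (intro incseq_SucI hit_antimono) (simp add: field_simps)
  have "AE \<omega> in M. \<not> ((\<forall>j. hit (1 / Suc j) p \<omega> < ?\<rho> \<omega>) \<and> ?\<rho> \<omega> < \<top> \<and>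
      (\<forall>s. 0 \<le> s \<longrightarrow> ennreal s < ?\<rho> \<omega> \<longrightarrow> N s \<omega> < N (enn2real (?\<rho> \<omega>)) \<omega>))"
    by (rule AE_no_announced_jump[OF _ mono]) (rule hit_adapted)
  then show ?thesis
  proof (rule AE_mp, intro AE_I2 impI)
    fix \<omega> assume \<omega>: "\<omega> \<in> space M"
      and nb: "\<not> ((\<forall>j. hit (1 / Suc j) p \<omega> < ?\<rho> \<omega>) \<and> ?\<rho> \<omega> < \<top> \<and> (\<forall>s. 0 \<le> s \<longrightarrow> ennreal s < ?\<rho> \<omega> \<longrightarrow> N s \<omega> < N (enn2real (?\<rho> \<omega>)) \<omega>))"
    have le: "hit (1 / Suc j) p \<omega> \<le> ?\<rho> \<omega>" for j by (rule SUP_upper) simp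
    have "?\<rho> \<omega> \<le> hit 0 p \<omega>" by (intro SUP_least hit_antimono) simp
    moreover have "hit 0 p \<omega> \<le> ?\<rho> \<omega>"
    proof (cases "?\<rho> \<omega>")
      case (real u)
      have rho: "(\<lambda>j. hit (1 / Suc j) p \<omega>) \<longlonglongrightarrow> ennreal u" using LIMSEQ_SUP[OF mono[of \<omega>]] real by simp
      define t where "t j = enn2real (hit (1 / Suc j) p \<omega>)" for j
      have t: "hit (1 / Suc j) p \<omega> = ennreal (t j)" "0 \<le> t j" "t j \<le> u" for j
      proof -
        have "hit (1 / Suc j) p \<omega> < \<top>" using le[of j] real by (metis ennreal_less_top le_less_trans)
        then show e: "hit (1 / Suc j) p \<omega> = ennreal (t j)" by (simp add: t_def)
        show "0 \<le> t j" by (simp add: t_def)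
        show "t j \<le> u" using le[of j] real e by (simp add: ennreal_le_iff)
      qed
      have tl: "t \<longlonglongrightarrow> u"
        using rho t(2) real unfolding t(1) by (subst (asm) tendsto_ennreal_iff) auto
      have tK: "ennreal K \<le> limit_value (state p (path \<omega>) (t j)) + ennreal (1 / Suc j)" for j
        using hit_attained[OF \<omega> t(2,1)[of j]] by (simp add: stop_times_def)
      have e0: "(\<lambda>j. ennreal (1 / Suc j)) \<longlonglongrightarrow> ennreal 0"
        by (intro tendsto_ennrealI LIMSEQ_Suc[OF lim_1_over_n])
      have "(\<lambda>j. state p (path \<omega>) (t j)) \<longlonglongrightarrow> state p (path \<omega>) u"
      proof (cases "\<exists>j. t j = u")
        case True
        then obtain j where "t j = u" by blast
        then have "t i = u" if "j \<le> i" for i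
        proof -
          have "ennreal (t j) \<le> ennreal (t i)" unfolding t(1)[symmetric] by (rule incseqD[OF mono that])
          then show ?thesis using t(2,3)[of i] \<open>t j = u\<close> by (simp add: ennreal_le_iff)
        qed
        then have "eventually (\<lambda>i. state p (path \<omega>) (t i) = state p (path \<omega>) u) sequentially"
          by (auto simp: eventually_sequentially intro!: exI[of _ j])
        then show ?thesis by (rule tendsto_eventually)
      next
        case False
        have "hit (1 / Suc j) p \<omega> < ?\<rho> \<omega>" for j
        proof -
          have "t j < u" using t(3)[of j] False by (auto simp: order_le_less)
          then have "ennreal (t j) < ennreal u" using t(2) by (simp add: ennreal_less_iff)
          then show ?thesis by (simp only: t(1)[of j] real(2))
        qed
        moreover have "?\<rho> \<omega> < \<top>" "enn2real (?\<rho> \<omega>) = u" using real by simp_all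
        ultimately obtain s where s: "0 \<le> s" "ennreal s < ennreal u" "\<not> N s \<omega> < N u \<omega>"
          using nb real(2) by metis
        then have "s < u" by (simp add: ennreal_less_iff)
        moreover have "N s \<omega> = N u \<omega>" using N_mono[OF \<omega> s(1), of u] s(3) \<open>s < u\<close> by simp
        ultimately have s: "0 \<le> s" "s < u" "N s \<omega> = N u \<omega>" using s(1) by auto
        have "\<sigma> (N u \<omega>) \<omega> \<le> s" using sigma_N_le[OF \<omega> s(1)] s(3) by simp
        then have "eventually (\<lambda>j. t j \<in> {\<sigma> (N u \<omega>) \<omega>..u}) sequentially"
          using order_tendstoD(1)[OF tl s(2)] t(3) by (auto elim!: eventually_mono)
        then show ?thesis
          using \<open>\<sigma> (N u \<omega>) \<omega> \<le> s\<close> s real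
          by (intro continuous_on_tendsto_compose[OF continuous_state_between_jumps[OF \<omega>, of u] tl]) auto
      qed
      from tendsto_add[OF value_add_tendsto[OF this, of 0] e0]
      have "(\<lambda>j. limit_value (state p (path \<omega>) (t j)) + ennreal (1 / Suc j)) \<longlonglongrightarrow> limit_value (state p (path \<omega>) u)" by simp
      then have "ennreal K \<le> limit_value (state p (path \<omega>) u)"
        by (rule LIMSEQ_le_const) (use tK in auto)
      then have "u \<in> stop_times 0 p \<omega>" using real by (simp add: stop_times_def)
      then have "hit 0 p \<omega> \<le> ennreal u" unfolding hit_def by (intro Inf_lower imageI)
      then show ?thesis by (simp only: real(2))
    next
      case top
      then show ?thesis by (simp only: top_greatest)
    qed
    ultimately show "?\<rho> \<omega> = hit 0 p \<omega>" by (rule antisym)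
  qed
qed

text \<open>By Fatou it suffices that the cost is lower semicontinuous along increasing times: the
  running part grows to its value at the supremum, and the discount is smallest there.\<close>

lemma expected_cost_hit_zero: "(\<integral>\<^sup>+\<omega>. cost p (path \<omega>) (hit 0 p \<omega>) \<partial>M) \<le> limit_value p"
proof -
  have [measurable]: "hit \<epsilon> p \<in> borel_measurable M" for \<epsilon>
    by (rule measurable_time[OF adapted_less[OF hit_adapted]])
  have "(\<integral>\<^sup>+\<omega>. cost p (path \<omega>) (hit 0 p \<omega>) \<partial>M) = (\<integral>\<^sup>+\<omega>. cost p (path \<omega>) (SUP j. hit (1 / Suc j) p \<omega>) \<partial>M)"
  proof (rule nn_integral_cong_AE)
    show "AE \<omega> in M. cost p (path \<omega>) (hit 0 p \<omega>) = cost p (path \<omega>) (SUP j. hit (1 / Suc j) p \<omega>)"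
      using hit_zero_limit[of p] by eventually_elim (simp only:)
  qed
  also have "\<dots> \<le> limit_value p"
  proof (rule nn_integral_le_Fatou)
    show "(\<lambda>\<omega>. cost p (path \<omega>) (hit (1 / Suc j) p \<omega>)) \<in> borel_measurable M" for j by measurable
    show "(\<integral>\<^sup>+\<omega>. cost p (path \<omega>) (hit (1 / Suc j) p \<omega>) \<partial>M) \<le> limit_value p + ennreal (1 / Suc j)" for j
      by (rule expected_cost_hit_pos) simp
    have "(\<lambda>j. limit_value p + ennreal (1 / Suc j)) \<longlonglongrightarrow> limit_value p + ennreal 0"
      by (intro tendsto_add tendsto_const tendsto_ennrealI LIMSEQ_Suc[OF lim_1_over_n])
    then show "(\<lambda>j. limit_value p + ennreal (1 / Suc j)) \<longlonglongrightarrow> limit_value p" by simp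
    fix \<omega> assume \<omega>: "\<omega> \<in> space M"
    let ?\<tau> = "\<lambda>j. hit (1 / Suc j) p \<omega>"
    let ?\<rho> = "SUP j. ?\<tau> j"
    let ?F = "\<lambda>s. ennreal (exp (- lam * s)) * total_mass (state p (path \<omega>) s)"
    have [measurable]: "(\<lambda>s. state p (path \<omega>) s) \<in> borel_measurable borel"
      by (rule measurable_state_path) (use \<omega> in auto)
    have inc: "incseq ?\<tau>"
      by (intro incseq_SucI hit_antimono) (simp add: field_simps)
    \<comment> \<open>The supremum itself may lie beyond every \<tau>_j; a single point carries no
      Lebesgue mass.\<close>
    have "AE s in lborel. s \<noteq> enn2real ?\<rho>" by (rule AE_lborel_singleton)
    then have "AE s in lborel. indicator {s. 0 \<le> s \<and> ennreal s \<le> ?\<rho>} s * ?F s \<le> liminf (\<lambda>j. indicator {s. 0 \<le> s \<and> ennreal s \<le> ?\<tau> j} s * ?F s)"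
    proof eventually_elim
      case (elim s)
      show ?case
      proof (cases "0 \<le> s \<and> ennreal s \<le> ?\<rho>")
        case True
        moreover have "ennreal s \<noteq> ?\<rho>" using elim True by (metis enn2real_ennreal)
        ultimately have "ennreal s < ?\<rho>" by (auto simp: order_le_less)
        then obtain j where j: "ennreal s < ?\<tau> j" by (auto simp: less_SUP_iff)
        have "eventually (\<lambda>i. indicator {s. 0 \<le> s \<and> ennreal s \<le> ?\<rho>} s * ?F s \<le> indicator {s. 0 \<le> s \<and> ennreal s \<le> ?\<tau> i} s * ?F s) sequentially"
          using eventually_ge_at_top[of j]
        proof eventually_elim
          case (elim i)
          then have "ennreal s \<le> ?\<tau> i" using incseqD[OF inc elim] j by (meson less_imp_le order_trans)
          then show ?case using True by simp
        qed
        then show ?thesis by (rule Liminf_bounded)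
      qed simp
    qed
    then have "run_until p (path \<omega>) ?\<rho> \<le> (\<integral>\<^sup>+s. liminf (\<lambda>j. indicator {s. 0 \<le> s \<and> ennreal s \<le> ?\<tau> j} s * ?F s) \<partial>lborel)"
      unfolding run_until_def by (rule nn_integral_mono_AE)
    also have "\<dots> \<le> liminf (\<lambda>j. run_until p (path \<omega>) (?\<tau> j))"
      unfolding run_until_def by (rule nn_integral_liminf) measurable
    finally have r: "run_until p (path \<omega>) ?\<rho> \<le> liminf (\<lambda>j. run_until p (path \<omega>) (?\<tau> j))" .
    have "cost p (path \<omega>) ?\<rho> \<le> liminf (\<lambda>j. run_until p (path \<omega>) (?\<tau> j)) + ennreal K * discount ?\<rho>"
      unfolding cost_def by (intro add_right_mono r)
    also have "\<dots> = liminf (\<lambda>j. run_until p (path \<omega>) (?\<tau> j) + ennreal K * discount ?\<rho>)"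
    proof -
      have "(\<lambda>j. run_until p (path \<omega>) (?\<tau> j)) \<longlonglongrightarrow> (SUP j. run_until p (path \<omega>) (?\<tau> j))"
        by (intro LIMSEQ_SUP) (use inc in \<open>auto simp: incseq_def intro!: run_until_mono\<close>)
      from lim_imp_Liminf[OF _ this] lim_imp_Liminf[OF _ tendsto_add[OF this tendsto_const]] show ?thesis by simp
    qed
    also have "\<dots> \<le> liminf (\<lambda>j. cost p (path \<omega>) (?\<tau> j))"
      unfolding cost_def
      by (intro Liminf_mono always_eventually allI add_left_mono mult_left_mono discount_antimono SUP_upper) auto
    finally show "cost p (path \<omega>) ?\<rho> \<le> liminf (\<lambda>j. cost p (path \<omega>) (?\<tau> j))" .
  qed
  finally show ?thesis .
qed

end

section \<open>The optimal stopping problem\<close>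

text \<open>A and B need not be the positive and negative parts. For truncated differences A + (B -
  A) = B + (A - B), and since B has a finite integral the common part cancels even when A has an
  infinite one.\<close>

lemma ext_integral_diff:
  fixes A B :: "'b \<Rightarrow> ennreal"
  assumes [measurable]: "A \<in> borel_measurable R" "B \<in> borel_measurable R"
    and B: "\<And>x. x \<in> space R \<Longrightarrow> B x < \<top>" "(\<integral>\<^sup>+x. B x \<partial>R) < \<top>"
    and f: "\<And>x. x \<in> space R \<Longrightarrow> f x = enn2ereal (A x) - enn2ereal (B x)"
  shows "ext_integral R f = enn2ereal (\<integral>\<^sup>+x. A x \<partial>R) - enn2ereal (\<integral>\<^sup>+x. B x \<partial>R)"
proof -
  have e1: "e2ennreal (enn2ereal u - enn2ereal v) = u - v" for u v :: ennreal
    by (simp add: minus_ennreal.rep_eq flip: e2ennreal_enn2ereal)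
  have pos: "(\<integral>\<^sup>+x. e2ennreal (f x) \<partial>R) = (\<integral>\<^sup>+x. A x - B x \<partial>R)"
    by (intro nn_integral_cong) (simp add: f e1)
  have neg: "(\<integral>\<^sup>+x. e2ennreal (- f x) \<partial>R) = (\<integral>\<^sup>+x. B x - A x \<partial>R)"
  proof (intro nn_integral_cong)
    fix x assume x: "x \<in> space R"
    have "- f x = enn2ereal (B x) - enn2ereal (A x)"
      using B(1)[OF x] unfolding f[OF x] by (cases "A x"; cases "B x") (auto simp: less_top)
    then show "e2ennreal (- f x) = B x - A x" by (simp add: e1)
  qed
  have "(\<integral>\<^sup>+x. A x \<partial>R) + (\<integral>\<^sup>+x. B x - A x \<partial>R) = (\<integral>\<^sup>+x. A x + (B x - A x) \<partial>R)"
    by (rule nn_integral_add[symmetric]) measurable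
  also have "\<dots> = (\<integral>\<^sup>+x. B x + (A x - B x) \<partial>R)"
  proof (intro nn_integral_cong)
    fix x assume x: "x \<in> space R"
    show "A x + (B x - A x) = B x + (A x - B x)"
    proof (cases "A x \<le> B x")
      case True
      then have "A x - B x = 0" using B(1)[OF x] by (intro diff_eq_0_ennreal) auto
      then show ?thesis using True by (simp add: add_diff_inverse_ennreal)
    next
      case False
      then have "B x - A x = 0" using B(1)[OF x] by (intro diff_eq_0_ennreal) auto
      then show ?thesis using False by (simp add: add_diff_inverse_ennreal)
    qed
  qed
  also have "\<dots> = (\<integral>\<^sup>+x. B x \<partial>R) + (\<integral>\<^sup>+x. A x - B x \<partial>R)"
    by (rule nn_integral_add) measurable
  finally have eq: "(\<integral>\<^sup>+x. A x \<partial>R) + (\<integral>\<^sup>+x. B x - A x \<partial>R) = (\<integral>\<^sup>+x. B x \<partial>R) + (\<integral>\<^sup>+x. A x - B x \<partial>R)" .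
  have "(\<integral>\<^sup>+x. B x - A x \<partial>R) \<le> (\<integral>\<^sup>+x. B x \<partial>R)"
    by (intro nn_integral_mono) (simp add: diff_le_self_ennreal)
  then have fin: "(\<integral>\<^sup>+x. B x - A x \<partial>R) < \<top>" using B(2) by (rule le_less_trans)
  have alg: "enn2ereal p - enn2ereal n = enn2ereal u - enn2ereal v" if sum: "u + n = v + p" and fin: "n < \<top>" "v < \<top>" for u n v p :: ennreal
  proof -
    obtain n' v' where n: "n = ennreal n'" "0 \<le> n'" and v: "v = ennreal v'" "0 \<le> v'"
      using fin by (cases n; cases v) auto
    show ?thesis
    proof (cases u)
      case (real u')
      have "p \<noteq> \<top>" using sum real n v by (auto simp: ennreal_plus[symmetric] simp del: ennreal_plus)
      then obtain p' where p: "p = ennreal p'" "0 \<le> p'" by (cases p) auto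
      have "u' + n' = v' + p'" using sum real n v p by (simp add: ennreal_plus[symmetric] del: ennreal_plus)
      then show ?thesis using real n v p by simp
    next
      case top
      then have "p = \<top>" using sum v by (cases p) (auto simp: ennreal_plus[symmetric] simp del: ennreal_plus)
      then show ?thesis using top n v by simp
    qed
  qed
  show ?thesis unfolding ext_integral_def pos neg using eq fin B(2) by (rule alg)
qed

context stopping_problem
begin

text \<open>An antiderivative of lam K exp(-lam s) is -K exp(-lam s). This identity trades the
  constant term of the cost rate for a terminal payment.\<close>

lemma discounted_constant:
  "(\<integral>\<^sup>+s. indicator {s. 0 \<le> s \<and> ennreal s \<le> \<tau>} s * ennreal (exp (- lam * s) * (lam * K)) \<partial>lborel) + ennreal K * discount \<tau> = ennreal K"
proof -
  let ?f = "\<lambda>s. exp (- lam * s) * (lam * K)"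
  let ?F = "\<lambda>s. - K * exp (- lam * s)"
  have d: "(?F has_real_derivative ?f s) (at s)" for s
    by (auto intro!: derivative_eq_intros)
  have f0: "0 \<le> ?f s" for s using lam K by simp
  show ?thesis
  proof (cases \<tau>)
    case (real t)
    have "(\<integral>\<^sup>+s. indicator {s. 0 \<le> s \<and> ennreal s \<le> \<tau>} s * ennreal (?f s) \<partial>lborel) = (\<integral>\<^sup>+s. ennreal (?f s) * indicator {0..t} s \<partial>lborel)"
      using real by (intro nn_integral_cong) (auto simp: indicator_def)
    also have "\<dots> = ennreal (?F t - ?F 0)"
      using real f0 by (intro nn_integral_FTC_Icc d) auto
    finally have 1: "(\<integral>\<^sup>+s. indicator {s. 0 \<le> s \<and> ennreal s \<le> \<tau>} s * ennreal (?f s) \<partial>lborel) = ennreal (K - K * exp (- lam * t))" by simp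
    have "K * exp (- lam * t) \<le> K * 1" using lam K real by (intro mult_left_mono) auto
    then show ?thesis unfolding 1 using real K discount_ennreal[of t]
      by (simp add: ennreal_mult[symmetric] ennreal_plus[symmetric] del: ennreal_plus)
  next
    case top
    have "(\<integral>\<^sup>+s. indicator {s. 0 \<le> s \<and> ennreal s \<le> \<tau>} s * ennreal (?f s) \<partial>lborel) = (\<integral>\<^sup>+s. ennreal (?f s) * indicator {0..} s \<partial>lborel)"
      using top by (intro nn_integral_cong) (auto simp: indicator_def)
    also have "\<dots> = ennreal (0 - ?F 0)"
    proof (rule nn_integral_FTC_atLeast)
      have "((\<lambda>s. exp (- (lam * s))) \<longlongrightarrow> 0) at_top"
        using lam by (intro filterlim_compose[OF exp_at_bot] filterlim_uminus_at_bot_at_top[THEN filterlim_compose]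
            filterlim_tendsto_pos_mult_at_top[OF tendsto_const] filterlim_ident)
      from tendsto_mult_right_zero[OF this, of "- K"] show "(?F \<longlongrightarrow> 0) at_top" by simp
    qed (use d f0 in auto)
    finally show ?thesis using top by (simp add: discount_def)
  qed
qed

context
  fixes x y :: "real \<Rightarrow> real \<Rightarrow> real" and \<Phi> :: "real \<times> real \<Rightarrow> real \<Rightarrow> 'a \<Rightarrow> real \<times> real"
  assumes x_ode: "\<And>t v. ((\<lambda>s. x s v) has_real_derivative (lam + 1) * x t v + a) (at t)"
    and x_init: "\<And>v. x 0 v = v"
    and y_ode: "\<And>t v. ((\<lambda>s. y s v) has_real_derivative (lam - 1) * y t v + b) (at t)"
    and y_init: "\<And>v. y 0 v = v"
    and \<Phi>_init: "\<And>p \<omega>. p \<in> {0..} \<times> {0..} \<Longrightarrow> \<omega> \<in> space M \<Longrightarrow> \<Phi> p 0 \<omega> = p"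
    and \<Phi>_flow: "\<And>p \<omega> n t. p \<in> {0..} \<times> {0..} \<Longrightarrow> \<omega> \<in> space M \<Longrightarrow>
                  \<sigma> n \<omega> \<le> t \<Longrightarrow> t < \<sigma> (Suc n) \<omega> \<Longrightarrow>
                  \<Phi> p t \<omega> = (x (t - \<sigma> n \<omega>) (fst (\<Phi> p (\<sigma> n \<omega>) \<omega>)),
                             y (t - \<sigma> n \<omega>) (snd (\<Phi> p (\<sigma> n \<omega>) \<omega>)))"
    and \<Phi>_jump: "\<And>p \<omega> n. p \<in> {0..} \<times> {0..} \<Longrightarrow> \<omega> \<in> space M \<Longrightarrow> n \<ge> 1 \<Longrightarrow>
                  \<Phi> p (\<sigma> n \<omega>) \<omega> = jump_map \<mu> (Lim (at_left (\<sigma> n \<omega>)) (\<lambda>t. \<Phi> p t \<omega>))"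
begin

section \<open>Identification of the given process with the explicit state\<close>

lemma path_on_interval:
  assumes "\<omega> \<in> space M" "\<sigma> n \<omega> \<le> t" "t < \<sigma> (Suc n) \<omega>"
  shows "path \<omega> t = n"
  using N_eq_iff[of \<omega> t n] assms sigma_nonneg[of \<omega> n] by (auto simp: path_simps)

text \<open>Just before the jump the count is n, at the jump n + 1. The formula with the exponent n
  held fixed is continuous through the jump time, so the left limit lacks exactly one factor
  z.\<close>

lemma flow_jump_limit:
  assumes \<omega>: "\<omega> \<in> space M" and z: "0 < z"
  shows "(flow \<rho> z u (path \<omega>) v \<longlongrightarrow> flow \<rho> z u (path \<omega>) v (\<sigma> (Suc n) \<omega>) / z) (at_left (\<sigma> (Suc n) \<omega>))"
proof -
  let ?s = "\<sigma> (Suc n) \<omega>"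
  let ?I = "\<lambda>t. integral {0..t} (\<lambda>s. u * exp (- \<rho> * s) / z ^ path \<omega> s)"
  note w = counting_path_path[OF \<omega>] z
  have s: "\<sigma> n \<omega> < ?s" using sigma_less_iff[OF \<omega>, of n "Suc n"] by simp
  have s0: "0 < ?s" using s sigma_nonneg[OF \<omega>, of n] by simp
  have "continuous_on {0..?s} (\<lambda>t. exp (\<rho> * t) * z ^ n * (v + ?I t))"
    by (intro continuous_intros continuous_flow_integral[OF w])
  then have "((\<lambda>t. exp (\<rho> * t) * z ^ n * (v + ?I t)) \<longlongrightarrow> exp (\<rho> * ?s) * z ^ n * (v + ?I ?s)) (at ?s within {0..?s})"
    using s0 by (auto simp: continuous_on)
  then have lim: "((\<lambda>t. exp (\<rho> * t) * z ^ n * (v + ?I t)) \<longlongrightarrow> exp (\<rho> * ?s) * z ^ n * (v + ?I ?s)) (at_left ?s)"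
    using at_within_Icc_at_left[OF s0] by simp
  have eq: "exp (\<rho> * ?s) * z ^ n * (v + ?I ?s) = flow \<rho> z u (path \<omega>) v ?s / z"
  proof -
    have "path \<omega> ?s = Suc n"
      using sigma_less_iff[OF \<omega>, of "Suc n" "Suc (Suc n)"] by (intro path_on_interval \<omega>) auto
    then show ?thesis using z unfolding flow_eq_HK(1)[OF w] by simp
  qed
  have ev: "eventually (\<lambda>t. exp (\<rho> * t) * z ^ n * (v + ?I t) = flow \<rho> z u (path \<omega>) v t) (at_left ?s)"
    using eventually_at_left_real[OF s]
  proof eventually_elim
    case (elim t)
    then have "path \<omega> t = n" by (intro path_on_interval \<omega>) auto
    then show ?case unfolding flow_eq_HK(1)[OF w] by simp
  qed
  from Lim_transform_eventually[OF lim ev] show ?thesis by (simp only: eq)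
qed

text \<open>Until the next jump the shifted path vanishes, so the restart formula for
  \<open>flow\<close> becomes the solution formula of the linear equation, which is unique.\<close>

lemma \<Phi>_eq_state_interval:
  assumes p: "p \<in> {0..} \<times> {0..}" and \<omega>: "\<omega> \<in> space M"
    and start: "\<Phi> p (\<sigma> n \<omega>) \<omega> = state p (path \<omega>) (\<sigma> n \<omega>)" and t: "\<sigma> n \<omega> \<le> t" "t < \<sigma> (Suc n) \<omega>"
  shows "\<Phi> p t \<omega> = state p (path \<omega>) t"
proof -
  let ?s = "\<sigma> n \<omega>"
  note w = counting_path_path[OF \<omega>]
  have s0: "0 \<le> ?s" by (rule sigma_nonneg[OF \<omega>])
  have zero: "incr ?s \<omega> u = 0" if "0 \<le> u" "u \<le> t - ?s" for u
    using that t path_on_interval[OF \<omega>, of n "?s + u"] path_on_interval[OF \<omega>, of n ?s] by (simp add: shift_path_simps)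
  have fl: "flow \<rho> z u (path \<omega>) v t = exp (\<rho> * (t - ?s)) * (flow \<rho> z u (path \<omega>) v ?s + integral {0..t - ?s} (\<lambda>r. u * exp (- \<rho> * r)))"
    if z: "0 < z" for \<rho> z u v
    using flow_add[OF w z s0, of "t - ?s" \<rho> u v] flow_zero_path[OF z, of "t - ?s" "incr ?s \<omega>"] t zero counting_path_shift[OF w]
    by simp
  have "x (t - ?s) v = exp ((lam + 1) * (t - ?s)) * (v + integral {0..t - ?s} (\<lambda>s. a * exp (- (lam + 1) * s)))" for v
    using linear_ode_unique[of "\<lambda>s. x s v" "lam + 1" a "t - ?s"] x_ode t by (simp add: x_init)
  moreover have "y (t - ?s) v = exp ((lam - 1) * (t - ?s)) * (v + integral {0..t - ?s} (\<lambda>s. b * exp (- (lam - 1) * s)))" for v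
    using linear_ode_unique[of "\<lambda>s. y s v" "lam - 1" b "t - ?s"] y_ode t by (simp add: y_init)
  ultimately show ?thesis
    unfolding \<Phi>_flow[OF p \<omega> t] start state_def fst_conv snd_conv fl[OF z_pos(1)] fl[OF z_pos(2)] by simp
qed

text \<open>Induction over the jumps: the left limit is the state at the jump with each coordinate
  divided by its factor, and \<open>jump_map\<close> multiplies the factors back.\<close>

lemma \<Phi>_eq_state:
  assumes p: "p \<in> {0..} \<times> {0..}" and \<omega>: "\<omega> \<in> space M" and t: "0 \<le> t"
  shows "\<Phi> p t \<omega> = state p (path \<omega>) t"
proof -
  have start: "\<Phi> p (\<sigma> n \<omega>) \<omega> = state p (path \<omega>) (\<sigma> n \<omega>)" for n
  proof (induction n)
    case 0
    have "path \<omega> 0 = 0" by (simp add: path_simps N_0 \<omega>)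
    then show ?case by (simp add: sigma_0 \<omega> \<Phi>_init p state_0 counting_path_path)
  next
    case (Suc n)
    let ?s = "\<sigma> (Suc n) \<omega>"
    have s: "\<sigma> n \<omega> < ?s" using sigma_less_iff[OF \<omega>, of n "Suc n"] by simp
    let ?q = "state p (path \<omega>) ?s"
    have "(state p (path \<omega>) \<longlongrightarrow> (fst ?q / (1 - 1/\<mu>), snd ?q / (1 + 1/\<mu>))) (at_left ?s)"
      unfolding state_def fst_conv snd_conv by (intro tendsto_Pair flow_jump_limit \<omega> z_pos)
    moreover have "eventually (\<lambda>t. state p (path \<omega>) t = \<Phi> p t \<omega>) (at_left ?s)"
      using eventually_at_left_real[OF s] by eventually_elim (auto simp: \<Phi>_eq_state_interval[OF p \<omega> Suc])
    ultimately have "((\<lambda>t. \<Phi> p t \<omega>) \<longlongrightarrow> (fst ?q / (1 - 1/\<mu>), snd ?q / (1 + 1/\<mu>))) (at_left ?s)"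
      by (rule Lim_transform_eventually)
    then have "Lim (at_left ?s) (\<lambda>t. \<Phi> p t \<omega>) = (fst ?q / (1 - 1/\<mu>), snd ?q / (1 + 1/\<mu>))"
      by (intro tendsto_Lim) auto
    then show ?case using \<Phi>_jump[OF p \<omega>, of "Suc n"] z_pos mu_gt_1 by (simp add: jump_map_def)
  qed
  let ?n = "N t \<omega>"
  have "\<sigma> ?n \<omega> \<le> t" "t < \<sigma> (Suc ?n) \<omega>" using N_eq_iff[OF \<omega> t, of ?n] by auto
  then show ?thesis by (rule \<Phi>_eq_state_interval[OF p \<omega> start])
qed

text \<open>\<open>ext_integral_diff\<close> is applied twice, to the time integral on each path and
  to the expectation. The subtracted part is finite both times, so infinite costs do no
  harm.\<close>

lemma expected_cost_eq:
  assumes K_eq: "K = sqrt 2 / c" and p: "p \<in> {0..} \<times> {0..}" and \<tau>: "\<tau> \<in> borel_measurable M"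
  shows "expected_cost M lam c \<Phi> p \<tau> = enn2ereal (\<integral>\<^sup>+\<omega>. cost p (path \<omega>) (\<tau> \<omega>) \<partial>M) - ereal K"
proof -
  note [measurable] = \<tau>
  have inner: "ext_integral lborel (\<lambda>t. ereal (indicator {t. 0 \<le> t \<and> ennreal t \<le> \<tau> \<omega>} t *
              (exp (- lam * t) * running_cost lam c (\<Phi> p t \<omega>)))) = enn2ereal (cost p (path \<omega>) (\<tau> \<omega>)) - enn2ereal (ennreal K)"
    if \<omega>: "\<omega> \<in> space M" for \<omega>
  proof -
    let ?i = "\<lambda>t. indicator {t. 0 \<le> t \<and> ennreal t \<le> \<tau> \<omega>} t"
    let ?A = "\<lambda>t. ?i t * (ennreal (exp (- lam * t)) * total_mass (state p (path \<omega>) t))"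
    let ?B = "\<lambda>t. ?i t * ennreal (exp (- lam * t) * (lam * K))"
    let ?R = "run_until p (path \<omega>) (\<tau> \<omega>)"
    define E where "E = (\<integral>\<^sup>+t. ?B t \<partial>lborel)"
    have E: "E + ennreal K * discount (\<tau> \<omega>) = ennreal K" unfolding E_def by (rule discounted_constant)
    have [measurable]: "(\<lambda>t. state p (path \<omega>) t) \<in> borel_measurable borel"
      by (rule measurable_state_path) (use \<omega> in auto)
    have Efin: "E < \<top>" using E by (metis add_increasing2 ennreal_less_top le_less_trans order_refl zero_le)
    have dfin: "ennreal K * discount (\<tau> \<omega>) < \<top>" using E by (metis add_increasing ennreal_less_top le_less_trans order_refl zero_le)
    have "ext_integral lborel (\<lambda>t. ereal (?i t * (exp (- lam * t) * running_cost lam c (\<Phi> p t \<omega>)))) = enn2ereal ?R - enn2ereal E"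
      unfolding run_until_def E_def
    proof (rule ext_integral_diff)
      show "(\<integral>\<^sup>+t. ?B t \<partial>lborel) < \<top>" using Efin by (simp add: E_def)
      show "?B t < \<top>" for t by (simp add: indicator_def)
      fix t :: real
      show "ereal (?i t * (exp (- lam * t) * running_cost lam c (\<Phi> p t \<omega>))) = enn2ereal (?A t) - enn2ereal (?B t)"
      proof (cases "0 \<le> t \<and> ennreal t \<le> \<tau> \<omega>")
        case True
        obtain q0 q1 where q: "state p (path \<omega>) t = (q0, q1)" "0 \<le> q0" "0 \<le> q1"
          using state_nonneg[OF p, of "path \<omega>" t] by (cases "state p (path \<omega>) t") auto
        have "running_cost lam c (\<Phi> p t \<omega>) = q0 + q1 - lam * K"
          using True q by (simp add: running_cost_def \<Phi>_eq_state[OF p \<omega>] K_eq)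
        moreover have "?A t = ennreal (exp (- lam * t) * (q0 + q1))"
          using True q by (simp add: total_mass_def ennreal_mult)
        moreover have "?B t = ennreal (exp (- lam * t) * (lam * K))" using True by simp
        ultimately show ?thesis using True q lam K by (simp add: right_diff_distrib)
      qed simp
    qed measurable
    \<comment> \<open>Adding the same finite payment to both terms turns the subtracted one into the
      constant K.\<close>
    also have "\<dots> = enn2ereal (?R + ennreal K * discount (\<tau> \<omega>)) - enn2ereal (E + ennreal K * discount (\<tau> \<omega>))"
      using Efin dfin by (cases ?R; cases E; cases "ennreal K * discount (\<tau> \<omega>)") (auto simp: ennreal_plus[symmetric] simp del: ennreal_plus)
    finally show ?thesis unfolding E cost_def .
  qed
  have "expected_cost M lam c \<Phi> p \<tau> = enn2ereal (\<integral>\<^sup>+\<omega>. cost p (path \<omega>) (\<tau> \<omega>) \<partial>M) - enn2ereal (\<integral>\<^sup>+\<omega>. ennreal K \<partial>M)"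
    unfolding expected_cost_def
  proof (rule ext_integral_diff)
    show "(\<integral>\<^sup>+\<omega>. ennreal K \<partial>M) < \<top>" by (simp add: emeasure_space_1)
    show "(\<lambda>\<omega>. cost p (path \<omega>) (\<tau> \<omega>)) \<in> borel_measurable M" by measurable
  qed (simp_all only: inner ennreal_less_top borel_measurable_const)
  then show ?thesis using K by (simp add: emeasure_space_1)
qed

section \<open>Stopping times of the augmented filtration and the value function\<close>

lemma sets_augmented:
  assumes "0 \<le> t" "s < ennreal t" "A \<in> sets (augmented_filtration M N s)"
  shows "A \<in> sets (past t)"
proof -
  let ?S = "{A \<in> sets M. \<forall>r\<ge>0. s < ennreal r \<longrightarrow> A \<in> sigma_sets (space M) (natural_events M N r \<union> null_sets M)}"
  have "?S \<subseteq> sets (past t)" using assms unfolding sets_past by auto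
  moreover have "sets (augmented_filtration M N s) = sigma_sets (space M) ?S"
    unfolding augmented_filtration_def using sets.sets_into_space by (intro sets_measure_of) auto
  ultimately show ?thesis
    using assms(3) sets.sigma_sets_subset[of ?S "past t"] by auto
qed

lemma space_augmented: "space (augmented_filtration M N s) = space M"
  unfolding augmented_filtration_def using sets.sets_into_space by (intro space_measure_of) auto

text \<open>The enlarged sigma-algebra at s lies in the past at any later t, and {\<tau> < t}
  involves only s < t. Strict inequalities are the form used by the lower bound.\<close>

lemma stopping_time_less:
  assumes \<tau>: "stopping_time (augmented_filtration M N) \<tau>" and t: "0 \<le> t"
  shows "{\<omega>\<in>space M. \<tau> \<omega> < ennreal t} \<in> sets (past t)"
proof (rule sets_past_lessI[OF t])
  fix s assume s: "0 \<le> s" "s < t"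
  have "{\<omega>\<in>space M. \<tau> \<omega> \<le> ennreal s} \<in> sets (augmented_filtration M N (ennreal s))"
    using stopping_timeD[OF \<tau>, of "ennreal s"] unfolding pred_def by (simp add: space_augmented)
  then show "{\<omega>\<in>space M. \<tau> \<omega> \<le> ennreal s} \<in> sets (past t)"
    using s by (intro sets_augmented[OF t]) (auto intro: ennreal_lessI)
qed

text \<open>For finite t the event lies in the past at t, hence in every later one; at infinity it
  is the whole space.\<close>

lemma stopping_time_hit: "stopping_time (augmented_filtration M N) (hit \<epsilon> p)"
  unfolding stopping_time_def
proof
  fix t :: ennreal
  let ?E = "{\<omega>\<in>space M. hit \<epsilon> p \<omega> \<le> t}"
  have "?E \<in> {A \<in> sets M. \<forall>r\<ge>0. t < ennreal r \<longrightarrow> A \<in> sigma_sets (space M) (natural_events M N r \<union> null_sets M)}"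
  proof (cases t)
    case (real u)
    then have "?E \<in> sets (past u)" using hit_adapted[of u \<epsilon> p] by simp
    then show ?thesis using real past_mono[of u] sets_past_subset
      by (auto simp: ennreal_less_iff simp flip: sets_past) (meson less_imp_le subsetD)
  next
    case top
    then show ?thesis using sets.top[of M] by simp
  qed
  then have "?E \<in> sets (augmented_filtration M N t)"
    unfolding augmented_filtration_def by (subst sets_measure_of) (auto dest: sets.sets_into_space intro: sigma_sets.Basic)
  then show "Measurable.pred (augmented_filtration M N t) (\<lambda>\<omega>. hit \<epsilon> p \<omega> \<le> t)"
    unfolding pred_def by (simp add: space_augmented)
qed

text \<open>The hitting time with tolerance 0 attains the lower bound valid for every stopping time,
  so no minimizing sequence is involved.\<close>

lemma value_function_eq:
  assumes K_eq: "K = sqrt 2 / c" and p: "p \<in> {0..} \<times> {0..}"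
  shows "value_function M N lam c \<Phi> p = enn2ereal (limit_value p) - ereal K"
proof (rule antisym)
  have "value_function M N lam c \<Phi> p \<le> expected_cost M lam c \<Phi> p (hit 0 p)"
    unfolding value_function_def by (rule INF_lower) (simp add: stopping_time_hit)
  also have "\<dots> = enn2ereal (\<integral>\<^sup>+\<omega>. cost p (path \<omega>) (hit 0 p \<omega>) \<partial>M) - ereal K"
    by (intro expected_cost_eq K_eq p measurable_time stopping_time_less stopping_time_hit)
  also have "\<dots> \<le> enn2ereal (limit_value p) - ereal K"
    using expected_cost_hit_zero[of p] by (intro ereal_minus_mono) (auto simp: less_eq_ennreal.rep_eq)
  finally show "value_function M N lam c \<Phi> p \<le> enn2ereal (limit_value p) - ereal K" .
  show "enn2ereal (limit_value p) - ereal K \<le> value_function M N lam c \<Phi> p"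
    unfolding value_function_def
  proof (rule INF_greatest)
    fix \<tau> assume "\<tau> \<in> {\<tau>. stopping_time (augmented_filtration M N) \<tau>}"
    then have less: "{\<omega>\<in>space M. \<tau> \<omega> < ennreal t} \<in> sets (past t)" if "0 \<le> t" for t
      using that by (simp add: stopping_time_less)
    have "limit_value p \<le> (\<integral>\<^sup>+\<omega>. cost p (path \<omega>) (\<tau> \<omega>) \<partial>M)" by (rule limit_value_le_cost[OF less])
    then have "enn2ereal (limit_value p) - ereal K \<le> enn2ereal (\<integral>\<^sup>+\<omega>. cost p (path \<omega>) (\<tau> \<omega>) \<partial>M) - ereal K"
      by (intro ereal_minus_mono) (auto simp: less_eq_ennreal.rep_eq)
    also have "\<dots> = expected_cost M lam c \<Phi> p \<tau>"
      by (rule expected_cost_eq[symmetric, OF K_eq p measurable_time[OF less]])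
    finally show "enn2ereal (limit_value p) - ereal K \<le> expected_cost M lam c \<Phi> p \<tau>" .
  qed
qed

text \<open>The state stays in the quadrant, so the formula for the value function applies at every
  state visited.\<close>

lemma hitting_time_eq:
  assumes K_eq: "K = sqrt 2 / c" and p: "p \<in> {0..} \<times> {0..}" and \<omega>: "\<omega> \<in> space M" and \<epsilon>: "0 \<le> \<epsilon>"
  shows "hitting_time M N lam c \<Phi> \<epsilon> p \<omega> = hit \<epsilon> p \<omega>"
proof -
  have "ereal (- \<epsilon>) \<le> value_function M N lam c \<Phi> (\<Phi> p t \<omega>) \<longleftrightarrow> ennreal K \<le> limit_value (state p (path \<omega>) t) + ennreal \<epsilon>"
    if t: "0 \<le> t" for t
  proof -
    let ?q = "state p (path \<omega>) t"
    obtain v where v: "limit_value ?q = ennreal v" "0 \<le> v"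
      using limit_value_le[of ?q] by (cases "limit_value ?q") (auto simp: top_unique)
    have "value_function M N lam c \<Phi> (\<Phi> p t \<omega>) = ereal (v - K)"
      unfolding \<Phi>_eq_state[OF p \<omega> t] value_function_eq[OF K_eq state_nonneg[OF p]] v using v by simp
    then show ?thesis unfolding v using v K \<epsilon> by (auto simp: ennreal_plus[symmetric] ennreal_le_iff simp del: ennreal_plus)
  qed
  then have "{t. 0 \<le> t \<and> ereal (- \<epsilon>) \<le> value_function M N lam c \<Phi> (\<Phi> p t \<omega>)} = stop_times \<epsilon> p \<omega>"
    by (auto simp: stop_times_def)
  then show ?thesis by (simp add: hitting_time_def hit_def)
qed

theorem hitting_time_optimal:
  assumes K_eq: "K = sqrt 2 / c" and p: "p \<in> {0..} \<times> {0..}" and \<epsilon>: "0 \<le> \<epsilon>"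
  shows "stopping_time (augmented_filtration M N) (hitting_time M N lam c \<Phi> \<epsilon> p)"
    and "expected_cost M lam c \<Phi> p (hitting_time M N lam c \<Phi> \<epsilon> p) \<le> value_function M N lam c \<Phi> p + ereal \<epsilon>"
proof -
  note eq = hitting_time_eq[OF K_eq p _ \<epsilon>]
  show st: "stopping_time (augmented_filtration M N) (hitting_time M N lam c \<Phi> \<epsilon> p)"
    by (rule stopping_time_cong[THEN iffD2, OF _ stopping_time_hit]) (simp add: space_augmented eq)
  have "(\<integral>\<^sup>+\<omega>. cost p (path \<omega>) (hit \<epsilon> p \<omega>) \<partial>M) \<le> limit_value p + ennreal \<epsilon>"
    using expected_cost_hit_pos[of \<epsilon> p] expected_cost_hit_zero[of p] \<epsilon> by (cases "\<epsilon> = 0") auto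
  moreover have "(\<integral>\<^sup>+\<omega>. cost p (path \<omega>) (hitting_time M N lam c \<Phi> \<epsilon> p \<omega>) \<partial>M) = (\<integral>\<^sup>+\<omega>. cost p (path \<omega>) (hit \<epsilon> p \<omega>) \<partial>M)"
    by (intro nn_integral_cong) (simp add: eq)
  ultimately have le: "(\<integral>\<^sup>+\<omega>. cost p (path \<omega>) (hitting_time M N lam c \<Phi> \<epsilon> p \<omega>) \<partial>M) \<le> limit_value p + ennreal \<epsilon>" by simp
  have "expected_cost M lam c \<Phi> p (hitting_time M N lam c \<Phi> \<epsilon> p)
      = enn2ereal (\<integral>\<^sup>+\<omega>. cost p (path \<omega>) (hitting_time M N lam c \<Phi> \<epsilon> p \<omega>) \<partial>M) - ereal K"
    by (intro expected_cost_eq K_eq p measurable_time stopping_time_less st)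
  also have "\<dots> \<le> enn2ereal (limit_value p + ennreal \<epsilon>) - ereal K"
    using le by (intro ereal_minus_mono) (auto simp: less_eq_ennreal.rep_eq)
  also have "\<dots> = (enn2ereal (limit_value p) - ereal K) + ereal \<epsilon>"
    using limit_value_le[of p] \<epsilon> by (cases "limit_value p") (auto simp: ennreal_plus[symmetric] top_unique simp del: ennreal_plus)
  finally show "expected_cost M lam c \<Phi> p (hitting_time M N lam c \<Phi> \<epsilon> p) \<le> value_function M N lam c \<Phi> p + ereal \<epsilon>"
    unfolding value_function_eq[OF K_eq p] .
qed

end

end

theorem proposition5p12:
  fixes M :: "'a measure"
    and N :: "real \<Rightarrow> 'a \<Rightarrow> nat"
    and \<sigma> :: "nat \<Rightarrow> 'a \<Rightarrow> real"
    and lam \<mu> c m :: real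
    and x y :: "real \<Rightarrow> real \<Rightarrow> real"
    and \<Phi> :: "real \<times> real \<Rightarrow> real \<Rightarrow> 'a \<Rightarrow> real \<times> real"
    and \<epsilon> :: real
  assumes "lam > 0" and "\<mu> > 1" and "c > 0" and "-1 < m" and "m < 1"
    and "prob_space M"
    and "homogeneous_poisson_process M \<mu> N \<sigma>"
    and x_ode: "\<And>t a. ((\<lambda>s. x s a) has_real_derivative
                  (lam + 1) * x t a + lam * (1 - m) / sqrt 2) (at t)"
    and x_init: "\<And>a. x 0 a = a"
    and y_ode: "\<And>t b. ((\<lambda>s. y s b) has_real_derivative
                  (lam - 1) * y t b + lam * (1 + m) / sqrt 2) (at t)"
    and y_init: "\<And>b. y 0 b = b"
    and \<Phi>_init: "\<And>p \<omega>. p \<in> {0..} \<times> {0..} \<Longrightarrow> \<omega> \<in> space M \<Longrightarrow> \<Phi> p 0 \<omega> = p"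
    and \<Phi>_flow: "\<And>p \<omega> n t. p \<in> {0..} \<times> {0..} \<Longrightarrow> \<omega> \<in> space M \<Longrightarrow>
                  \<sigma> n \<omega> \<le> t \<Longrightarrow> t < \<sigma> (Suc n) \<omega> \<Longrightarrow>
                  \<Phi> p t \<omega> = (x (t - \<sigma> n \<omega>) (fst (\<Phi> p (\<sigma> n \<omega>) \<omega>)),
                             y (t - \<sigma> n \<omega>) (snd (\<Phi> p (\<sigma> n \<omega>) \<omega>)))"
    and \<Phi>_jump: "\<And>p \<omega> n. p \<in> {0..} \<times> {0..} \<Longrightarrow> \<omega> \<in> space M \<Longrightarrow> n \<ge> 1 \<Longrightarrow>
                  \<Phi> p (\<sigma> n \<omega>) \<omega> = jump_map \<mu> (Lim (at_left (\<sigma> n \<omega>)) (\<lambda>t. \<Phi> p t \<omega>))"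
    and "\<epsilon> \<ge> 0"
  shows "\<forall>p \<in> {0..} \<times> {0..}.
           stopping_time (augmented_filtration M N) (hitting_time M N lam c \<Phi> \<epsilon> p) \<and>
           expected_cost M lam c \<Phi> p (hitting_time M N lam c \<Phi> \<epsilon> p)
             \<le> value_function M N lam c \<Phi> p + ereal \<epsilon>"
proof (intro ballI conjI)
  fix p :: "real \<times> real" assume p: "p \<in> {0..} \<times> {0..}"
  interpret prob_space M by fact
  \<comment> \<open>The bounds -1 < m < 1 make both constant drift terms nonnegative.\<close>
  interpret stopping_problem M N \<sigma> \<mu> lam "lam * (1 - m) / sqrt 2" "lam * (1 + m) / sqrt 2" "sqrt 2 / c"
    using assms(1-5) by unfold_locales (auto simp: \<open>homogeneous_poisson_process M \<mu> N \<sigma>\<close>)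
  note optimal = hitting_time_optimal[OF x_ode x_init y_ode y_init \<Phi>_init \<Phi>_flow \<Phi>_jump refl p \<open>\<epsilon> \<ge> 0\<close>]
  show "stopping_time (augmented_filtration M N) (hitting_time M N lam c \<Phi> \<epsilon> p)"
    by (rule optimal(1))
  show "expected_cost M lam c \<Phi> p (hitting_time M N lam c \<Phi> \<epsilon> p) \<le> value_function M N lam c \<Phi> p + ereal \<epsilon>"
    by (rule optimal(2))
qed

end
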